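(* Let $(h,\tau,I)\in\mathcal{G}$ and let $\mathcal{M}$ be an $(h,\tau)$-exponential family in $\mathcal{P}_I(\mu)$. If $\mathcal{X}$ is compact and $\mathbb{I}_\tau$ is constant on $\mathcal{M}$, then $(g^{h,\tau},\nabla^{h,\tau})$ is a Hessian structure on $\mathcal{M}$ and its global potential is $-\mathbb{I}_{s^\star_{h,\tau}}+\psi\,\mathbb{I}_\tau$, where $\psi$ is a global $(h,\tau)$-exponential normalization of $\mathcal{M}$ and $s^\star_{h,\tau}\colon I\to\mathbb{R}$ is defined by $s^\star_{h,\tau}:=-\tau\cdot(h'\circ\tau)+(h\circ\tau)$.
   Context: Setting: $\mathcal{X}$ is a topological space and $\mu$ is a Radon measure on $\mathcal{X}$ with support $\mathcal{X}$. Manifolds are smooth, Hausdorff, second countable, connected, without boundary. For an open interval $I\subset(0,\infty)$, $\mathcal{P}_I(\mu)=\{p\in L^1(\mu)\mid p\in I\ \mu\text{-a.e.},\ \|p\|_{L^1(\mu)}=1\}$ and $\mathcal{P}(\mu)=\mathcal{P}_{(0,\infty)}(\mu)$. A manifold in $\mathcal{P}_I(\mu)$ is a manifold whose underlying set is a subset of $\mathcal{P}_I(\mu)$; its elements are evaluated pointwise, $e_x(p):=p(x)$. $\mathcal{G}$ is the set of triples $(h,\tau,I)$ with $I\subset(0,\infty)$ an open interval, $\tau\in C^\infty(I)$ with $\tau'>0$ on $I$, and $h\in C^\infty(\tau(I))$ with $h''>0$ on $\tau(I)$. Put $\ell_{h,\tau}:=h'\circ\tau$ and $d_{h,\tau}(t,s):=h(\tau(t))-h(\tau(s))-(\tau(t)-\tau(s))h'(\tau(s))$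 for $s,t\in I$. For $\phi\in C^\infty(I)$, $\mathbb{I}_\phi(p):=\int_{\mathcal{X}}\phi(p(x))\,d\mu(x)$. Statistical model: a manifold $\mathcal{M}$ in $\mathcal{P}(\mu)$ is a statistical model if there is a $\mu$-null set $\mathcal{N}\subset\mathcal{X}$ such that: (a) the topology of $\mathcal{M}$ is the one induced by the family $(e_x)_{x\in\mathcal{X}\setminus\mathcal{N}}$; (b) $e_x\colon\mathcal{M}\to\mathbb{R}$ is smooth for $x\in\mathcal{X}\setminus\mathcal{N}$; (c) for $p\in\mathcal{M}$, the functions of $x$ given by the derivatives of $e_x$ of any order at $p$ are Borel; (d) for $V\in\mathfrak{X}(\mathcal{M})$ and $p\in\mathcal{M}$, $V_p(e_x)=0$ for all $x\in\mathcal{X}\setminus\mathcal{N}$ if and only if $V_p=0$; (e) for $V,W\in\mathfrak{X}(\mathcal{M})$, $p\in\mathcal{M}$, the functions $x\mapsto V_p(e_x)$ and $x\mapsto V_p(We_x)$ are in $L^1(\mu)$ and have integral $0$. $(h,\tau)$-exponential function: $\exp_{h,\tau}(u)=\ell_{h,\tau}^{-1}(u)$ for $u\in\ell_{h,\tau}(I)$, $=\infty$ for $u\ge\sup\ell_{h,\tau}(I)$, $=0$ for $u\le\inf\ell_{h,\tau}(I)$. For an $n$-dimensional manifold $\mathcal{M}$ in $\mathcal{P}_I(\mu)$, an $(h,\tau)$-exponential coordinate representation is a quintuple $(U,\theta,T,c,\psi)$ with $(U,\theta)$ a coordinate system on $\mathcal{M}$, $T\colon\mathcal{X}\to\mathbb{R}^n$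 and $c\colon\mathcal{X}\to\mathbb{R}$ continuous, $\psi\colon U\to\mathbb{R}$ smooth, and $p(x)=\exp_{h,\tau}(\langle\theta(p),T(x)\rangle-c(x)-\psi(p))$ for all $p\in U$, $x\in\mathcal{X}$, where elements of $\mathcal{M}$ are regarded as functions with values in $I$ at every point. It is global if $U=\mathcal{M}$; then $\psi$ is called a global $(h,\tau)$-exponential normalization of $\mathcal{M}$. $\mathcal{M}$ is an $(h,\tau)$-exponential family if it is a statistical model each point of which lies in the domain $U$ of such a representation. (An $(h,\tau)$-exponential family has a global representation, unique up to affine transformation.) Metric and connection: for $V\in\mathfrak{X}(\mathcal{M})$ put $\widetilde V:=(V,0)$, $\widehat V:=(0,V)\in\mathfrak{X}(\mathcal{M}\times\mathcal{M})$, and let $d_{h,\tau}\circ(e_x,e_x)$ denote $(p,p')\mapsto d_{h,\tau}(p(x),p'(x))$. Then $g^{h,\tau}$ and $\nabla^{h,\tau}$ are given by $$g^{h,\tau}_p(V,W)=-\int_{\mathcal{X}}\widetilde V_{(p,p)}\big(\widehat W(d_{h,\tau}\circ(e_x,e_x))\big)d\mu(x),\qquad g^{h,\tau}_p(\nabla^{h,\tau}_ZV,W)=-\int_{\mathcal{X}}\widehat Z_{(p,p)}\big(\widehat V\widetilde W(d_{h,\tau}\circ(e_x,e_x))\big)d\mu(x).$$ Hessian structure: a pair $(g,\nabla)$ of a Riemannian metric and a connection on $\mathcal{M}$ such that $\nabla$ is flat (torsion and curvature vanish) and locally $g=\nabla d\Psi$ for some smooth $\Psi$ (a local potential); $\Psi$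 is a global potential if it is defined on $\mathcal{M}$ and $g=\nabla d\Psi$ on $\mathcal{M}$. *)

theory Defs
  imports "HOL-Analysis.Analysis"
begin

section \<open>Smooth maps between Euclidean spaces\<close>

primrec Ck_on ::
  "nat \<Rightarrow> 'a::real_normed_vector set \<Rightarrow> ('a \<Rightarrow> 'b::real_normed_vector) \<Rightarrow> bool" where
  "Ck_on 0 S f \<longleftrightarrow> continuous_on S f"
| "Ck_on (Suc k) S f \<longleftrightarrow>
     (\<forall>x\<in>S. f differentiable (at x)) \<and> (\<forall>v. Ck_on k S (\<lambda>x. frechet_derivative f (at x) v))"

text \<open>Only used for open sets \<open>S\<close> of finite-dimensional spaces.\<close>

definition smooth_on ::
  "'a::real_normed_vector set \<Rightarrow> ('a \<Rightarrow> 'b::real_normed_vector) \<Rightarrow> bool" where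
  "smooth_on S f \<longleftrightarrow> (\<forall>k. Ck_on k S f)"

primrec iterated_partial :: "'n::finite list \<Rightarrow> (real^'n \<Rightarrow> real) \<Rightarrow> real^'n \<Rightarrow> real" where
  "iterated_partial [] f = f"
| "iterated_partial (i # is) f = (\<lambda>y. frechet_derivative (iterated_partial is f) (at y) (axis i 1))"


section \<open>Smooth manifolds\<close>

text \<open>A chart is a pair of an open set and a map; the values of the map outside of that set are
  irrelevant, and its inverse is \<^term>\<open>inv_into U \<phi>\<close>.\<close>

record ('p, 'n) manifold =
  mtop :: "'p topology"
  atlas :: "('p set \<times> ('p \<Rightarrow> real^'n)) set"

definition carrier_of :: "('p, 'n::finite) manifold \<Rightarrow> 'p set" where
  "carrier_of M = topspace (mtop M)"

definition chart :: "'p topology \<Rightarrow> 'p set \<Rightarrow> ('p \<Rightarrow> real^'n::finite) \<Rightarrow> bool" where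
  "chart X U \<phi> \<longleftrightarrow> openin X U \<and> open (\<phi> ` U) \<and>
     homeomorphic_map (subtopology X U) (top_of_set (\<phi> ` U)) \<phi>"

definition smoothly_compatible ::
  "'p set \<times> ('p \<Rightarrow> real^'n::finite) \<Rightarrow> 'p set \<times> ('p \<Rightarrow> real^'n) \<Rightarrow> bool" where
  "smoothly_compatible = (\<lambda>(U, \<phi>) (V, \<xi>).
     smooth_on (\<phi> ` (U \<inter> V)) (\<xi> \<circ> inv_into U \<phi>) \<and>
     smooth_on (\<xi> ` (U \<inter> V)) (\<phi> \<circ> inv_into V \<xi>))"

definition is_manifold :: "('p, 'n::finite) manifold \<Rightarrow> bool" where
  "is_manifold M \<longleftrightarrow>
     Hausdorff_space (mtop M) \<and> second_countable (mtop M) \<and> connected_space (mtop M) \<and>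
     (\<forall>(U, \<phi>)\<in>atlas M. chart (mtop M) U \<phi>) \<and>
     (\<Union>(U, \<phi>)\<in>atlas M. U) = carrier_of M \<and>
     (\<forall>C\<in>atlas M. \<forall>D\<in>atlas M. smoothly_compatible C D)"

text \<open>The atlas is not required to be maximal; the coordinate systems are the elements of the
  maximal atlas it generates.\<close>

definition coordinate_system ::
  "('p, 'n::finite) manifold \<Rightarrow> 'p set \<Rightarrow> ('p \<Rightarrow> real^'n) \<Rightarrow> bool" where
  "coordinate_system M U \<theta> \<longleftrightarrow>
     chart (mtop M) U \<theta> \<and> (\<forall>C\<in>atlas M. smoothly_compatible (U, \<theta>) C)"

definition smooth_fun :: "('p, 'n::finite) manifold \<Rightarrow> 'p set \<Rightarrow> ('p \<Rightarrow> real) \<Rightarrow> bool" where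
  "smooth_fun M U f \<longleftrightarrow> openin (mtop M) U \<and>
     (\<forall>(V, \<phi>)\<in>atlas M. smooth_on (\<phi> ` (U \<inter> V)) (f \<circ> inv_into V \<phi>))"

definition smooth_at :: "('p, 'n::finite) manifold \<Rightarrow> 'p \<Rightarrow> ('p \<Rightarrow> real) \<Rightarrow> bool" where
  "smooth_at M p f \<longleftrightarrow> (\<exists>U. p \<in> U \<and> smooth_fun M U f)"


section \<open>Vector fields\<close>

text \<open>A tangent vector at \<open>p\<close> is the directional derivative \<open>f \<mapsto> \<Sum>\<^sub>i a\<^sub>i (\<partial>f/\<partial>\<phi>\<^sup>i)(p)\<close> in some
  chart \<open>\<phi>\<close> around \<open>p\<close>, acting on the functions that are smooth near \<open>p\<close>.  It is
  extended by \<open>0\<close> to all other functions, and vector fields are extended by the zero functional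
  outside of the manifold, so that equality of tangent vectors and of vector fields is
  equality of HOL functions.\<close>

type_synonym 'p tangent = "('p \<Rightarrow> real) \<Rightarrow> real"
type_synonym 'p vfield = "'p \<Rightarrow> 'p tangent"

definition tangent_space :: "('p, 'n::finite) manifold \<Rightarrow> 'p \<Rightarrow> 'p tangent set" where
  "tangent_space M p = {v. \<exists>(U, \<phi>)\<in>atlas M. p \<in> U \<and> (\<exists>a.
     v = (\<lambda>f. if smooth_at M p f
               then frechet_derivative (f \<circ> inv_into U \<phi>) (at (\<phi> p)) a else 0))}"

definition vector_fields :: "('p, 'n::finite) manifold \<Rightarrow> 'p vfield set" where
  "vector_fields M = {V.
     (\<forall>p\<in>carrier_of M. V p \<in> tangent_space M p) \<and>
     (\<forall>p. p \<notin> carrier_of M \<longrightarrow> V p = (\<lambda>f. 0)) \<and>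
     (\<forall>U f. smooth_fun M U f \<longrightarrow> smooth_fun M U (\<lambda>p. V p f))}"

definition vf_add :: "'p vfield \<Rightarrow> 'p vfield \<Rightarrow> 'p vfield" where
  "vf_add V W = (\<lambda>p f. V p f + W p f)"

definition vf_mult :: "('p \<Rightarrow> real) \<Rightarrow> 'p vfield \<Rightarrow> 'p vfield" where
  "vf_mult \<phi> V = (\<lambda>p f. \<phi> p * V p f)"

definition vf_bracket ::
  "('p, 'n::finite) manifold \<Rightarrow> 'p vfield \<Rightarrow> 'p vfield \<Rightarrow> 'p vfield" where
  "vf_bracket M V W = (\<lambda>p f.
     if smooth_at M p f then V p (\<lambda>q. W q f) - W p (\<lambda>q. V q f) else 0)"

text \<open>The vector fields \<open>(V, 0)\<close> and \<open>(0, V)\<close> on the product manifold: they differentiate a function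
  of two variables with respect to one variable, with the other one held fixed.\<close>

definition vf_left :: "'p vfield \<Rightarrow> ('p \<times> 'p) vfield" where
  "vf_left V = (\<lambda>(p, p') F. V p (\<lambda>q. F (q, p')))"

definition vf_right :: "'p vfield \<Rightarrow> ('p \<times> 'p) vfield" where
  "vf_right V = (\<lambda>(p, p') F. V p' (\<lambda>q'. F (p, q')))"


section \<open>Metrics, connections, Hessian structures\<close>

text \<open>Tensor fields are multilinear over the ring of smooth functions.\<close>

type_synonym 'p metric = "'p vfield \<Rightarrow> 'p vfield \<Rightarrow> 'p \<Rightarrow> real"
type_synonym 'p connection = "'p vfield \<Rightarrow> 'p vfield \<Rightarrow> 'p vfield"

definition riemannian_metric :: "('p, 'n::finite) manifold \<Rightarrow> 'p metric \<Rightarrow> bool" where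
  "riemannian_metric M g \<longleftrightarrow>
     (\<forall>V\<in>vector_fields M. \<forall>W\<in>vector_fields M. smooth_fun M (carrier_of M) (g V W)) \<and>
     (\<forall>V\<in>vector_fields M. \<forall>W\<in>vector_fields M. \<forall>p\<in>carrier_of M. g V W p = g W V p) \<and>
     (\<forall>V\<in>vector_fields M. \<forall>V'\<in>vector_fields M. \<forall>W\<in>vector_fields M. \<forall>p\<in>carrier_of M.
        g (vf_add V V') W p = g V W p + g V' W p) \<and>
     (\<forall>\<phi>. smooth_fun M (carrier_of M) \<phi> \<longrightarrow>
        (\<forall>V\<in>vector_fields M. \<forall>W\<in>vector_fields M. \<forall>p\<in>carrier_of M.
          g (vf_mult \<phi> V) W p = \<phi> p * g V W p)) \<and>
     (\<forall>V\<in>vector_fields M. \<forall>p\<in>carrier_of M. V p \<noteq> (\<lambda>f. 0) \<longrightarrow> g V V p > 0)"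

text \<open>\<^term>\<open>nab Z V\<close> stands for \<open>\<nabla>\<^sub>Z V\<close>.\<close>

definition affine_connection :: "('p, 'n::finite) manifold \<Rightarrow> 'p connection \<Rightarrow> bool" where
  "affine_connection M nab \<longleftrightarrow>
     (\<forall>Z\<in>vector_fields M. \<forall>V\<in>vector_fields M. nab Z V \<in> vector_fields M) \<and>
     (\<forall>Z\<in>vector_fields M. \<forall>Z'\<in>vector_fields M. \<forall>V\<in>vector_fields M.
        nab (vf_add Z Z') V = vf_add (nab Z V) (nab Z' V)) \<and>
     (\<forall>Z\<in>vector_fields M. \<forall>V\<in>vector_fields M. \<forall>V'\<in>vector_fields M.
        nab Z (vf_add V V') = vf_add (nab Z V) (nab Z V')) \<and>
     (\<forall>\<phi>. smooth_fun M (carrier_of M) \<phi> \<longrightarrow>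
        (\<forall>Z\<in>vector_fields M. \<forall>V\<in>vector_fields M.
          nab (vf_mult \<phi> Z) V = vf_mult \<phi> (nab Z V) \<and>
          nab Z (vf_mult \<phi> V) = vf_add (vf_mult (\<lambda>p. Z p \<phi>) V) (vf_mult \<phi> (nab Z V))))"

definition torsion ::
  "('p, 'n::finite) manifold \<Rightarrow> 'p connection \<Rightarrow> 'p vfield \<Rightarrow> 'p vfield \<Rightarrow> 'p vfield" where
  "torsion M nab V W = (\<lambda>p f. nab V W p f - nab W V p f - vf_bracket M V W p f)"

definition curvature ::
  "('p, 'n::finite) manifold \<Rightarrow> 'p connection \<Rightarrow> 'p vfield \<Rightarrow> 'p vfield \<Rightarrow> 'p vfield \<Rightarrow> 'p vfield"
  where
  "curvature M nab V W Z = (\<lambda>p f.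
     nab V (nab W Z) p f - nab W (nab V Z) p f - nab (vf_bracket M V W) Z p f)"

definition flat_connection :: "('p, 'n::finite) manifold \<Rightarrow> 'p connection \<Rightarrow> bool" where
  "flat_connection M nab \<longleftrightarrow> affine_connection M nab \<and>
     (\<forall>V\<in>vector_fields M. \<forall>W\<in>vector_fields M. torsion M nab V W = (\<lambda>p f. 0)) \<and>
     (\<forall>V\<in>vector_fields M. \<forall>W\<in>vector_fields M. \<forall>Z\<in>vector_fields M.
        curvature M nab V W Z = (\<lambda>p f. 0))"

text \<open>\<open>(\<nabla>d\<Psi>)(V, W) = V(W\<Psi>) - (\<nabla>\<^sub>V W)\<Psi>\<close>\<close>

definition hessian ::
  "'p connection \<Rightarrow> ('p \<Rightarrow> real) \<Rightarrow> 'p vfield \<Rightarrow> 'p vfield \<Rightarrow> 'p \<Rightarrow> real" where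
  "hessian nab \<Psi> V W p = V p (\<lambda>q. W q \<Psi>) - nab V W p \<Psi>"

definition potential_on ::
  "('p, 'n::finite) manifold \<Rightarrow> 'p metric \<Rightarrow> 'p connection \<Rightarrow> 'p set \<Rightarrow> ('p \<Rightarrow> real) \<Rightarrow> bool" where
  "potential_on M g nab U \<Psi> \<longleftrightarrow> smooth_fun M U \<Psi> \<and>
     (\<forall>V\<in>vector_fields M. \<forall>W\<in>vector_fields M. \<forall>p\<in>U. g V W p = hessian nab \<Psi> V W p)"

definition hessian_structure ::
  "('p, 'n::finite) manifold \<Rightarrow> 'p metric \<Rightarrow> 'p connection \<Rightarrow> bool" where
  "hessian_structure M g nab \<longleftrightarrow> riemannian_metric M g \<and> flat_connection M nab \<and>
     (\<forall>p\<in>carrier_of M. \<exists>U \<Psi>. p \<in> U \<and> potential_on M g nab U \<Psi>)"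

definition global_potential ::
  "('p, 'n::finite) manifold \<Rightarrow> 'p metric \<Rightarrow> 'p connection \<Rightarrow> ('p \<Rightarrow> real) \<Rightarrow> bool" where
  "global_potential M g nab \<Psi> \<longleftrightarrow> potential_on M g nab (carrier_of M) \<Psi>"


section \<open>Manifolds of probability densities\<close>

text \<open>Borel, locally finite, and inner regular with respect to compact sets.\<close>

definition radon_measure :: "'x::topological_space measure \<Rightarrow> bool" where
  "radon_measure \<mu> \<longleftrightarrow> sets \<mu> = sets borel \<and>
     (\<forall>x. \<exists>U. open U \<and> x \<in> U \<and> emeasure \<mu> U < \<infinity>) \<and>
     (\<forall>B\<in>sets \<mu>. emeasure \<mu> B = (SUP K\<in>{K. compact K \<and> K \<in> sets \<mu> \<and> K \<subseteq> B}. emeasure \<mu> K))"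

definition measure_support :: "'x::topological_space measure \<Rightarrow> 'x set" where
  "measure_support \<mu> = {x. \<forall>U. open U \<longrightarrow> x \<in> U \<longrightarrow> emeasure \<mu> U > 0}"

definition prob_densities :: "'x measure \<Rightarrow> real set \<Rightarrow> ('x \<Rightarrow> real) set" where
  "prob_densities \<mu> I =
     {p. integrable \<mu> p \<and> (AE x in \<mu>. p x \<in> I) \<and> (\<integral>x. \<bar>p x\<bar> \<partial>\<mu>) = 1}"

text \<open>The elements of \<open>L\<^sup>1(\<mu>)\<close> in the manifold are evaluated pointwise, hence they are given by
  functions, with one representative for each class.\<close>

definition manifold_in_densities ::
  "'x measure \<Rightarrow> real set \<Rightarrow> ('x \<Rightarrow> real, 'n::finite) manifold \<Rightarrow> bool" where
  "manifold_in_densities \<mu> I M \<longleftrightarrow> is_manifold M \<and> carrier_of M \<subseteq> prob_densities \<mu> I \<and>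
     (\<forall>p\<in>carrier_of M. \<forall>q\<in>carrier_of M. (AE x in \<mu>. p x = q x) \<longrightarrow> p = q)"

definition ev :: "'x \<Rightarrow> ('x \<Rightarrow> real) \<Rightarrow> real" where
  "ev x = (\<lambda>p. p x)"

text \<open>The functions of \<open>x\<close> below are only meaningful outside of the null set \<open>N\<close>; their
  measurability and integrals are therefore taken on the complement of \<open>N\<close>.\<close>

definition statistical_model ::
  "'x::topological_space measure \<Rightarrow> ('x \<Rightarrow> real, 'n::finite) manifold \<Rightarrow> bool" where
  "statistical_model \<mu> M \<longleftrightarrow> manifold_in_densities \<mu> {0<..} M \<and>
     (\<exists>N\<in>null_sets \<mu>.
        mtop M = topology_generated_by {{p \<in> carrier_of M. ev x p \<in> S} | x S. x \<notin> N \<and> open S} \<and>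
        (\<forall>x. x \<notin> N \<longrightarrow> smooth_fun M (carrier_of M) (ev x)) \<and>
        (\<forall>(U, \<phi>)\<in>atlas M. \<forall>p\<in>U. \<forall>is.
           (\<lambda>x. iterated_partial is (ev x \<circ> inv_into U \<phi>) (\<phi> p))
             \<in> borel_measurable (restrict_space borel (- N))) \<and>
        (\<forall>V\<in>vector_fields M. \<forall>p\<in>carrier_of M.
           (\<forall>x. x \<notin> N \<longrightarrow> V p (ev x) = 0) \<longleftrightarrow> V p = (\<lambda>f. 0)) \<and>
        (\<forall>V\<in>vector_fields M. \<forall>W\<in>vector_fields M. \<forall>p\<in>carrier_of M.
           set_integrable \<mu> (- N) (\<lambda>x. V p (ev x)) \<and>
           (LINT x:- N|\<mu>. V p (ev x)) = 0 \<and>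
           set_integrable \<mu> (- N) (\<lambda>x. V p (\<lambda>q. W q (ev x))) \<and>
           (LINT x:- N|\<mu>. V p (\<lambda>q. W q (ev x))) = 0))"

definition integral_functional :: "'x measure \<Rightarrow> (real \<Rightarrow> real) \<Rightarrow> ('x \<Rightarrow> real) \<Rightarrow> real" where
  "integral_functional \<mu> \<phi> p = (\<integral>x. \<phi> (p x) \<partial>\<mu>)"


section \<open>\<open>(h, \<tau>)\<close>-exponential families and their geometry\<close>

definition admissible_triples :: "((real \<Rightarrow> real) \<times> (real \<Rightarrow> real) \<times> real set) set" where
  "admissible_triples = {(h, \<tau>, I).
     open I \<and> is_interval I \<and> I \<noteq> {} \<and> I \<subseteq> {0<..} \<and>
     smooth_on I \<tau> \<and> (\<forall>t\<in>I. deriv \<tau> t > 0) \<and>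
     smooth_on (\<tau> ` I) h \<and> (\<forall>y\<in>\<tau> ` I. deriv (deriv h) y > 0)}"

definition ell :: "(real \<Rightarrow> real) \<Rightarrow> (real \<Rightarrow> real) \<Rightarrow> real \<Rightarrow> real" where
  "ell h \<tau> = deriv h \<circ> \<tau>"

definition divergence :: "(real \<Rightarrow> real) \<Rightarrow> (real \<Rightarrow> real) \<Rightarrow> real \<Rightarrow> real \<Rightarrow> real" where
  "divergence h \<tau> t s = h (\<tau> t) - h (\<tau> s) - (\<tau> t - \<tau> s) * deriv h (\<tau> s)"

definition entropy_integrand :: "(real \<Rightarrow> real) \<Rightarrow> (real \<Rightarrow> real) \<Rightarrow> real \<Rightarrow> real" where
  "entropy_integrand h \<tau> t = - \<tau> t * deriv h (\<tau> t) + h (\<tau> t)"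

text \<open>For admissible triples \<open>ell h \<tau> ` I\<close> is an open interval, so that the last case is
  \<open>u \<le> inf (ell h \<tau> ` I)\<close>.\<close>

definition gen_exp ::
  "(real \<Rightarrow> real) \<Rightarrow> (real \<Rightarrow> real) \<Rightarrow> real set \<Rightarrow> real \<Rightarrow> ereal" where
  "gen_exp h \<tau> I u =
     (if u \<in> ell h \<tau> ` I then ereal (inv_into I (ell h \<tau>) u)
      else if (SUP t\<in>I. ereal (ell h \<tau> t)) \<le> ereal u then \<infinity>
      else 0)"

definition exp_representation ::
  "(real \<Rightarrow> real) \<Rightarrow> (real \<Rightarrow> real) \<Rightarrow> real set \<Rightarrow>
   ('x::topological_space \<Rightarrow> real, 'n::finite) manifold \<Rightarrow> ('x \<Rightarrow> real) set \<Rightarrow>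
   (('x \<Rightarrow> real) \<Rightarrow> real^'n) \<Rightarrow> ('x \<Rightarrow> real^'n) \<Rightarrow> ('x \<Rightarrow> real) \<Rightarrow> (('x \<Rightarrow> real) \<Rightarrow> real) \<Rightarrow> bool"
  where
  "exp_representation h \<tau> I M U \<theta> T c \<psi> \<longleftrightarrow>
     coordinate_system M U \<theta> \<and> continuous_on UNIV T \<and> continuous_on UNIV c \<and> smooth_fun M U \<psi> \<and>
     (\<forall>p\<in>U. \<forall>x. p x \<in> I \<and> ereal (p x) = gen_exp h \<tau> I (\<theta> p \<bullet> T x - c x - \<psi> p))"

definition exponential_family ::
  "'x::topological_space measure \<Rightarrow> (real \<Rightarrow> real) \<Rightarrow> (real \<Rightarrow> real) \<Rightarrow> real set \<Rightarrow>
   ('x \<Rightarrow> real, 'n::finite) manifold \<Rightarrow> bool" where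
  "exponential_family \<mu> h \<tau> I M \<longleftrightarrow> manifold_in_densities \<mu> I M \<and> statistical_model \<mu> M \<and>
     (\<forall>p\<in>carrier_of M. \<exists>U \<theta> T c \<psi>. p \<in> U \<and> exp_representation h \<tau> I M U \<theta> T c \<psi>)"

definition global_exp_normalization ::
  "(real \<Rightarrow> real) \<Rightarrow> (real \<Rightarrow> real) \<Rightarrow> real set \<Rightarrow>
   ('x::topological_space \<Rightarrow> real, 'n::finite) manifold \<Rightarrow> (('x \<Rightarrow> real) \<Rightarrow> real) \<Rightarrow> bool" where
  "global_exp_normalization h \<tau> I M \<psi> \<longleftrightarrow>
     (\<exists>\<theta> T c. exp_representation h \<tau> I M (carrier_of M) \<theta> T c \<psi>)"

definition divergence_ev ::
  "(real \<Rightarrow> real) \<Rightarrow> (real \<Rightarrow> real) \<Rightarrow> 'x \<Rightarrow> ('x \<Rightarrow> real) \<times> ('x \<Rightarrow> real) \<Rightarrow> real" where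
  "divergence_ev h \<tau> x = (\<lambda>(p, p'). divergence h \<tau> (ev x p) (ev x p'))"

definition ht_metric ::
  "'x measure \<Rightarrow> (real \<Rightarrow> real) \<Rightarrow> (real \<Rightarrow> real) \<Rightarrow> ('x \<Rightarrow> real) metric" where
  "ht_metric \<mu> h \<tau> V W p =
     - (\<integral>x. vf_left V (p, p) (\<lambda>z. vf_right W z (divergence_ev h \<tau> x)) \<partial>\<mu>)"

text \<open>\<open>\<nabla>\<^sub>Z V\<close> is the vector field \<open>Y\<close> for which \<open>g(Y, W)\<close> is the given integral for all \<open>W\<close>.\<close>

definition ht_connection ::
  "'x measure \<Rightarrow> (real \<Rightarrow> real) \<Rightarrow> (real \<Rightarrow> real) \<Rightarrow> ('x \<Rightarrow> real, 'n::finite) manifold \<Rightarrow>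
   ('x \<Rightarrow> real) connection" where
  "ht_connection \<mu> h \<tau> M Z V = (THE Y. Y \<in> vector_fields M \<and>
     (\<forall>W\<in>vector_fields M. \<forall>p\<in>carrier_of M.
        ht_metric \<mu> h \<tau> Y W p =
          - (\<integral>x. vf_right Z (p, p)
                (\<lambda>z. vf_right V z (\<lambda>y. vf_left W y (divergence_ev h \<tau> x))) \<partial>\<mu>)))"

end

theory Submission
  imports Defs
begin

text \<open>
  Write \<open>\<ell> = h' \<circ> \<tau>\<close>, let \<open>\<kappa> = \<tau> \<circ> \<ell>\<inverse>\<close>, the inverse of \<open>h'\<close>, and put
  \<open>L\<^sub>x(p) = \<ell>(p(x)) = \<langle>\<theta>(p), T(x)\<rangle> - c(x) - \<psi>(p)\<close>.

  Two densities whose \<open>\<ell>\<close>-images differ by a constant are pointwise comparable, so they coincide;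
  hence \<open>1, T\<^sub>1, \<dots>, T\<^sub>n\<close> are linearly independent and \<open>\<theta>\<close> is unique up to affine maps.  On overlapping
  domains the spans of \<open>1, T\<^sub>1, \<dots>, T\<^sub>n\<close> agree, so by connectedness all of \<open>M\<close> is expressed by one pair
  \<open>(T, c)\<close>, which gives a global representation.

  Differentiating the divergence yields \<open>g(V, W) = \<integral> V(\<kappa> \<circ> L\<^sub>x) W(L\<^sub>x) d\<mu>(x)\<close> and
  \<open>g(\<nabla>\<^sub>Z V, W) = \<integral> W(\<kappa> \<circ> L\<^sub>x) Z(V L\<^sub>x) d\<mu>(x)\<close>.  As \<open>\<integral> \<tau>(p(x)) d\<mu>(x)\<close> is constant, the terms with \<open>\<psi>\<close> drop out;
  with \<open>\<eta>\<^sub>i(p) = \<integral> \<tau>(p(x)) T\<^sub>i(x) d\<mu>(x)\<close> this leaves \<open>g(V, W) = \<Sum>\<^sub>i V(\<theta>\<^sup>i) W(\<eta>\<^sub>i)\<close>, and \<open>\<nabla>\<close> is the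
  flat connection with affine coordinates \<open>\<theta>\<close>.  By Legendre duality the differential of the claimed
  potential is \<open>\<Sum>\<^sub>i \<eta>\<^sub>i d\<theta>\<^sup>i\<close>, so its Hessian is \<open>g\<close>.  Compactness of the sample space justifies the
  differentiation under the integral.
\<close>

section \<open>Calculus of smooth maps\<close>

text \<open>Tangent vectors are functionals on arbitrary functions
  \<open>'p \<Rightarrow> real\<close>, so an identity valid only on the manifold cannot be
  rewritten under a vector field directly. A single chart is the remedy: given a global
  representation, a field is its coefficient vector over an open subset of Euclidean space, and
  identities of fields are checked on coordinate functions. This is why globalization precedes the
  geometry.

  The sample space carries no smooth structure; it enters the integrals only through the continuous
  map with values (T x, c x). Compactness makes the measure finite and the range of this map
  compact, so uniform continuity replaces the search for dominating functions.

  Strict positivity of the metric has two sources: condition (d) of a statistical model yields one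
  sample point at which a nonzero tangent vector acts nontrivially, and full support turns this one
  nonzero value of a continuous integrand into a positive integral. Positivity in turn makes the
  vector field described by \<open>ht_connection\<close> unique.\<close>

lemma Ck_on_subset: "Ck_on k S f \<Longrightarrow> T \<subseteq> S \<Longrightarrow> Ck_on k T f"
  by (induction k arbitrary: f) (auto intro: continuous_on_subset)

text \<open>Openness of \<open>S\<close> is the point: \<open>frechet_derivative\<close> sees only
  the germ of a function, so the derivatives of \<open>f\<close> and \<open>g\<close> also agree on
  \<open>S\<close> and the induction can continue.\<close>

lemma Ck_on_cong:
  assumes "open S" "\<And>x. x \<in> S \<Longrightarrow> f x = g x" "Ck_on k S f"
  shows "Ck_on k S g"
  using assms(2,3)
proof (induction k arbitrary: f g)
  case 0
  then show ?case using continuous_on_cong by force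
next
  case (Suc k)
  have d: "(g has_derivative frechet_derivative f (at x)) (at x)" if "x \<in> S" for x
  proof (rule has_derivative_transform_within_open[OF _ \<open>open S\<close> that])
    show "(f has_derivative frechet_derivative f (at x)) (at x)"
      using Suc.prems(2) that by (simp flip: frechet_derivative_works)
  qed (use Suc.prems in auto)
  then have "frechet_derivative f (at x) = frechet_derivative g (at x)" if "x \<in> S" for x
    using that frechet_derivative_at by blast
  then have "Ck_on k S (\<lambda>x. frechet_derivative g (at x) v)" for v
    using Suc.IH[of "\<lambda>x. frechet_derivative f (at x) v" "\<lambda>x. frechet_derivative g (at x) v"] Suc.prems by simp
  then show ?case using d by (auto simp: differentiable_def)
qed

lemma Ck_on_local:
  assumes "\<And>x. x \<in> S \<Longrightarrow> \<exists>T. open T \<and> x \<in> T \<and> Ck_on k T f"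
  shows "Ck_on k S f"
  using assms
proof (induction k arbitrary: f)
  case 0
  then have "continuous (at x) f" if "x \<in> S" for x
    using that by (metis Ck_on.simps(1) continuous_on_eq_continuous_at)
  then show ?case by (simp add: continuous_at_imp_continuous_on)
next
  case (Suc k)
  then have "f differentiable at x" if "x \<in> S" for x using that by force
  moreover have "Ck_on k S (\<lambda>x. frechet_derivative f (at x) v)" for v
    using Suc.prems by (intro Suc.IH) force
  ultimately show ?case by simp
qed

lemma Ck_on_Suc_imp: "Ck_on (Suc k) S f \<Longrightarrow> Ck_on k S f"
proof (induction k arbitrary: f)
  case 0
  then show ?case
    by (simp add: continuous_at_imp_continuous_on differentiable_imp_continuous_within)
next
  case (Suc k)
  show ?case
    using Suc.prems Suc.IH unfolding Ck_on.simps(2)[of "Suc k"] Ck_on.simps(2)[of k] by blast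
qed

lemma Ck_on_const: "Ck_on k S (\<lambda>x. c)"
  by (induction k arbitrary: c) auto

lemma Ck_on_bounded_linear:
  assumes "bounded_linear f" shows "Ck_on k S f"
proof (cases k)
  case 0
  then show ?thesis using assms by (simp add: linear_continuous_on)
next
  case (Suc j)
  have "(f has_derivative f) (at x)" for x
    using assms bounded_linear_imp_has_derivative by blast
  then show ?thesis
    using Suc frechet_derivative_at[of f f] by (auto simp: differentiable_def Ck_on_const)
qed

text \<open>Replaces \<open>frechet_derivative\<close> by any explicit formula for the derivative.
  The closure properties below all have this shape: exhibit the derivative, then apply the induction
  hypothesis to its directional values.\<close>

lemma Ck_on_SucI:
  assumes "open S" "\<And>x. x \<in> S \<Longrightarrow> (f has_derivative f' x) (at x)"
    "\<And>v. Ck_on k S (\<lambda>x. f' x v)"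
  shows "Ck_on (Suc k) S f"
proof -
  have "f' x v = frechet_derivative f (at x) v" if "x \<in> S" for x v
    using assms(2)[OF that] frechet_derivative_at by force
  then have "Ck_on k S (\<lambda>x. frechet_derivative f (at x) v)" for v
    by (rule Ck_on_cong[OF assms(1) _ assms(3)])
  then show ?thesis using assms(2) by (auto simp: differentiable_def)
qed

lemma Ck_on_SucD:
  assumes "Ck_on (Suc k) S f" "x \<in> S"
  shows "(f has_derivative frechet_derivative f (at x)) (at x)"
  using assms frechet_derivative_works by auto

lemma Ck_on_add:
  assumes "open S" "Ck_on k S f" "Ck_on k S g"
  shows "Ck_on k S (\<lambda>x. f x + g x)"
  using assms(2,3)
proof (induction k arbitrary: f g)
  case 0 then show ?case by (simp add: continuous_on_add)
next
  case (Suc k)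
  show ?case
  proof (rule Ck_on_SucI[OF \<open>open S\<close>])
    show "((\<lambda>x. f x + g x) has_derivative
        (\<lambda>v. frechet_derivative f (at x) v + frechet_derivative g (at x) v)) (at x)" if "x \<in> S" for x
      using Suc.prems that by (intro has_derivative_add Ck_on_SucD)
  qed (use Suc in auto)
qed

lemma Ck_on_sum:
  assumes "open S" "\<And>i. i \<in> A \<Longrightarrow> Ck_on k S (f i)"
  shows "Ck_on k S (\<lambda>x. \<Sum>i\<in>A. f i x)"
  using assms by (induction A rule: infinite_finite_induct) (auto simp: Ck_on_const Ck_on_add)

text \<open>Stated for a general bilinear map so that products, scalar multiples and inner products
  are covered by one induction on the Leibniz rule.\<close>

lemma Ck_on_prod:
  assumes "bounded_bilinear B" "open S" "Ck_on k S f" "Ck_on k S g"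
  shows "Ck_on k S (\<lambda>x. B (f x) (g x))"
  using assms(3,4)
proof (induction k arbitrary: f g)
  case 0 then show ?case by (simp add: bounded_bilinear.continuous_on[OF assms(1)])
next
  case (Suc k)
  show ?case
  proof (rule Ck_on_SucI[OF \<open>open S\<close>])
    show "((\<lambda>x. B (f x) (g x)) has_derivative
        (\<lambda>v. B (f x) (frechet_derivative g (at x) v) + B (frechet_derivative f (at x) v) (g x))) (at x)"
      if "x \<in> S" for x
      using Suc.prems that by (intro bounded_bilinear.FDERIV[OF assms(1)] Ck_on_SucD)
    show "Ck_on k S (\<lambda>x. B (f x) (frechet_derivative g (at x) v) + B (frechet_derivative f (at x) v) (g x))" for v
      using Suc.prems Ck_on_Suc_imp[OF Suc.prems(1)] Ck_on_Suc_imp[OF Suc.prems(2)]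
      by (intro Ck_on_add[OF \<open>open S\<close>] Suc.IH) auto
  qed
qed

text \<open>\<open>Ck_on\<close> controls derivatives in fixed directions only, whereas the chain
  rule produces the derivative of \<open>g\<close> in the direction
  \<open>frechet_derivative f (at x) v\<close>, which varies with \<open>x\<close>. Expanding that
  direction in \<open>Basis\<close> leaves fixed directions and scalar coefficients.\<close>

lemma Ck_on_compose:
  fixes f :: "'a::real_normed_vector \<Rightarrow> 'b::euclidean_space"
  assumes "open S" "open T" "f ` S \<subseteq> T" "Ck_on k S f" "Ck_on k T g"
  shows "Ck_on k S (\<lambda>x. g (f x))"
  using assms(4,5)
proof (induction k arbitrary: g)
  case 0
  then show ?case using assms(3) by (simp add: continuous_on_compose2[of T g])
next
  case (Suc k)
  let ?D = "\<lambda>x v. \<Sum>b\<in>Basis. (frechet_derivative f (at x) v \<bullet> b) *\<^sub>R frechet_derivative g (at (f x)) b"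
  show ?case
  proof (rule Ck_on_SucI[OF \<open>open S\<close>])
    fix x assume x: "x \<in> S"
    have g: "(g has_derivative frechet_derivative g (at (f x))) (at (f x))"
      using Suc.prems x assms(3) by (intro Ck_on_SucD) auto
    have "((\<lambda>x. g (f x)) has_derivative
        (\<lambda>v. frechet_derivative g (at (f x)) (frechet_derivative f (at x) v))) (at x)"
      using has_derivative_compose[OF Ck_on_SucD[OF Suc.prems(1) x] g] by simp
    moreover have "frechet_derivative g (at (f x)) w
        = (\<Sum>b\<in>Basis. (w \<bullet> b) *\<^sub>R frechet_derivative g (at (f x)) b)" for w
      using linear_sum[OF has_derivative_linear[OF g], of "\<lambda>b. (w \<bullet> b) *\<^sub>R b" Basis]
      by (simp add: euclidean_representation linear_scale[OF has_derivative_linear[OF g]])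
    ultimately show "((\<lambda>x. g (f x)) has_derivative ?D x) (at x)"
      by (metis (no_types, lifting) ext)
  next
    fix v
    have f: "Ck_on k S f" using Suc.prems(1) Ck_on_Suc_imp by blast
    have "Ck_on k S (\<lambda>x. frechet_derivative f (at x) v \<bullet> b)" for b
      using Suc.prems(1) by (intro Ck_on_prod[OF bounded_bilinear_inner \<open>open S\<close>] Ck_on_const) auto
    moreover have "Ck_on k S (\<lambda>x. frechet_derivative g (at (f x)) b)" for b
      using Suc.IH[OF f, of "\<lambda>y. frechet_derivative g (at y) b"] Suc.prems(2) by simp
    ultimately show "Ck_on k S (\<lambda>x. ?D x v)"
      by (intro Ck_on_sum[OF \<open>open S\<close>] Ck_on_prod[OF bounded_bilinear_scaleR \<open>open S\<close>])
  qed
qed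

text \<open>The derivative is a polynomial in the function itself, so the induction closes with
  \<open>Ck_on_prod\<close>.\<close>

lemma Ck_on_inverse: "Ck_on k (- {0}) (inverse :: real \<Rightarrow> real)"
proof (induction k)
  case 0 then show ?case by (auto intro!: continuous_intros)
next
  case (Suc k)
  show ?case
  proof (rule Ck_on_SucI)
    show "(inverse has_derivative (\<lambda>v. - (inverse x * inverse x) * v)) (at x)" if "x \<in> - {0}" for x :: real
      using that by (auto intro!: derivative_eq_intros)
    show "Ck_on k (- {0}) (\<lambda>x. - (inverse x * inverse x) * v)" for v :: real
    proof -
      have "Ck_on k (- {0}) (\<lambda>x. (inverse x * inverse x) * (-v))"
        by (intro Ck_on_prod[OF bounded_bilinear_mult] Suc Ck_on_const) auto
      then show ?thesis by simp
    qed
  qed auto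
qed

section \<open>Closure properties of smooth maps\<close>

lemma smooth_on_subset: "smooth_on S f \<Longrightarrow> T \<subseteq> S \<Longrightarrow> smooth_on T f"
  unfolding smooth_on_def using Ck_on_subset by blast

lemma smooth_on_cong:
  "open S \<Longrightarrow> (\<And>x. x \<in> S \<Longrightarrow> f x = g x) \<Longrightarrow> smooth_on S f \<Longrightarrow> smooth_on S g"
  unfolding smooth_on_def using Ck_on_cong by blast

lemma smooth_on_local:
  "(\<And>x. x \<in> S \<Longrightarrow> \<exists>T. open T \<and> x \<in> T \<and> smooth_on T f) \<Longrightarrow> smooth_on S f"
  unfolding smooth_on_def by (intro allI Ck_on_local) blast

lemma smooth_on_empty: "smooth_on {} f"
  by (rule smooth_on_local) simp

lemma smooth_on_const: "smooth_on S (\<lambda>x. c)"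
  by (simp add: smooth_on_def Ck_on_const)

lemma smooth_on_bounded_linear: "bounded_linear f \<Longrightarrow> smooth_on S f"
  by (simp add: smooth_on_def Ck_on_bounded_linear)

lemma smooth_on_ident: "smooth_on S (\<lambda>x. x)"
  by (intro smooth_on_bounded_linear bounded_linear_ident)

lemma smooth_on_prod:
  "bounded_bilinear B \<Longrightarrow> open S \<Longrightarrow> smooth_on S f \<Longrightarrow> smooth_on S g \<Longrightarrow> smooth_on S (\<lambda>x. B (f x) (g x))"
  by (simp add: smooth_on_def Ck_on_prod)

lemmas smooth_on_mult = smooth_on_prod[OF bounded_bilinear_mult]
  and smooth_on_scaleR = smooth_on_prod[OF bounded_bilinear_scaleR]
  and smooth_on_inner = smooth_on_prod[OF bounded_bilinear_inner]

lemma smooth_on_add: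
  "open S \<Longrightarrow> smooth_on S f \<Longrightarrow> smooth_on S g \<Longrightarrow> smooth_on S (\<lambda>x. f x + g x)"
  by (simp add: smooth_on_def Ck_on_add)

lemma smooth_on_sum:
  "open S \<Longrightarrow> (\<And>i. i \<in> A \<Longrightarrow> smooth_on S (f i)) \<Longrightarrow> smooth_on S (\<lambda>x. \<Sum>i\<in>A. f i x)"
  by (simp add: smooth_on_def Ck_on_sum)

lemma smooth_on_compose:
  fixes f :: "'a::real_normed_vector \<Rightarrow> 'b::euclidean_space"
  shows "open S \<Longrightarrow> open T \<Longrightarrow> f ` S \<subseteq> T \<Longrightarrow> smooth_on S f \<Longrightarrow> smooth_on T g \<Longrightarrow>
    smooth_on S (\<lambda>x. g (f x))"
  unfolding smooth_on_def using Ck_on_compose by blast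

lemma smooth_on_minus: "open S \<Longrightarrow> smooth_on S f \<Longrightarrow> smooth_on S (\<lambda>x. - f x)"
  using smooth_on_scaleR[OF _ smooth_on_const, of S f "-1"] by simp

lemma smooth_on_diff:
  "open S \<Longrightarrow> smooth_on S f \<Longrightarrow> smooth_on S g \<Longrightarrow> smooth_on S (\<lambda>x. f x - g x)"
  using smooth_on_add[of S f "\<lambda>x. - g x"] smooth_on_minus by auto

lemma smooth_on_inverse:
  fixes f :: "'a::real_normed_vector \<Rightarrow> real"
  assumes "open S" "smooth_on S f" "\<And>x. x \<in> S \<Longrightarrow> f x \<noteq> 0"
  shows "smooth_on S (\<lambda>x. inverse (f x))"
  by (rule smooth_on_compose[where T = "- {0}" and f = f])
     (use assms Ck_on_inverse in \<open>auto simp: smooth_on_def\<close>)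

lemma smooth_on_deriv:
  "smooth_on S f \<Longrightarrow> smooth_on S (\<lambda>x. frechet_derivative f (at x) v)"
  unfolding smooth_on_def using Ck_on.simps(2) by blast

lemma smooth_on_has_derivative:
  "smooth_on S f \<Longrightarrow> x \<in> S \<Longrightarrow> (f has_derivative frechet_derivative f (at x)) (at x)"
  unfolding smooth_on_def using Ck_on_SucD by blast

lemma smooth_on_continuous_on: "smooth_on S f \<Longrightarrow> continuous_on S f"
  unfolding smooth_on_def using Ck_on.simps(1) by blast

text \<open>The direction moves with the point, so it is expanded in \<open>Basis\<close> as in the
  chain rule; this is how a vector field with smooth coefficients preserves smoothness.\<close>

lemma smooth_on_derivative:
  fixes f :: "'a::euclidean_space \<Rightarrow> 'b::real_normed_vector"
  assumes "open S" "smooth_on S f" "smooth_on S a"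
  shows "smooth_on S (\<lambda>x. frechet_derivative f (at x) (a x))"
proof (rule smooth_on_cong[OF \<open>open S\<close>])
  show "smooth_on S (\<lambda>x. \<Sum>b\<in>Basis. (a x \<bullet> b) *\<^sub>R frechet_derivative f (at x) b)"
    using assms
    by (intro smooth_on_sum smooth_on_scaleR smooth_on_inner smooth_on_const smooth_on_deriv)
next
  fix x assume "x \<in> S"
  then have f: "linear (frechet_derivative f (at x))"
    using assms(2) smooth_on_has_derivative has_derivative_linear by blast
  show "(\<Sum>b\<in>Basis. (a x \<bullet> b) *\<^sub>R frechet_derivative f (at x) b) = frechet_derivative f (at x) (a x)"
    using linear_sum[OF f, of "\<lambda>b. (a x \<bullet> b) *\<^sub>R b" Basis]
    by (simp add: euclidean_representation linear_scale[OF f])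
qed

section \<open>Functions of one real variable and their inverses\<close>

lemma smooth_on_real_deriv:
  fixes f :: "real \<Rightarrow> real"
  assumes "open S" "smooth_on S f"
  shows "smooth_on S (deriv f)" and "\<And>x. x \<in> S \<Longrightarrow> (f has_field_derivative deriv f x) (at x)"
proof -
  have d: "(f has_field_derivative frechet_derivative f (at x) 1) (at x)" if "x \<in> S" for x
  proof (rule has_derivative_imp_has_field_derivative[OF smooth_on_has_derivative[OF assms(2) that]])
    have "linear (frechet_derivative f (at x))"
      using smooth_on_has_derivative[OF assms(2) that] has_derivative_linear by blast
    then show "v * frechet_derivative f (at x) 1 = frechet_derivative f (at x) v" for v
      using linear_scale[of "frechet_derivative f (at x)" v 1] by simp
  qed
  then show "(f has_field_derivative deriv f x) (at x)" if "x \<in> S" for x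
    using that DERIV_imp_deriv by force
  show "smooth_on S (deriv f)"
    by (rule smooth_on_cong[OF assms(1) _ smooth_on_deriv[OF assms(2), of 1]])
       (use d DERIV_imp_deriv in force)
qed

lemma real_inverse_function_has_derivative:
  fixes f :: "real \<Rightarrow> real"
  assumes "open I" "inj_on f I" "\<And>x. x \<in> I \<Longrightarrow> (f has_field_derivative f' x) (at x)"
    "\<And>x. x \<in> I \<Longrightarrow> f' x \<noteq> 0" "y \<in> f ` I"
  shows "(inv_into I f has_field_derivative inverse (f' (inv_into I f y))) (at y)"
proof -
  have c: "continuous_on I f"
    using assms(3) DERIV_isCont continuous_at_imp_continuous_on by blast
  obtain x where x: "x \<in> I" "y = f x" using assms(5) by auto
  have "(inv_into I f has_derivative (*) (inverse (f' x))) (at (f x))"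
  proof (rule has_derivative_inverse_strong[where S = I and f = f and x = x and f' = "(*) (f' x)"])
    show "(f has_derivative (*) (f' x)) (at x)"
      using assms(3)[OF x(1)] by (simp add: has_field_derivative_def)
    show "open I" "x \<in> I" "continuous_on I f"
      using assms(1) x c by auto
    show "(*) (f' x) \<circ> (*) (inverse (f' x)) = id"
      using assms(4)[OF x(1)] by (auto simp: fun_eq_iff)
    show "inv_into I f (f z) = z" if "z \<in> I" for z using assms(2) that by simp
  qed
  then show ?thesis using assms(2) x by (simp add: has_field_derivative_def)
qed

text \<open>Bootstrapping: the derivative of the inverse is \<open>1 / deriv f\<close> evaluated at
  the inverse itself, so each degree of regularity of the inverse yields the next one.\<close>

lemma smooth_on_real_inverse_function:
  fixes f :: "real \<Rightarrow> real"
  assumes "open I" "inj_on f I" "smooth_on I f" "\<And>x. x \<in> I \<Longrightarrow> deriv f x \<noteq> 0"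
  shows "open (f ` I)" and "smooth_on (f ` I) (inv_into I f)"
proof -
  show o: "open (f ` I)"
    using assms invariance_of_domain smooth_on_continuous_on by blast
  let ?E = "inv_into I f"
  have d: "(?E has_field_derivative inverse (deriv f (?E y))) (at y)" if "y \<in> f ` I" for y
    using real_inverse_function_has_derivative[OF assms(1,2) smooth_on_real_deriv(2)[OF assms(1,3)] assms(4) that]
    by blast
  have "Ck_on k (f ` I) ?E" for k
  proof (induction k)
    case 0
    show ?case
      unfolding Ck_on.simps(1) using d DERIV_isCont by (intro continuous_at_imp_continuous_on) blast
  next
    case (Suc k)
    show ?case
    proof (rule Ck_on_SucI[OF o])
      show "(?E has_derivative (\<lambda>v. inverse (deriv f (?E y)) * v)) (at y)" if "y \<in> f ` I" for y
        using d[OF that] by (simp add: has_field_derivative_def)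
      have "smooth_on I (\<lambda>x. inverse (deriv f x))"
        using assms by (intro smooth_on_inverse smooth_on_real_deriv)
      then have "Ck_on k I (\<lambda>x. inverse (deriv f x))"
        by (simp add: smooth_on_def)
      then have "Ck_on k (f ` I) (\<lambda>y. inverse (deriv f (?E y)))"
        using assms(1,2) by (intro Ck_on_compose[OF o _ _ Suc]) auto
      then show "Ck_on k (f ` I) (\<lambda>y. inverse (deriv f (?E y)) * v)" for v
        by (intro Ck_on_prod[OF bounded_bilinear_mult o] Ck_on_const)
    qed
  qed
  then show "smooth_on (f ` I) ?E" by (simp add: smooth_on_def)
qed

section \<open>Second derivatives and parametric integrals\<close>

lemma has_real_derivative_along_line:
  assumes "(f has_derivative f') (at (c + s *\<^sub>R v))"
  shows "((\<lambda>s. f (c + s *\<^sub>R v)) has_real_derivative f' v) (at s)"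
proof -
  have "((\<lambda>s. f (c + s *\<^sub>R v)) has_derivative (\<lambda>r. f' (r *\<^sub>R v))) (at s)"
  proof (rule has_derivative_compose[where f = "\<lambda>s. c + s *\<^sub>R v" and f' = "\<lambda>r. r *\<^sub>R v", OF _ assms])
    show "((\<lambda>s. c + s *\<^sub>R v) has_derivative (\<lambda>r. r *\<^sub>R v)) (at s)"
      by (auto intro!: derivative_eq_intros)
  qed
  then show ?thesis
    using linear_scale[OF has_derivative_linear[OF assms], of _ v]
    by (intro has_derivative_imp_has_field_derivative[where D = "\<lambda>r. f' (r *\<^sub>R v)"]) (simp_all)
qed

text \<open>Two applications of the mean value theorem, along \<open>v\<close> to a difference of
  two shifted copies of \<open>f\<close> and then along \<open>w\<close> to the derivative
  \<open>D\<close>, turn the second difference quotient into the mixed derivative at an intermediate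
  point; continuity does the rest. Unlike the mixed derivative, the quotient is visibly symmetric in
  \<open>v\<close> and \<open>w\<close>.\<close>

lemma second_difference_limit:
  fixes f :: "'a::real_normed_vector \<Rightarrow> real"
  assumes "open S" "smooth_on S f" "x \<in> S" "e > 0"
  obtains d where "d > 0"
    "\<And>t. 0 < t \<Longrightarrow> t < d \<Longrightarrow>
      \<bar>(f (x + t *\<^sub>R v + t *\<^sub>R w) - f (x + t *\<^sub>R v) - f (x + t *\<^sub>R w) + f x) / t\<^sup>2
        - frechet_derivative (\<lambda>y. frechet_derivative f (at y) v) (at x) w\<bar> < e"
proof -
  define D where "D = (\<lambda>y. frechet_derivative f (at y) v)"
  define A where "A = (\<lambda>y. frechet_derivative D (at y) w)"
  have D: "smooth_on S D" unfolding D_def by (rule smooth_on_deriv[OF assms(2)])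
  then have "continuous_on S A" unfolding A_def by (intro smooth_on_continuous_on smooth_on_deriv)
  then have "isCont A x" using assms continuous_on_eq_continuous_at by blast
  then obtain r1 where r1: "r1 > 0" "\<And>y. dist y x < r1 \<Longrightarrow> dist (A y) (A x) < e"
    using assms(4) unfolding continuous_at_eps_delta by metis
  obtain r2 where r2: "r2 > 0" "ball x r2 \<subseteq> S" using assms openE by blast
  define r where "r = min r1 r2"
  \<comment> \<open>Chosen so that the whole parallelogram spanned by \<open>t *\<^sub>R v\<close>
    and \<open>t *\<^sub>R w\<close> at \<open>x\<close> stays within distance \<open>r\<close> for
    \<open>t < d\<close>; the summand 1 keeps the denominator positive when \<open>v\<close> and
    \<open>w\<close> vanish.\<close>
  define d where "d = r / (norm v + norm w + 1)"
  have r: "r > 0" using r1 r2 by (simp add: r_def)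
  have nz: "norm v + norm w + 1 > 0" by (smt (verit) norm_ge_zero)
  have d: "d > 0" unfolding d_def using r nz by simp
  have near: "dist (x + s *\<^sub>R v + q *\<^sub>R w) x < r" if "0 \<le> s" "s \<le> t" "0 \<le> q" "q \<le> t" "t < d" for s q t
  proof -
    have "dist (x + s *\<^sub>R v + q *\<^sub>R w) x = norm (s *\<^sub>R v + q *\<^sub>R w)"
      by (simp add: dist_norm)
    also have "\<dots> \<le> s * norm v + q * norm w"
      using norm_triangle_ineq[of "s *\<^sub>R v" "q *\<^sub>R w"] that by simp
    also have "\<dots> \<le> t * norm v + t * norm w"
      using that by (intro add_mono mult_right_mono) auto
    also have "\<dots> \<le> t * (norm v + norm w + 1)"
      using that by (simp add: algebra_simps)
    also have "\<dots> < d * (norm v + norm w + 1)"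
      using that nz by simp
    also have "\<dots> = r" unfolding d_def using nz by simp
    finally show ?thesis .
  qed
  have inS: "x + s *\<^sub>R v + q *\<^sub>R w \<in> S" if "0 \<le> s" "s \<le> t" "0 \<le> q" "q \<le> t" "t < d" for s q t
    using near[OF that] r2 by (auto simp: r_def dist_commute)
  have "\<bar>(f (x + t *\<^sub>R v + t *\<^sub>R w) - f (x + t *\<^sub>R v) - f (x + t *\<^sub>R w) + f x) / t\<^sup>2 - A x\<bar> < e"
    if t: "0 < t" "t < d" for t
  proof -
    define g where "g = (\<lambda>s. f ((x + t *\<^sub>R w) + s *\<^sub>R v) - f (x + s *\<^sub>R v))"
    have g: "(g has_real_derivative D (x + t *\<^sub>R w + s *\<^sub>R v) - D (x + s *\<^sub>R v)) (at s)"
      if s: "0 \<le> s" "s \<le> t" for s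
    proof -
      have "x + s *\<^sub>R v + t *\<^sub>R w \<in> S" "x + s *\<^sub>R v + 0 *\<^sub>R w \<in> S" 
        using inS[of s t t] inS[of s t 0] s t by auto
      then show ?thesis
        unfolding g_def D_def using assms(2)
        by (intro DERIV_diff has_real_derivative_along_line smooth_on_has_derivative)
           (auto simp: add_ac)
    qed
    obtain z where z: "0 < z" "z < t" "g t - g 0 = (t - 0) * (D (x + t *\<^sub>R w + z *\<^sub>R v) - D (x + z *\<^sub>R v))"
      using MVT2[OF t(1), of g "\<lambda>s. D (x + t *\<^sub>R w + s *\<^sub>R v) - D (x + s *\<^sub>R v)"] g by blast
    have k: "((\<lambda>q. D ((x + z *\<^sub>R v) + q *\<^sub>R w)) has_real_derivative A (x + z *\<^sub>R v + q *\<^sub>R w)) (at q)"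
      if q: "0 \<le> q" "q \<le> t" for q
      unfolding A_def using inS[of z t q] z t q
      by (intro has_real_derivative_along_line smooth_on_has_derivative[OF D]) auto
    obtain q where q: "0 < q" "q < t" 
      "D ((x + z *\<^sub>R v) + t *\<^sub>R w) - D ((x + z *\<^sub>R v) + 0 *\<^sub>R w) = (t - 0) * A (x + z *\<^sub>R v + q *\<^sub>R w)"
      using MVT2[OF t(1), of "\<lambda>q. D ((x + z *\<^sub>R v) + q *\<^sub>R w)" "\<lambda>q. A (x + z *\<^sub>R v + q *\<^sub>R w)"] k by blast
    have "f (x + t *\<^sub>R v + t *\<^sub>R w) - f (x + t *\<^sub>R v) - f (x + t *\<^sub>R w) + f x = g t - g 0"
      by (simp add: g_def add_ac)
    also have "\<dots> = t\<^sup>2 * A (x + z *\<^sub>R v + q *\<^sub>R w)"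
      using z(3) q(3) by (simp add: add_ac power2_eq_square)
    finally have "(f (x + t *\<^sub>R v + t *\<^sub>R w) - f (x + t *\<^sub>R v) - f (x + t *\<^sub>R w) + f x) / t\<^sup>2
      = A (x + z *\<^sub>R v + q *\<^sub>R w)" using t by simp
    moreover have "dist (A (x + z *\<^sub>R v + q *\<^sub>R w)) (A x) < e"
      using near[of z t q] z q t by (intro r1) (auto simp: r_def)
    ultimately show ?thesis by (simp add: dist_real_def)
  qed
  then show thesis using that[OF d] by (simp add: A_def D_def)
qed

text \<open>Both sides are limits of the same symmetric quotient. This makes the Lie bracket a
  first-order operator later on.\<close>

lemma frechet_derivative_commute:
  fixes f :: "'a::real_normed_vector \<Rightarrow> real"
  assumes "open S" "smooth_on S f" "x \<in> S"
  shows "frechet_derivative (\<lambda>y. frechet_derivative f (at y) v) (at x) w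
       = frechet_derivative (\<lambda>y. frechet_derivative f (at y) w) (at x) v" (is "?A = ?B")
proof (rule ccontr)
  assume "?A \<noteq> ?B"
  then have e: "\<bar>?A - ?B\<bar> / 2 > 0" by simp
  obtain d1 where d1: "d1 > 0" "\<And>t. 0 < t \<Longrightarrow> t < d1 \<Longrightarrow>
      \<bar>(f (x + t *\<^sub>R v + t *\<^sub>R w) - f (x + t *\<^sub>R v) - f (x + t *\<^sub>R w) + f x) / t\<^sup>2 - ?A\<bar> < \<bar>?A - ?B\<bar> / 2"
    using second_difference_limit[OF assms e, of v w] by metis
  obtain d2 where d2: "d2 > 0" "\<And>t. 0 < t \<Longrightarrow> t < d2 \<Longrightarrow>
      \<bar>(f (x + t *\<^sub>R w + t *\<^sub>R v) - f (x + t *\<^sub>R w) - f (x + t *\<^sub>R v) + f x) / t\<^sup>2 - ?B\<bar> < \<bar>?A - ?B\<bar> / 2"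
    using second_difference_limit[OF assms e, of w v] by metis
  define t where "t = min d1 d2 / 2"
  have t: "0 < t" "t < d1" "t < d2" using d1 d2 by (auto simp: t_def)
  have eq: "f (x + t *\<^sub>R w + t *\<^sub>R v) - f (x + t *\<^sub>R w) - f (x + t *\<^sub>R v) + f x
      = f (x + t *\<^sub>R v + t *\<^sub>R w) - f (x + t *\<^sub>R v) - f (x + t *\<^sub>R w) + f x"
    by (simp add: add_ac)
  have "False" if "\<bar>q - a\<bar> < \<bar>a - b\<bar> / 2" "\<bar>q - b\<bar> < \<bar>a - b\<bar> / 2" for a b q :: real
    using that by (simp add: abs_if split: if_splits)
  from this[OF d1(2)[OF t(1,2)] d2(2)[OF t(1,3), unfolded eq]] show False .
qed

section \<open>Differentiation under the integral sign over a compact space\<close>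

lemma integrable_continuous_compact:
  fixes f :: "'x::topological_space \<Rightarrow> real"
  assumes "finite_measure \<mu>" "sets \<mu> = sets borel" "compact (UNIV :: 'x set)" "continuous_on UNIV f"
  shows "integrable \<mu> f"
proof -
  have "bounded (range f)" 
    using compact_continuous_image[OF assms(4,3)] compact_imp_bounded by blast
  then obtain B where "\<And>x. norm (f x) \<le> B" by (auto simp: bounded_iff)
  moreover have "f \<in> borel_measurable \<mu>"
    using borel_measurable_continuous_onI[OF assms(4)] measurable_cong_sets[OF assms(2) refl] by blast
  ultimately show ?thesis
    by (intro finite_measure.integrable_const_bound[OF assms(1), of _ B]) auto
qed

context
  fixes \<mu> :: "'x::topological_space measure" and Y :: "'x \<Rightarrow> 'b::euclidean_space"
    and S :: "'a::euclidean_space set" and Q :: "('a \<times> 'b) set"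
  assumes fin: "finite_measure \<mu>" and sets: "sets \<mu> = sets borel"
    and cpt: "compact (UNIV :: 'x set)" and Y: "continuous_on UNIV Y"
    and S: "open S" and Q: "open Q" and SQ: "S \<times> range Y \<subseteq> Q"
begin

lemma parametric_integrable:
  fixes H :: "'a \<times> 'b \<Rightarrow> real"
  assumes "continuous_on Q H" "u \<in> S"
  shows "integrable \<mu> (\<lambda>x. H (u, Y x))"
proof (rule integrable_continuous_compact[OF fin sets cpt])
  show "continuous_on UNIV (\<lambda>x. H (u, Y x))"
    using assms(2) SQ by (intro continuous_on_compose2[OF assms(1)] continuous_on_Pair Y continuous_on_const) auto
qed

text \<open>The linearization error must be small uniformly in the sample point. The partial
  derivatives are continuous on the compact set \<open>cball u r \<times> range Y\<close>, hence
  uniformly continuous there, and the mean value inequality converts this into an error bound that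
  is constant in \<open>x\<close> and can be integrated over the finite measure.\<close>

lemma has_derivative_parametric_integral:
  fixes F :: "'a \<times> 'b \<Rightarrow> real"
  assumes F: "smooth_on Q F" and u: "u \<in> S"
  shows "((\<lambda>u. \<integral>x. F (u, Y x) \<partial>\<mu>) has_derivative
           (\<lambda>v. \<integral>x. frechet_derivative F (at (u, Y x)) (v, 0) \<partial>\<mu>)) (at u)"
proof -
  define D where "D = (\<lambda>w y v. frechet_derivative F (at (w, y)) (v, 0))"
  have K: "compact (range Y)" by (rule compact_continuous_image[OF Y cpt])
  have FD: "(F has_derivative frechet_derivative F (at (w, Y x))) (at (w, Y x))" if "w \<in> S" for w x
    using smooth_on_has_derivative[OF F] SQ that by blast
  have Dlin: "linear (D w (Y x))" if "w \<in> S" for w x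
  proof -
    have "linear (\<lambda>v. (v :: 'a, 0 :: 'b))" by (auto simp: linear_iff)
    then show ?thesis unfolding D_def
      using linear_compose[OF _ has_derivative_linear[OF FD[OF that, of x]], of "\<lambda>v. (v, 0)"]
      by (simp add: o_def)
  qed
  have Dder: "((\<lambda>w. F (w, Y x)) has_derivative D w (Y x)) (at w within A)" if "w \<in> S" for w x A
  proof -
    have "((\<lambda>w. (w, Y x)) has_derivative (\<lambda>v. (v, 0))) (at w within A)"
      by (auto intro!: derivative_eq_intros)
    then show ?thesis
      using has_derivative_compose[of "\<lambda>w. (w, Y x)" "\<lambda>v. (v, 0)", OF _ FD[OF that]] by (simp add: D_def)
  qed
  have Dcont: "continuous_on Q (\<lambda>z. D (fst z) (snd z) v)" for v
    unfolding D_def using smooth_on_continuous_on[OF smooth_on_deriv[OF F]] by simp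
  have Dint: "integrable \<mu> (\<lambda>x. D w (Y x) v)" if "w \<in> S" for w v
    using parametric_integrable[OF Dcont that] by simp
  have Fint: "integrable \<mu> (\<lambda>x. F (w, Y x))" if "w \<in> S" for w
    by (rule parametric_integrable[OF smooth_on_continuous_on[OF F] that])
  define C where "C = measure \<mu> (space \<mu>)"
  have C: "C \<ge> 0" by (simp add: C_def)
  obtain r where r: "r > 0" "cball u r \<subseteq> S" using S u open_contains_cball by blast
  \<comment> \<open>Sums the changes of the partial derivatives between \<open>u\<close> and
    \<open>w\<close>. It vanishes at \<open>w = u\<close> and bounds the operator norm of
    \<open>D w y - D u y\<close>, so its uniform continuity supplies the bound for the mean value
    inequality.\<close>
  define R where "R = (\<lambda>z. \<Sum>b\<in>Basis. \<bar>D (fst z) (snd z) b - D u (snd z) b\<bar>)"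
  have KQ: "cball u r \<times> range Y \<subseteq> Q" using r SQ by blast
  have "continuous_on (cball u r \<times> range Y) R"
  proof -
    have "continuous_on (cball u r \<times> range Y) (\<lambda>z. D u (snd z) b)" for b
      using continuous_on_compose2[OF Dcont, of "cball u r \<times> range Y" "\<lambda>z. (u, snd z)" b] SQ u
      by (force intro!: continuous_intros)
    then show ?thesis
      unfolding R_def using Dcont KQ by (auto intro!: continuous_intros intro: continuous_on_subset)
  qed
  then have Ru: "uniformly_continuous_on (cball u r \<times> range Y) R"
    using compact_uniformly_continuous compact_Times K compact_cball by blast
  have D_fold: "frechet_derivative F (at (w, y)) (v, 0) = D w y v" for w y v
    by (simp add: D_def)
  show ?thesis
    unfolding D_fold has_derivative_at_alt
  proof (intro conjI allI impI)
    show "bounded_linear (\<lambda>v. \<integral>x. D u (Y x) v \<partial>\<mu>)"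
      unfolding linear_conv_bounded_linear[symmetric]
      using Dint[OF u] by (intro linearI) (simp_all add: linear_add[OF Dlin[OF u]] linear_scale[OF Dlin[OF u]])
  next
    fix e :: real assume e: "0 < e"
    \<comment> \<open>Integration multiplies the pointwise bound by the total mass \<open>C\<close>;
      \<open>C + 1\<close> absorbs it and also covers the zero measure.\<close>
    define e' where "e' = e / (C + 1)"
    have e': "e' > 0" using e C by (simp add: e'_def)
    obtain d where d: "d > 0" "\<And>z z'. z \<in> cball u r \<times> range Y \<Longrightarrow> z' \<in> cball u r \<times> range Y \<Longrightarrow>
        dist z' z < d \<Longrightarrow> dist (R z') (R z) < e'"
      using Ru e' unfolding uniformly_continuous_on_def by metis
    define d' where "d' = min d r"
    have near: "\<bar>F (w, Y x) - F (u, Y x) - D u (Y x) (w - u)\<bar> \<le> norm (w - u) * e'"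
      if w: "norm (w - u) < d'" for w x
    proof -
      have sub: "ball u d' \<subseteq> S" using r by (auto simp: d'_def)
      have "norm (F (w, Y x) - F (u, Y x) - D u (Y x) (w - u)) \<le> norm (w - u) * e'"
      proof (rule differentiable_bound_linearization[where S = "ball u d'" and f' = "\<lambda>w. D w (Y x)" and f = "\<lambda>w. F (w, Y x)" and a = u and b = w and ?x0.0 = u])
        fix t :: real assume "t \<in> {0..1}"
        then have "norm (t *\<^sub>R (w - u)) \<le> norm (w - u)"
          by (simp add: mult_left_le_one_le)
        then show "u + t *\<^sub>R (w - u) \<in> ball u d'" using w by (simp add: dist_norm)
      next
        show "((\<lambda>w. F (w, Y x)) has_derivative D y (Y x)) (at y within ball u d')" if "y \<in> ball u d'" for y
          using sub that by (intro Dder) auto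
        show "u \<in> ball u d'" using d r by (simp add: d'_def)
        show "onorm (D y (Y x) - D u (Y x)) \<le> e'" if y: "y \<in> ball u d'" for y
        proof (rule onorm_le)
          fix v
          have lin: "linear (\<lambda>v. D y (Y x) v - D u (Y x) v)"
            using y sub u by (intro linear_compose_sub Dlin) auto
          have "dist (R (y, Y x)) (R (u, Y x)) < e'"
            using y r by (intro d) (auto simp: d'_def dist_Pair_Pair dist_commute)
          then have Re: "R (y, Y x) \<le> e'" by (simp add: R_def dist_real_def)
          have "norm ((D y (Y x) - D u (Y x)) v) = \<bar>\<Sum>b\<in>Basis. (v \<bullet> b) * (D y (Y x) b - D u (Y x) b)\<bar>"
            using linear_sum[OF lin, of "\<lambda>b. (v \<bullet> b) *\<^sub>R b" Basis] linear_scale[OF lin]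
            by (simp add: euclidean_representation)
          also have "\<dots> \<le> (\<Sum>b\<in>Basis. \<bar>v \<bullet> b\<bar> * \<bar>D y (Y x) b - D u (Y x) b\<bar>)"
            by (rule order_trans[OF sum_abs]) (simp add: abs_mult)
          also have "\<dots> \<le> (\<Sum>b\<in>Basis. norm v * \<bar>D y (Y x) b - D u (Y x) b\<bar>)"
            by (intro sum_mono mult_right_mono) (auto simp: Basis_le_norm)
          also have "\<dots> = norm v * R (y, Y x)" by (simp add: R_def sum_distrib_left)
          also have "\<dots> \<le> e' * norm v" using mult_left_mono[OF Re norm_ge_zero[of v]] by (simp add: mult.commute)
          finally show "norm ((D y (Y x) - D u (Y x)) v) \<le> e' * norm v" .
        qed
      qed
      then show ?thesis by simp
    qed
    have "norm ((\<integral>x. F (w, Y x) \<partial>\<mu>) - (\<integral>x. F (u, Y x) \<partial>\<mu>) - (\<integral>x. D u (Y x) (w - u) \<partial>\<mu>)) \<le> e * norm (w - u)"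
      if w: "norm (w - u) < d'" for w
    proof -
      have wS: "w \<in> S" using w r by (auto simp: d'_def dist_norm norm_minus_commute)
      have "(\<integral>x. F (w, Y x) \<partial>\<mu>) - (\<integral>x. F (u, Y x) \<partial>\<mu>) - (\<integral>x. D u (Y x) (w - u) \<partial>\<mu>)
          = (\<integral>x. F (w, Y x) - F (u, Y x) - D u (Y x) (w - u) \<partial>\<mu>)"
        using Fint[OF wS] Fint[OF u] Dint[OF u] by simp
      also have "norm \<dots> \<le> (\<integral>x. norm (F (w, Y x) - F (u, Y x) - D u (Y x) (w - u)) \<partial>\<mu>)"
        by (rule integral_norm_bound)
      also have "\<dots> \<le> (\<integral>x. norm (w - u) * e' \<partial>\<mu>)"
        using Fint[OF wS] Fint[OF u] Dint[OF u] near[OF w] finite_measure.integrable_const[OF fin]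
        by (intro integral_mono) auto
      also have "\<dots> = C * (norm (w - u) * e')" by (simp add: C_def)
      also have "\<dots> = (C / (C + 1)) * (e * norm (w - u))" by (simp add: e'_def)
      also have "\<dots> \<le> 1 * (e * norm (w - u))"
        using C e by (intro mult_right_mono) auto
      finally show ?thesis by simp
    qed
    moreover have "d' > 0" using d r by (simp add: d'_def)
    ultimately show "\<exists>d>0. \<forall>w. norm (w - u) < d \<longrightarrow>
        norm ((\<integral>x. F (w, Y x) \<partial>\<mu>) - (\<integral>x. F (u, Y x) \<partial>\<mu>) - (\<integral>x. D u (Y x) (w - u) \<partial>\<mu>)) \<le> e * norm (w - u)"
      by blast
  qed
qed

text \<open>A directional derivative of such an integral is again one, with the smooth integrand
  \<open>frechet_derivative F (at z) (v, 0)\<close>; hence the induction is over all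
  \<open>F\<close> simultaneously.\<close>

lemma smooth_on_parametric_integral:
  fixes F :: "'a \<times> 'b \<Rightarrow> real"
  assumes "smooth_on Q F"
  shows "smooth_on S (\<lambda>u. \<integral>x. F (u, Y x) \<partial>\<mu>)"
proof -
  have "Ck_on k S (\<lambda>u. \<integral>x. F (u, Y x) \<partial>\<mu>)" for k
    using assms
  proof (induction k arbitrary: F)
    case 0
    show ?case unfolding Ck_on.simps(1)
      using has_derivative_parametric_integral[OF 0]
      by (intro continuous_at_imp_continuous_on ballI has_derivative_continuous) blast
  next
    case (Suc k)
    show ?case
      using has_derivative_parametric_integral[OF Suc.prems]
    proof (rule Ck_on_SucI[OF S])
      show "Ck_on k S (\<lambda>u. \<integral>x. frechet_derivative F (at (u, Y x)) (v, 0) \<partial>\<mu>)" for v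
        using Suc.IH[OF smooth_on_deriv[OF Suc.prems, of "(v, 0)"]] by simp
    qed
  qed
  then show ?thesis by (simp add: smooth_on_def)
qed

end

section \<open>Manifolds with a global chart\<close>

lemma chart_homeomorphic:
  assumes "chart X U \<phi>"
  shows "inj_on \<phi> U" "openin X U" "U \<subseteq> topspace X"
    and "\<And>W. W \<subseteq> U \<Longrightarrow> open (\<phi> ` W) \<longleftrightarrow> openin X W"
proof -
  have U: "openin X U" "open (\<phi> ` U)" and hom: "homeomorphic_map (subtopology X U) (top_of_set (\<phi> ` U)) \<phi>"
    using assms by (auto simp: chart_def)
  show oU: "openin X U" "U \<subseteq> topspace X" using U openin_subset by auto
  then have top: "topspace (subtopology X U) = U" by auto
  show "inj_on \<phi> U" using homeomorphic_imp_injective_map[OF hom] top by simp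
  fix W assume W: "W \<subseteq> U"
  have "openin (top_of_set (\<phi> ` U)) (\<phi> ` W) \<longleftrightarrow> openin (subtopology X U) W"
    by (rule homeomorphic_map_openness[OF hom]) (use top W in auto)
  moreover have "openin (top_of_set (\<phi> ` U)) (\<phi> ` W) \<longleftrightarrow> open (\<phi> ` W)"
    using W U(2) by (simp add: openin_open_eq image_mono)
  moreover have "openin (subtopology X U) W \<longleftrightarrow> openin X W"
    using W U(1) by (simp add: openin_open_subtopology)
  ultimately show "open (\<phi> ` W) \<longleftrightarrow> openin X W" by simp
qed

lemma chart_openin_vimage:
  assumes "chart X U \<phi>" "open A"
  shows "openin X {p \<in> U. \<phi> p \<in> A}"
proof -
  have "\<phi> ` {p \<in> U. \<phi> p \<in> A} = \<phi> ` U \<inter> A" by auto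
  then show ?thesis
    using chart_homeomorphic(4)[OF assms(1), of "{p \<in> U. \<phi> p \<in> A}"] assms by (auto simp: chart_def)
qed

lemma smoothly_compatible_sym: "smoothly_compatible C D \<Longrightarrow> smoothly_compatible D C"
  by (auto simp: smoothly_compatible_def Int_commute split: prod.splits)

lemma smooth_on_change_chart:
  fixes \<phi> \<theta> :: "'p \<Rightarrow> real^'n::finite"
  assumes "chart X U \<theta>" "chart X V \<phi>" "smoothly_compatible (U, \<theta>) (V, \<phi>)" "openin X W"
    and "smooth_on (\<phi> ` (W \<inter> V)) (f \<circ> inv_into V \<phi>)"
  shows "smooth_on (\<theta> ` (W \<inter> U \<inter> V)) (f \<circ> inv_into U \<theta>)"
proof -
  note \<theta> = chart_homeomorphic[OF assms(1)] and \<phi> = chart_homeomorphic[OF assms(2)]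
  let ?A = "\<theta> ` (W \<inter> U \<inter> V)"
  have oA: "open ?A" using \<theta> \<phi> assms(4) by (subst \<theta>(4)) (auto intro: openin_Int)
  have oB: "open (\<phi> ` (W \<inter> V))" using \<phi> assms(4) by (subst \<phi>(4)) (auto intro: openin_Int)
  have "smooth_on ?A (\<phi> \<circ> inv_into U \<theta>)"
    using assms(3) by (rule_tac smooth_on_subset[of "\<theta> ` (U \<inter> V)"]) (auto simp: smoothly_compatible_def)
  then have "smooth_on ?A (\<lambda>u. (f \<circ> inv_into V \<phi>) ((\<phi> \<circ> inv_into U \<theta>) u))"
    using \<theta>(1) by (intro smooth_on_compose[OF oA oB _ _ assms(5)]) (auto simp: o_def)
  then show ?thesis
    by (rule smooth_on_cong[OF oA, rotated]) (use \<theta>(1) \<phi>(1) in auto)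
qed

lemma smooth_fun_openin: "smooth_fun M U f \<Longrightarrow> openin (mtop M) U"
  by (simp add: smooth_fun_def)

lemma smooth_fun_subset_carrier: "smooth_fun M U f \<Longrightarrow> U \<subseteq> carrier_of M"
  by (simp add: smooth_fun_def carrier_of_def openin_subset)

lemma smooth_at_carrier: "smooth_at M p f \<Longrightarrow> p \<in> carrier_of M"
  using smooth_fun_subset_carrier unfolding smooth_at_def by blast

lemma atlas_chart:
  assumes "is_manifold M" "(U, \<phi>) \<in> atlas M"
  shows "chart (mtop M) U \<phi>" "coordinate_system M U \<phi>"
  using assms by (auto simp: is_manifold_def coordinate_system_def)

lemma atlas_cover:
  assumes "is_manifold M" "p \<in> carrier_of M"
  obtains U \<phi> where "(U, \<phi>) \<in> atlas M" "p \<in> U"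
proof -
  have "p \<in> (\<Union>(U, \<phi>)\<in>atlas M. U)" using assms by (simp add: is_manifold_def)
  then show thesis using that by blast
qed

text \<open>Smoothness is defined through the charts of the atlas, while coordinate systems need
  only be compatible with it. Transition maps carry smoothness both ways, so one coordinate system
  whose domain contains \<open>W\<close> decides it.\<close>

lemma smooth_fun_coordinates_iff:
  fixes M :: "('p, 'n::finite) manifold"
  assumes M: "is_manifold M" and \<theta>: "coordinate_system M U \<theta>" and W: "W \<subseteq> U"
  shows "smooth_fun M W f \<longleftrightarrow> openin (mtop M) W \<and> smooth_on (\<theta> ` W) (f \<circ> inv_into U \<theta>)"
proof (intro iffI conjI)
  have cU: "chart (mtop M) U \<theta>"
    and comp: "\<And>V \<phi>. (V, \<phi>) \<in> atlas M \<Longrightarrow> smoothly_compatible (U, \<theta>) (V, \<phi>)"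
    using \<theta> by (auto simp: coordinate_system_def)
  note cU' = chart_homeomorphic[OF cU]
  {
    assume f: "smooth_fun M W f"
    then show o: "openin (mtop M) W" by (rule smooth_fun_openin)
    show "smooth_on (\<theta> ` W) (f \<circ> inv_into U \<theta>)"
    proof (rule smooth_on_local)
      fix u assume "u \<in> \<theta> ` W"
      then obtain p where p: "p \<in> W" "u = \<theta> p" by auto
      then obtain V \<phi> where V: "(V, \<phi>) \<in> atlas M" "p \<in> V"
        using atlas_cover[OF M] smooth_fun_subset_carrier[OF f] by blast
      have cV: "chart (mtop M) V \<phi>" using atlas_chart[OF M V(1)] by simp
      have "smooth_on (\<phi> ` (W \<inter> V)) (f \<circ> inv_into V \<phi>)"
        using f V by (auto simp: smooth_fun_def)
      from smooth_on_change_chart[OF cU cV comp[OF V(1)] o this]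
      have "smooth_on (\<theta> ` (W \<inter> U \<inter> V)) (f \<circ> inv_into U \<theta>)" .
      moreover have "open (\<theta> ` (W \<inter> U \<inter> V))"
        using cU' chart_homeomorphic[OF cV] o by (subst cU'(4)) (auto intro: openin_Int)
      ultimately show "\<exists>T. open T \<and> u \<in> T \<and> smooth_on T (f \<circ> inv_into U \<theta>)"
        using p V W by (intro exI[of _ "\<theta> ` (W \<inter> U \<inter> V)"]) auto
    qed
  }
  assume r: "openin (mtop M) W \<and> smooth_on (\<theta> ` W) (f \<circ> inv_into U \<theta>)"
  have "smooth_on (\<phi> ` (W \<inter> V)) (f \<circ> inv_into V \<phi>)" if V: "(V, \<phi>) \<in> atlas M" for V \<phi>
  proof -
    have cV: "chart (mtop M) V \<phi>" using atlas_chart[OF M V(1)] by simp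
    have "W \<inter> V = W \<inter> V \<inter> U" "W \<inter> U = W" using W by auto
    then show ?thesis
      using smooth_on_change_chart[OF cV cU smoothly_compatible_sym[OF comp[OF V]], of W f] r by simp
  qed
  then show "smooth_fun M W f" using r by (auto simp: smooth_fun_def)
qed

section \<open>Tangent vectors in coordinate systems outside the atlas\<close>

definition coordinate_vector ::
  "('p, 'n::finite) manifold \<Rightarrow> 'p set \<Rightarrow> ('p \<Rightarrow> real^'n) \<Rightarrow> 'p \<Rightarrow> real^'n \<Rightarrow> 'p tangent" where
  "coordinate_vector M U \<theta> p a =
     (\<lambda>f. if smooth_at M p f then frechet_derivative (f \<circ> inv_into U \<theta>) (at (\<theta> p)) a else 0)"

lemma smooth_at_has_derivative:
  assumes M: "is_manifold M" and \<theta>: "coordinate_system M U \<theta>" and p: "p \<in> U" and f: "smooth_at M p f"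
  shows "(f \<circ> inv_into U \<theta> has_derivative frechet_derivative (f \<circ> inv_into U \<theta>) (at (\<theta> p))) (at (\<theta> p))"
proof -
  obtain W where W: "p \<in> W" "smooth_fun M W f" using f by (auto simp: smooth_at_def)
  have c: "chart (mtop M) U \<theta>" using \<theta> by (simp add: coordinate_system_def)
  note c' = chart_homeomorphic[OF c]
  have "smooth_fun M (W \<inter> U) f"
    using W c'(2) unfolding smooth_fun_def
    by (auto intro!: openin_Int elim!: smooth_on_subset)
  then have "smooth_on (\<theta> ` (W \<inter> U)) (f \<circ> inv_into U \<theta>)"
    using smooth_fun_coordinates_iff[OF M \<theta>, of "W \<inter> U" f] by simp
  then show ?thesis using W(1) p by (intro smooth_on_has_derivative) auto
qed

lemma coordinate_vector_change:
  fixes M :: "('p, 'n::finite) manifold"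
  assumes M: "is_manifold M" and \<theta>: "coordinate_system M U \<theta>" and \<phi>: "coordinate_system M V \<phi>"
    and compat: "smoothly_compatible (U, \<theta>) (V, \<phi>)" and p: "p \<in> U" "p \<in> V"
  shows "coordinate_vector M V \<phi> p a
       = coordinate_vector M U \<theta> p (frechet_derivative (\<theta> \<circ> inv_into V \<phi>) (at (\<phi> p)) a)"
proof -
  have cU: "chart (mtop M) U \<theta>" and cV: "chart (mtop M) V \<phi>"
    using \<theta> \<phi> by (auto simp: coordinate_system_def)
  note cU' = chart_homeomorphic[OF cU] and cV' = chart_homeomorphic[OF cV]
  let ?A = "\<phi> ` (U \<inter> V)"
  have A: "open ?A" "\<phi> p \<in> ?A" using cU' cV' p by (auto intro: openin_Int)
  have "frechet_derivative (f \<circ> inv_into V \<phi>) (at (\<phi> p)) a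
      = frechet_derivative (f \<circ> inv_into U \<theta>) (at (\<theta> p))
          (frechet_derivative (\<theta> \<circ> inv_into V \<phi>) (at (\<phi> p)) a)" if f: "smooth_at M p f" for f
  proof -
    have 1: "(\<theta> \<circ> inv_into V \<phi> has_derivative frechet_derivative (\<theta> \<circ> inv_into V \<phi>) (at (\<phi> p))) (at (\<phi> p))"
      using compat A by (intro smooth_on_has_derivative[of ?A]) (auto simp: smoothly_compatible_def Int_commute)
    have 2: "(f \<circ> inv_into U \<theta> has_derivative frechet_derivative (f \<circ> inv_into U \<theta>) (at (\<theta> p)))
        (at ((\<theta> \<circ> inv_into V \<phi>) (\<phi> p)))"
      using smooth_at_has_derivative[OF M \<theta> p(1) f] cV'(1) p(2) by simp
    have "(f \<circ> inv_into V \<phi> has_derivative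
        (\<lambda>v. frechet_derivative (f \<circ> inv_into U \<theta>) (at (\<theta> p)) (frechet_derivative (\<theta> \<circ> inv_into V \<phi>) (at (\<phi> p)) v)))
        (at (\<phi> p))"
      by (rule has_derivative_transform_within_open[OF has_derivative_compose[OF 1 2] A])
         (use cU'(1) cV'(1) in auto)
    from frechet_derivative_at[OF this] show ?thesis by metis
  qed
  then show ?thesis by (auto simp: coordinate_vector_def)
qed

text \<open>By the chain rule the Jacobian of the transition map converts components in one chart
  into components in another; the two inclusions use this with the charts interchanged.\<close>

lemma tangent_space_coordinates:
  assumes M: "is_manifold M" and \<theta>: "coordinate_system M U \<theta>" and p: "p \<in> U"
  shows "tangent_space M p = range (coordinate_vector M U \<theta> p)"
proof -
  have t: "tangent_space M p = {v. \<exists>(V, \<phi>)\<in>atlas M. p \<in> V \<and> (\<exists>a. v = coordinate_vector M V \<phi> p a)}"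
    by (simp add: tangent_space_def coordinate_vector_def)
  have comp: "smoothly_compatible (U, \<theta>) (V, \<phi>)" "coordinate_system M V \<phi>" if "(V, \<phi>) \<in> atlas M" for V \<phi>
    using \<theta> that atlas_chart[OF M that] by (auto simp: coordinate_system_def)
  have "p \<in> carrier_of M"
    using \<theta> p chart_homeomorphic(3) by (auto simp: coordinate_system_def carrier_of_def)
  then obtain V \<phi> where V: "(V, \<phi>) \<in> atlas M" "p \<in> V" using atlas_cover[OF M] by blast
  show ?thesis
  proof (intro equalityI subsetI)
    fix v assume "v \<in> tangent_space M p"
    then show "v \<in> range (coordinate_vector M U \<theta> p)"
      unfolding t using coordinate_vector_change[OF M \<theta> comp(2) comp(1) p] by auto
  next
    fix v assume "v \<in> range (coordinate_vector M U \<theta> p)"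
    then show "v \<in> tangent_space M p"
      unfolding t using V coordinate_vector_change[OF M comp(2)[OF V(1)] \<theta> smoothly_compatible_sym[OF comp(1)[OF V(1)]] V(2) p]
      by auto
  qed
qed

section \<open>Vector fields as coefficient functions in a global chart\<close>

locale global_chart =
  fixes M :: "('p, 'n::finite) manifold" and \<theta> :: "'p \<Rightarrow> real^'n"
  assumes manifold: "is_manifold M" and coordinates: "coordinate_system M (carrier_of M) \<theta>"
begin

abbreviation \<sigma> :: "real^'n \<Rightarrow> 'p" where "\<sigma> \<equiv> inv_into (carrier_of M) \<theta>"

abbreviation smooth :: "('p \<Rightarrow> real) \<Rightarrow> bool" where "smooth \<equiv> smooth_fun M (carrier_of M)"

abbreviation VF :: "'p vfield set" where "VF \<equiv> vector_fields M"

definition coef :: "'p vfield \<Rightarrow> 'p \<Rightarrow> real^'n" where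
  "coef V p = (\<chi> i. V p (\<lambda>q. \<theta> q $ i))"

text \<open>Inverse to \<open>coef\<close>. It vanishes off the carrier automatically, because no
  function is \<open>smooth_at\<close> a point outside of it.\<close>

definition field_of :: "('p \<Rightarrow> real^'n) \<Rightarrow> 'p vfield" where
  "field_of a p = coordinate_vector M (carrier_of M) \<theta> p (a p)"

lemma global_chart: "chart (mtop M) (carrier_of M) \<theta>"
  using coordinates by (simp add: coordinate_system_def)

lemma inv_\<theta>[simp]: "p \<in> carrier_of M \<Longrightarrow> \<sigma> (\<theta> p) = p"
  using chart_homeomorphic(1)[OF global_chart] by simp

lemma open_image: "openin (mtop M) U \<Longrightarrow> open (\<theta> ` U)"
  using chart_homeomorphic(4)[OF global_chart] openin_subset by (auto simp: carrier_of_def)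

lemma openin_carrier: "openin (mtop M) (carrier_of M)"
  by (simp add: carrier_of_def)

lemma smooth_fun_iff:
  "smooth_fun M U f \<longleftrightarrow> openin (mtop M) U \<and> smooth_on (\<theta> ` U) (f \<circ> \<sigma>)"
  using smooth_fun_coordinates_iff[OF manifold coordinates, of U f] openin_subset[of "mtop M" U]
    smooth_fun_openin[of M U f] by (auto simp: carrier_of_def)

lemma smooth_funI:
  assumes "openin (mtop M) U" "smooth_on (\<theta> ` U) F" "\<And>p. p \<in> U \<Longrightarrow> f p = F (\<theta> p)"
  shows "smooth_fun M U f"
  unfolding smooth_fun_iff
  by (intro conjI assms(1) smooth_on_cong[OF open_image[OF assms(1)] _ assms(2)])
     (use assms(1,3) openin_subset[OF assms(1)] in \<open>auto simp: carrier_of_def[symmetric] subset_iff\<close>)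

lemma smooth_fun_cong:
  "smooth_fun M U f \<Longrightarrow> (\<And>p. p \<in> U \<Longrightarrow> g p = f p) \<Longrightarrow> smooth_fun M U g"
  using smooth_fun_subset_carrier[of M U f]
  by (intro smooth_funI[where F = "f \<circ> \<sigma>"]) (auto simp: smooth_fun_iff subset_iff)

lemma smooth_fun_restrict:
  "smooth f \<Longrightarrow> openin (mtop M) U \<Longrightarrow> smooth_fun M U f"
  using openin_subset[of "mtop M" U]
  by (auto simp: smooth_fun_iff carrier_of_def elim!: smooth_on_subset)

lemma smooth_fun_const: "openin (mtop M) U \<Longrightarrow> smooth_fun M U (\<lambda>p. c)"
  by (simp add: smooth_fun_iff o_def smooth_on_const)

lemma smooth_fun_add: "smooth_fun M U f \<Longrightarrow> smooth_fun M U g \<Longrightarrow> smooth_fun M U (\<lambda>p. f p + g p)"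
  using smooth_on_add[OF open_image] by (auto simp: smooth_fun_iff o_def)

lemma smooth_fun_diff: "smooth_fun M U f \<Longrightarrow> smooth_fun M U g \<Longrightarrow> smooth_fun M U (\<lambda>p. f p - g p)"
  using smooth_on_diff[OF open_image] by (auto simp: smooth_fun_iff o_def)

lemma smooth_fun_mult: "smooth_fun M U f \<Longrightarrow> smooth_fun M U g \<Longrightarrow> smooth_fun M U (\<lambda>p. f p * g p)"
  using smooth_on_mult[OF open_image] by (auto simp: smooth_fun_iff o_def)

lemma smooth_fun_sum:
  assumes "openin (mtop M) U" "\<And>i. i \<in> A \<Longrightarrow> smooth_fun M U (f i)"
  shows "smooth_fun M U (\<lambda>p. \<Sum>i\<in>A. f i p)"
  using assms by (auto simp: smooth_fun_iff o_def intro!: smooth_on_sum[OF open_image])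

lemma smooth_fun_compose:
  fixes F :: "real \<Rightarrow> real"
  assumes "smooth_fun M U f" "open A" "smooth_on A F" "\<And>p. p \<in> U \<Longrightarrow> f p \<in> A"
  shows "smooth_fun M U (\<lambda>p. F (f p))"
proof -
  have U: "openin (mtop M) U" "smooth_on (\<theta> ` U) (f \<circ> \<sigma>)" using assms(1) by (simp_all add: smooth_fun_iff)
  show ?thesis
  proof (rule smooth_funI[OF U(1)])
    have "(f \<circ> \<sigma>) ` \<theta> ` U \<subseteq> A"
      using assms(4) smooth_fun_subset_carrier[OF assms(1)] by (auto simp: subset_iff)
    then show "smooth_on (\<theta> ` U) (\<lambda>u. F ((f \<circ> \<sigma>) u))"
      by (rule smooth_on_compose[OF open_image[OF U(1)] \<open>open A\<close> _ U(2) assms(3)])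
    show "F (f p) = F ((f \<circ> \<sigma>) (\<theta> p))" if "p \<in> U" for p
      using that smooth_fun_subset_carrier[OF assms(1)] by (simp add: subset_iff)
  qed
qed

lemma smooth_coordinate: "smooth (\<lambda>q. \<theta> q $ i)"
  by (rule smooth_funI[where F = "\<lambda>u. u $ i"])
     (auto intro: openin_carrier smooth_on_bounded_linear bounded_linear_vec_nth)

lemma smooth_at_fun: "smooth_fun M U f \<Longrightarrow> p \<in> U \<Longrightarrow> smooth_at M p f"
  by (auto simp: smooth_at_def)

lemma field_of_apply:
  assumes "smooth_at M p f" "((f \<circ> \<sigma>) has_derivative F') (at (\<theta> p))"
  shows "field_of a p f = F' (a p)"
  using assms frechet_derivative_at[OF assms(2)] by (simp add: field_of_def coordinate_vector_def)

lemma coef_field_of: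
  assumes "p \<in> carrier_of M" shows "coef (field_of a) p = a p"
proof -
  have "field_of a p (\<lambda>q. \<theta> q $ i) = a p $ i" for i
  proof (rule field_of_apply[where F' = "\<lambda>v. v $ i"])
    show "smooth_at M p (\<lambda>q. \<theta> q $ i)" using smooth_at_fun[OF smooth_coordinate assms] .
    have "((\<lambda>u. u $ i) has_derivative (\<lambda>v. v $ i)) (at (\<theta> p))"
      by (rule bounded_linear_imp_has_derivative[OF bounded_linear_vec_nth])
    then show "((\<lambda>q. \<theta> q $ i) \<circ> \<sigma> has_derivative (\<lambda>v. v $ i)) (at (\<theta> p))"
      by (rule has_derivative_transform_within_open[OF _ open_image[OF openin_carrier]]) (use assms in auto)
  qed
  then show ?thesis by (simp add: coef_def vec_eq_iff)
qed

lemma field_of_vector_field: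
  assumes "\<And>i. smooth (\<lambda>p. a p $ i)"
  shows "field_of a \<in> VF"
  unfolding vector_fields_def
proof (intro CollectI conjI allI ballI impI)
  fix p assume "p \<in> carrier_of M"
  then show "field_of a p \<in> tangent_space M p"
    by (simp add: tangent_space_coordinates[OF manifold coordinates] field_of_def)
next
  fix p assume "p \<notin> carrier_of M"
  then show "field_of a p = (\<lambda>f. 0)"
    using smooth_at_carrier[of M p] by (auto simp: field_of_def coordinate_vector_def fun_eq_iff)
next
  fix U f assume f: "smooth_fun M U f"
  then have U: "U \<subseteq> carrier_of M" "openin (mtop M) U" by (auto simp: smooth_fun_subset_carrier smooth_fun_openin)
  show "smooth_fun M U (\<lambda>p. field_of a p f)"
  \<comment> \<open>The hypothesis speaks about the components of \<open>a\<close>, so the direction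
    is written as a combination of axis vectors with smooth scalar coefficients.\<close>
  proof (rule smooth_funI[OF U(2), where F = "\<lambda>u. frechet_derivative (f \<circ> \<sigma>) (at u) (\<Sum>i\<in>UNIV. a (\<sigma> u) $ i *\<^sub>R axis i 1)"])
    have "smooth_on (\<theta> ` U) (\<lambda>u. a (\<sigma> u) $ i)" for i
      using smooth_fun_restrict[OF assms U(2), of i] by (simp add: smooth_fun_iff o_def)
    then show "smooth_on (\<theta> ` U) (\<lambda>u. frechet_derivative (f \<circ> \<sigma>) (at u) (\<Sum>i\<in>UNIV. a (\<sigma> u) $ i *\<^sub>R axis i 1))"
      using f unfolding smooth_fun_iff
      by (intro smooth_on_derivative smooth_on_sum smooth_on_scaleR smooth_on_const open_image U) auto
  next
    fix p assume p: "p \<in> U"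
    have "(\<Sum>i\<in>UNIV. a p $ i *\<^sub>R axis i 1) = a p"
      using basis_expansion[of "a p"] by (simp add: scalar_mult_eq_scaleR)
    then show "field_of a p f = frechet_derivative (f \<circ> \<sigma>) (at (\<theta> p)) (\<Sum>i\<in>UNIV. a (\<sigma> (\<theta> p)) $ i *\<^sub>R axis i 1)"
      using p U smooth_at_fun[OF f p] by (simp add: field_of_def coordinate_vector_def subset_iff)
  qed
qed

lemma field_of_cong: "(\<And>p. p \<in> carrier_of M \<Longrightarrow> a p = b p) \<Longrightarrow> field_of a = field_of b"
proof (intro ext)
  fix p f assume "\<And>p. p \<in> carrier_of M \<Longrightarrow> a p = b p"
  then show "field_of a p f = field_of b p f"
    using smooth_at_carrier[of M p f] by (cases "smooth_at M p f") (simp_all add: field_of_def coordinate_vector_def)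
qed

lemma vector_field_outside: "V \<in> VF \<Longrightarrow> p \<notin> carrier_of M \<Longrightarrow> V p f = 0"
  by (simp add: vector_fields_def)

text \<open>Owing to the extension by zero this is an equality of HOL functions, including the
  values on nonsmooth arguments and off the carrier. Two fields are therefore equal once they agree
  on the coordinate functions.\<close>

lemma vector_field_eq: assumes "V \<in> VF" shows "V = field_of (coef V)"
proof
  fix p
  show "V p = field_of (coef V) p"
  proof (cases "p \<in> carrier_of M")
    case True
    then have "V p \<in> range (coordinate_vector M (carrier_of M) \<theta> p)"
      using assms tangent_space_coordinates[OF manifold coordinates True] by (auto simp: vector_fields_def)
    then obtain a where a: "V p = coordinate_vector M (carrier_of M) \<theta> p a" by auto
    then have "coef V p = coef (field_of (\<lambda>_. a)) p" by (simp add: coef_def field_of_def)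
    then show ?thesis using coef_field_of[OF True] a by (simp add: field_of_def)
  next
    case False
    then show ?thesis
      using vector_field_outside[OF assms] smooth_at_carrier[of M p]
      by (auto simp: field_of_def coordinate_vector_def fun_eq_iff)
  qed
qed

lemma vector_field_eqI:
  assumes "V \<in> VF" "W \<in> VF" "\<And>p i. p \<in> carrier_of M \<Longrightarrow> V p (\<lambda>q. \<theta> q $ i) = W p (\<lambda>q. \<theta> q $ i)"
  shows "V = W"
proof -
  have "field_of (coef V) = field_of (coef W)"
    using assms(3) by (intro field_of_cong) (simp add: coef_def)
  then show ?thesis using vector_field_eq[OF assms(1)] vector_field_eq[OF assms(2)] by simp
qed

lemma vector_field_apply:
  assumes "V \<in> VF" "smooth_at M p f" "((f \<circ> \<sigma>) has_derivative F') (at (\<theta> p))"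
  shows "V p f = F' (coef V p)"
  by (subst vector_field_eq[OF assms(1)]) (rule field_of_apply[OF assms(2,3)])

lemma vector_field_smooth: "V \<in> VF \<Longrightarrow> smooth_fun M U f \<Longrightarrow> smooth_fun M U (\<lambda>p. V p f)"
  by (simp add: vector_fields_def)

lemma coef_smooth: "V \<in> VF \<Longrightarrow> smooth (\<lambda>p. coef V p $ i)"
  using vector_field_smooth[OF _ smooth_coordinate] by (simp add: coef_def)

lemma smooth_fun_derivative:
  assumes "smooth_fun M U f" "p \<in> U"
  shows "(f \<circ> \<sigma> has_derivative frechet_derivative (f \<circ> \<sigma>) (at (\<theta> p))) (at (\<theta> p))"
  using assms by (intro smooth_on_has_derivative[of "\<theta> ` U"]) (auto simp: smooth_fun_iff)

lemma vector_field_fun: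
  assumes "V \<in> VF" "smooth_fun M U f" "p \<in> U"
  shows "V p f = frechet_derivative (f \<circ> \<sigma>) (at (\<theta> p)) (coef V p)"
  using assms by (intro vector_field_apply smooth_fun_derivative smooth_at_fun)

text \<open>A tangent vector depends only on the germ of its argument. This is the substitute for
  rewriting under a vector field, needed because the formulas below hold only on the
  manifold.\<close>

lemma vector_field_cong:
  assumes "V \<in> VF" "smooth_fun M U f" "p \<in> U" "\<And>q. q \<in> U \<Longrightarrow> f q = g q"
  shows "V p f = V p g"
proof -
  have g: "smooth_fun M U g" using smooth_fun_cong[OF assms(2)] assms(4) by simp
  have "((g \<circ> \<sigma>) has_derivative frechet_derivative (f \<circ> \<sigma>) (at (\<theta> p))) (at (\<theta> p))"
    by (rule has_derivative_transform_within_open[OF smooth_fun_derivative[OF assms(2,3)] open_image[OF smooth_fun_openin[OF assms(2)]]])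
       (use assms(3,4) smooth_fun_subset_carrier[OF assms(2)] in \<open>auto simp: subset_iff\<close>)
  from vector_field_apply[OF assms(1) smooth_at_fun[OF g assms(3)] this] show ?thesis
    using vector_field_fun[OF assms(1-3)] by simp
qed

lemma vector_field_const: "V \<in> VF \<Longrightarrow> p \<in> carrier_of M \<Longrightarrow> V p (\<lambda>q. c) = 0"
  using vector_field_fun[OF _ smooth_fun_const[OF openin_carrier], of V p c] by (simp add: o_def)

lemma vector_field_add:
  assumes "V \<in> VF" "smooth_fun M U f" "smooth_fun M U g" "p \<in> U"
  shows "V p (\<lambda>q. f q + g q) = V p f + V p g"
  unfolding vector_field_fun[OF assms(1,2,4)] vector_field_fun[OF assms(1,3,4)]
  by (rule vector_field_apply[OF assms(1) smooth_at_fun[OF smooth_fun_add[OF assms(2,3)] assms(4)]])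
     (use has_derivative_add[OF smooth_fun_derivative[OF assms(2,4)] smooth_fun_derivative[OF assms(3,4)]]
       in \<open>simp add: o_def\<close>)

lemma vector_field_diff:
  assumes "V \<in> VF" "smooth_fun M U f" "smooth_fun M U g" "p \<in> U"
  shows "V p (\<lambda>q. f q - g q) = V p f - V p g"
  unfolding vector_field_fun[OF assms(1,2,4)] vector_field_fun[OF assms(1,3,4)]
  by (rule vector_field_apply[OF assms(1) smooth_at_fun[OF smooth_fun_diff[OF assms(2,3)] assms(4)]])
     (use has_derivative_diff[OF smooth_fun_derivative[OF assms(2,4)] smooth_fun_derivative[OF assms(3,4)]]
       in \<open>simp add: o_def\<close>)

lemma vector_field_mult:
  assumes "V \<in> VF" "smooth_fun M U f" "smooth_fun M U g" "p \<in> U"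
  shows "V p (\<lambda>q. f q * g q) = f p * V p g + V p f * g p"
proof -
  have "p \<in> carrier_of M" using assms smooth_fun_subset_carrier by blast
  then show ?thesis
    unfolding vector_field_fun[OF assms(1,2,4)] vector_field_fun[OF assms(1,3,4)]
    by (intro vector_field_apply[OF assms(1) smooth_at_fun[OF smooth_fun_mult[OF assms(2,3)] assms(4)],
          where F' = "\<lambda>v. f p * frechet_derivative (g \<circ> \<sigma>) (at (\<theta> p)) v
            + frechet_derivative (f \<circ> \<sigma>) (at (\<theta> p)) v * g p"])
       (use has_derivative_mult[OF smooth_fun_derivative[OF assms(2,4)] smooth_fun_derivative[OF assms(3,4)]]
         in \<open>simp add: o_def\<close>)
qed

lemma vector_field_mult_const:
  assumes "V \<in> VF" "smooth_fun M U f" "p \<in> U"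
  shows "V p (\<lambda>q. f q * c) = V p f * c" "V p (\<lambda>q. c * f q) = c * V p f"
proof -
  have U: "openin (mtop M) U" "p \<in> carrier_of M"
    using smooth_fun_openin[OF assms(2)] smooth_fun_subset_carrier[OF assms(2)] assms(3) by auto
  show "V p (\<lambda>q. f q * c) = V p f * c" "V p (\<lambda>q. c * f q) = c * V p f"
    using vector_field_mult[OF assms(1,2) smooth_fun_const[OF U(1)] assms(3), of c]
      vector_field_mult[OF assms(1) smooth_fun_const[OF U(1)] assms(2,3), of c]
      vector_field_const[OF assms(1) U(2)] by simp_all
qed

lemma vector_field_sum:
  assumes "V \<in> VF" "\<And>i. i \<in> A \<Longrightarrow> smooth_fun M U (f i)" "p \<in> U" "openin (mtop M) U"
  shows "V p (\<lambda>q. \<Sum>i\<in>A. f i q) = (\<Sum>i\<in>A. V p (f i))"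
proof -
  have "p \<in> carrier_of M" using assms(3) openin_subset[OF assms(4)] by (auto simp: carrier_of_def)
  note const = vector_field_const[OF assms(1) this]
  show ?thesis using assms(2)
  proof (induction A rule: infinite_finite_induct)
    case (insert j A)
    have "V p (\<lambda>q. f j q + (\<Sum>i\<in>A. f i q)) = V p (f j) + V p (\<lambda>q. \<Sum>i\<in>A. f i q)"
      using insert.prems by (intro vector_field_add[OF assms(1) _ smooth_fun_sum[OF assms(4)] assms(3)]) auto
    then show ?case using insert by simp
  qed (simp_all add: const)
qed

lemma vector_field_compose:
  fixes F :: "real \<Rightarrow> real"
  assumes "V \<in> VF" "smooth_fun M U f" "p \<in> U" "open A" "smooth_on A F" "\<And>q. q \<in> U \<Longrightarrow> f q \<in> A"
  shows "V p (\<lambda>q. F (f q)) = deriv F (f p) * V p f"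
proof -
  have p: "p \<in> carrier_of M" using assms smooth_fun_subset_carrier by blast
  have "(F has_derivative (*) (deriv F (f p))) (at ((f \<circ> \<sigma>) (\<theta> p)))"
    using smooth_on_real_deriv(2)[OF assms(4,5)] assms(3,6) p by (simp add: has_field_derivative_def)
  from has_derivative_compose[OF smooth_fun_derivative[OF assms(2,3)] this]
  have "((\<lambda>q. F (f q)) \<circ> \<sigma> has_derivative
      (\<lambda>v. deriv F (f p) * frechet_derivative (f \<circ> \<sigma>) (at (\<theta> p)) v)) (at (\<theta> p))"
    by (simp add: o_def)
  from vector_field_apply[OF assms(1) smooth_at_fun[OF smooth_fun_compose[OF assms(2,4,5,6)] assms(3)] this]
  show ?thesis unfolding vector_field_fun[OF assms(1-3)] .
qed

lemma vector_field_point: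
  assumes "V \<in> VF" shows "V p = coordinate_vector M (carrier_of M) \<theta> p (coef V p)"
  by (subst vector_field_eq[OF assms]) (simp only: field_of_def)

text \<open>On nonsmooth \<open>f\<close> the functional is zero and hence still linear in
  \<open>a\<close>; so algebra of coefficients carries over to fields without a smoothness condition
  on the argument.\<close>

lemma coordinate_vector_linear:
  "linear (\<lambda>a. coordinate_vector M (carrier_of M) \<theta> p a f)"
proof (cases "smooth_at M p f")
  case True
  then show ?thesis
    using has_derivative_linear[OF smooth_at_has_derivative[OF manifold coordinates smooth_at_carrier[OF True] True]]
    by (simp only: coordinate_vector_def if_True)
next
  case False
  then show ?thesis by (simp add: coordinate_vector_def linear_iff)
qed

lemma vf_add_eq:
  assumes "V \<in> VF" "W \<in> VF"
  shows "vf_add V W = field_of (\<lambda>p. coef V p + coef W p)"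
proof (intro ext)
  fix p f
  have "V p f + W p f = coordinate_vector M (carrier_of M) \<theta> p (coef V p + coef W p) f"
    by (simp only: linear_add[OF coordinate_vector_linear] vector_field_point[OF assms(1), symmetric]
        vector_field_point[OF assms(2), symmetric])
  then show "vf_add V W p f = field_of (\<lambda>p. coef V p + coef W p) p f"
    by (simp only: vf_add_def field_of_def)
qed

lemma vf_mult_eq:
  assumes "V \<in> VF"
  shows "vf_mult \<phi> V = field_of (\<lambda>p. \<phi> p *\<^sub>R coef V p)"
proof (intro ext)
  fix p f
  have "\<phi> p * V p f = coordinate_vector M (carrier_of M) \<theta> p (\<phi> p *\<^sub>R coef V p) f"
    by (simp only: linear_scale[OF coordinate_vector_linear] vector_field_point[OF assms(1), symmetric]
        real_scaleR_def)
  then show "vf_mult \<phi> V p f = field_of (\<lambda>p. \<phi> p *\<^sub>R coef V p) p f"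
    by (simp only: vf_mult_def field_of_def)
qed

lemma vf_add_closed: "V \<in> VF \<Longrightarrow> W \<in> VF \<Longrightarrow> vf_add V W \<in> VF"
  by (auto simp: vf_add_eq intro!: field_of_vector_field smooth_fun_add coef_smooth)

lemma vf_mult_closed: "smooth \<phi> \<Longrightarrow> V \<in> VF \<Longrightarrow> vf_mult \<phi> V \<in> VF"
  by (auto simp: vf_mult_eq intro!: field_of_vector_field smooth_fun_mult coef_smooth)

end

section \<open>Flat connections and Hessian structures in affine coordinates\<close>

lemma linear_eq_sum_axis:
  fixes f :: "real^'n::finite \<Rightarrow> real"
  assumes "linear f" shows "f v = (\<Sum>i\<in>UNIV. v $ i * f (axis i 1))"
proof -
  have "f v = f (\<Sum>i\<in>UNIV. v $ i *\<^sub>R axis i 1)"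
    using basis_expansion[of v] by (simp add: scalar_mult_eq_scaleR)
  also have "\<dots> = (\<Sum>i\<in>UNIV. v $ i * f (axis i 1))"
    by (simp only: linear_sum[OF assms] linear_scale[OF assms] real_scaleR_def)
  finally show ?thesis .
qed

context global_chart
begin

abbreviation \<xi> :: "'n \<Rightarrow> 'p \<Rightarrow> real" where "\<xi> i \<equiv> (\<lambda>q. \<theta> q $ i)"

lemma vector_field_fun_sum:
  assumes "V \<in> VF" "smooth_fun M U f" "p \<in> U"
  shows "V p f = (\<Sum>i\<in>UNIV. V p (\<xi> i) * frechet_derivative (f \<circ> \<sigma>) (at (\<theta> p)) (axis i 1))"
  unfolding vector_field_fun[OF assms]
    linear_eq_sum_axis[OF has_derivative_linear[OF smooth_fun_derivative[OF assms(2,3)]], of "coef V p"]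
  by (simp add: coef_def)

text \<open>Write \<open>W f\<close> as a combination of the partial derivatives \<open>P i\<close>
  and apply the product rule. The result separates a first-order part, with coefficients
  \<open>V(W \<xi>\<^sub>i)\<close>, from a second-order part that is symmetric in \<open>V\<close>
  and \<open>W\<close> once second partials commute.\<close>

lemma vector_field_second_derivative:
  assumes V: "V \<in> VF" and W: "W \<in> VF" and f: "smooth_fun M U f" and p: "p \<in> U"
  shows "V p (\<lambda>q. W q f) =
      (\<Sum>i\<in>UNIV. V p (\<lambda>q. W q (\<xi> i)) * frechet_derivative (f \<circ> \<sigma>) (at (\<theta> p)) (axis i 1)) +
      (\<Sum>i\<in>UNIV. \<Sum>j\<in>UNIV. W p (\<xi> i) * V p (\<xi> j) *
        frechet_derivative (\<lambda>u. frechet_derivative (f \<circ> \<sigma>) (at u) (axis i 1)) (at (\<theta> p)) (axis j 1))"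
proof -
  let ?D = "\<lambda>i u. frechet_derivative (f \<circ> \<sigma>) (at u) (axis i 1)"
  define P where "P = (\<lambda>i q. ?D i (\<theta> q))"
  have U: "openin (mtop M) U" "U \<subseteq> carrier_of M"
    using smooth_fun_openin[OF f] smooth_fun_subset_carrier[OF f] by auto
  have D: "smooth_on (\<theta> ` U) (?D i)" for i
    using f by (intro smooth_on_deriv) (simp add: smooth_fun_iff)
  have P: "smooth_fun M U (P i)" for i
    by (rule smooth_funI[OF U(1) D]) (simp add: P_def)
  have W\<xi>: "smooth_fun M U (\<lambda>q. W q (\<xi> i))" for i
    by (rule smooth_fun_restrict[OF vector_field_smooth[OF W smooth_coordinate] U(1)])
  have VP: "V p (P i) = (\<Sum>j\<in>UNIV. V p (\<xi> j) * frechet_derivative (?D i) (at (\<theta> p)) (axis j 1))" for i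
  proof -
    have d: "(?D i has_derivative frechet_derivative (?D i) (at (\<theta> p))) (at (\<theta> p))"
      using p by (intro smooth_on_has_derivative[OF D]) auto
    have "(P i \<circ> \<sigma> has_derivative frechet_derivative (?D i) (at (\<theta> p))) (at (\<theta> p))"
      by (rule has_derivative_transform_within_open[OF d open_image[OF U(1)]])
         (use p U(2) in \<open>auto simp: P_def subset_iff\<close>)
    from vector_field_apply[OF V smooth_at_fun[OF P p] this] 
    show ?thesis using linear_eq_sum_axis[OF has_derivative_linear[OF d], of "coef V p"] by (simp add: coef_def)
  qed
  have "V p (\<lambda>q. W q f) = V p (\<lambda>q. \<Sum>i\<in>UNIV. W q (\<xi> i) * P i q)"
    by (rule vector_field_cong[OF V vector_field_smooth[OF W f] p])
       (simp add: vector_field_fun_sum[OF W f] P_def)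
  also have "\<dots> = (\<Sum>i\<in>UNIV. V p (\<lambda>q. W q (\<xi> i) * P i q))"
    by (rule vector_field_sum[OF V _ p U(1)]) (intro smooth_fun_mult W\<xi> P)
  also have "\<dots> = (\<Sum>i\<in>UNIV. W p (\<xi> i) * V p (P i) + V p (\<lambda>q. W q (\<xi> i)) * P i p)"
    by (intro sum.cong refl vector_field_mult[OF V W\<xi> P p])
  finally show ?thesis
    unfolding VP by (simp add: sum.distrib sum_distrib_left P_def mult.assoc)
qed

text \<open>The second-order parts of \<open>VW\<close> and \<open>WV\<close> cancel by
  \<open>frechet_derivative_commute\<close>, leaving a derivation given by its values on the
  coordinates.\<close>

lemma vf_bracket_eq:
  assumes V: "V \<in> VF" and W: "W \<in> VF"
  shows "vf_bracket M V W = field_of (\<lambda>p. \<chi> i. V p (\<lambda>q. W q (\<xi> i)) - W p (\<lambda>q. V q (\<xi> i)))"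
proof (intro ext)
  fix p f
  let ?a = "\<lambda>p. \<chi> i. V p (\<lambda>q. W q (\<xi> i)) - W p (\<lambda>q. V q (\<xi> i))"
  show "vf_bracket M V W p f = field_of ?a p f"
  proof (cases "smooth_at M p f")
    case False
    then show ?thesis by (simp add: vf_bracket_def field_of_def coordinate_vector_def)
  next
    case True
    then obtain U where U: "p \<in> U" "smooth_fun M U f" by (auto simp: smooth_at_def)
    let ?D = "\<lambda>i u. frechet_derivative (f \<circ> \<sigma>) (at u) (axis i 1)"
    let ?H = "\<lambda>i j. frechet_derivative (?D i) (at (\<theta> p)) (axis j 1)"
    have sym: "?H i j = ?H j i" for i j
      using U by (intro frechet_derivative_commute[of "\<theta> ` U"] open_image) (auto simp: smooth_fun_iff)
    have "(\<Sum>i\<in>UNIV. \<Sum>j\<in>UNIV. W p (\<xi> i) * V p (\<xi> j) * ?H i j)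
        = (\<Sum>j\<in>UNIV. \<Sum>i\<in>UNIV. W p (\<xi> i) * V p (\<xi> j) * ?H i j)"
      by (rule sum.swap)
    also have "\<dots> = (\<Sum>j\<in>UNIV. \<Sum>i\<in>UNIV. V p (\<xi> j) * W p (\<xi> i) * ?H j i)"
      by (intro sum.cong refl) (subst sym, simp)
    finally have "vf_bracket M V W p f = (\<Sum>i\<in>UNIV. V p (\<lambda>q. W q (\<xi> i)) * ?D i (\<theta> p))
        - (\<Sum>i\<in>UNIV. W p (\<lambda>q. V q (\<xi> i)) * ?D i (\<theta> p))"
      using True vector_field_second_derivative[OF V W U(2,1)] vector_field_second_derivative[OF W V U(2,1)]
      by (simp add: vf_bracket_def)
    also have "\<dots> = (\<Sum>i\<in>UNIV. ?a p $ i * ?D i (\<theta> p))"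
      by (simp add: left_diff_distrib sum_subtractf)
    also have "\<dots> = frechet_derivative (f \<circ> \<sigma>) (at (\<theta> p)) (?a p)"
      by (rule linear_eq_sum_axis[symmetric, OF has_derivative_linear[OF smooth_fun_derivative[OF U(2,1)]]])
    also have "\<dots> = field_of ?a p f"
      by (rule field_of_apply[symmetric, OF True smooth_fun_derivative[OF U(2,1)]])
    finally show ?thesis .
  qed
qed

lemma second_derivative_coordinate_smooth:
  "V \<in> VF \<Longrightarrow> W \<in> VF \<Longrightarrow> smooth (\<lambda>p. V p (\<lambda>q. W q (\<xi> i)))"
  by (rule vector_field_smooth[OF _ vector_field_smooth[OF _ smooth_coordinate]])

lemma vf_bracket_closed: "V \<in> VF \<Longrightarrow> W \<in> VF \<Longrightarrow> vf_bracket M V W \<in> VF"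
  unfolding vf_bracket_eq
  by (rule field_of_vector_field) (simp add: smooth_fun_diff second_derivative_coordinate_smooth)

text \<open>The connection whose Christoffel symbols vanish in the coordinates
  \<open>\<theta>\<close>: it differentiates coefficients and keeps the coordinate fields
  parallel.\<close>

definition affine_derivative :: "'p connection" where
  "affine_derivative Z V = field_of (\<lambda>p. \<chi> i. Z p (\<lambda>q. V q (\<xi> i)))"

lemma affine_derivative_closed: "Z \<in> VF \<Longrightarrow> V \<in> VF \<Longrightarrow> affine_derivative Z V \<in> VF"
  unfolding affine_derivative_def
  by (rule field_of_vector_field) (simp add: second_derivative_coordinate_smooth)

lemma affine_derivative_coordinate:
  "p \<in> carrier_of M \<Longrightarrow> affine_derivative Z V p (\<xi> i) = Z p (\<lambda>q. V q (\<xi> i))"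
  using coef_field_of[of p "\<lambda>p. \<chi> i. Z p (\<lambda>q. V q (\<xi> i))"]
  by (simp add: affine_derivative_def coef_def vec_eq_iff)

lemma field_of_diff: "field_of a p f - field_of b p f = field_of (\<lambda>p. a p - b p) p f"
  by (simp only: field_of_def linear_diff[OF coordinate_vector_linear])

lemma field_of_zero: "field_of (\<lambda>p. 0) p f = 0"
  by (simp only: field_of_def linear_0[OF coordinate_vector_linear])

text \<open>Agreement is asked only on vector fields, because a connection given by a definite
  description, as \<open>ht_connection\<close> is, can be controlled only there. On coordinate
  functions the axioms reduce to linearity and the product rule.\<close>

lemma affine_connection_cong:
  assumes "\<And>Z V. Z \<in> VF \<Longrightarrow> V \<in> VF \<Longrightarrow> nab Z V = affine_derivative Z V"
  shows "affine_connection M nab"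
  unfolding affine_connection_def
proof (intro conjI ballI allI impI)
  fix Z V assume Z: "Z \<in> VF" and V: "V \<in> VF"
  show "nab Z V \<in> VF" using assms Z V affine_derivative_closed by simp
  fix V' assume V': "V' \<in> VF"
  show "nab (vf_add Z V') V = vf_add (nab Z V) (nab V' V)"
    unfolding assms[OF Z V] assms[OF V' V] assms[OF vf_add_closed[OF Z V'] V]
    using Z V V'
    by (intro vector_field_eqI affine_derivative_closed vf_add_closed)
       (simp_all add: affine_derivative_coordinate vf_add_def)
  show "nab Z (vf_add V V') = vf_add (nab Z V) (nab Z V')"
    unfolding assms[OF Z V] assms[OF Z V'] assms[OF Z vf_add_closed[OF V V']]
  proof (intro vector_field_eqI affine_derivative_closed vf_add_closed Z V V')
    fix p i assume p: "p \<in> carrier_of M"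
    have "Z p (\<lambda>q. V q (\<xi> i) + V' q (\<xi> i)) = Z p (\<lambda>q. V q (\<xi> i)) + Z p (\<lambda>q. V' q (\<xi> i))"
      by (rule vector_field_add[OF Z vector_field_smooth[OF V smooth_coordinate]
            vector_field_smooth[OF V' smooth_coordinate] p])
    then show "affine_derivative Z (vf_add V V') p (\<xi> i)
        = vf_add (affine_derivative Z V) (affine_derivative Z V') p (\<xi> i)"
      using p by (simp add: affine_derivative_coordinate vf_add_def)
  qed
next
  fix \<phi> Z V assume \<phi>: "smooth \<phi>" and Z: "Z \<in> VF" and V: "V \<in> VF"
  show "nab (vf_mult \<phi> Z) V = vf_mult \<phi> (nab Z V)"
    unfolding assms[OF Z V] assms[OF vf_mult_closed[OF \<phi> Z] V]
    using Z V \<phi>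
    by (intro vector_field_eqI affine_derivative_closed vf_mult_closed)
       (simp_all add: affine_derivative_coordinate vf_mult_def)
  show "nab Z (vf_mult \<phi> V) = vf_add (vf_mult (\<lambda>p. Z p \<phi>) V) (vf_mult \<phi> (nab Z V))"
    unfolding assms[OF Z V] assms[OF Z vf_mult_closed[OF \<phi> V]]
  proof (intro vector_field_eqI affine_derivative_closed vf_add_closed vf_mult_closed
      vector_field_smooth[OF Z \<phi>] Z V \<phi>)
    fix p i assume p: "p \<in> carrier_of M"
    have "Z p (\<lambda>q. \<phi> q * V q (\<xi> i)) = \<phi> p * Z p (\<lambda>q. V q (\<xi> i)) + Z p \<phi> * V p (\<xi> i)"
      by (rule vector_field_mult[OF Z \<phi> vector_field_smooth[OF V smooth_coordinate] p])
    then show "affine_derivative Z (vf_mult \<phi> V) p (\<xi> i)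
        = vf_add (vf_mult (\<lambda>p. Z p \<phi>) V) (vf_mult \<phi> (affine_derivative Z V)) p (\<xi> i)"
      using p by (simp add: affine_derivative_coordinate vf_add_def vf_mult_def)
  qed
qed

text \<open>In coefficients, torsion compares the antisymmetrized derivatives with the bracket
  formula \<open>vf_bracket_eq\<close>, and curvature is \<open>V(W(Z \<xi>\<^sub>i)) - W(V(Z
  \<xi>\<^sub>i)) - [V, W](Z \<xi>\<^sub>i)\<close>, which is zero by the definition of the
  bracket.\<close>

lemma flat_connection_cong:
  assumes nab: "\<And>Z V. Z \<in> VF \<Longrightarrow> V \<in> VF \<Longrightarrow> nab Z V = affine_derivative Z V"
  shows "flat_connection M nab"
  unfolding flat_connection_def
proof (intro conjI ballI)
  show "affine_connection M nab" by (rule affine_connection_cong[OF nab])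
next
  fix V W assume V: "V \<in> VF" and W: "W \<in> VF"
  show "torsion M nab V W = (\<lambda>p f. 0)"
  proof (intro ext)
    fix p f
    have "torsion M nab V W p f = field_of (\<lambda>p. (\<chi> i. V p (\<lambda>q. W q (\<xi> i))) - (\<chi> i. W p (\<lambda>q. V q (\<xi> i)))
        - (\<chi> i. V p (\<lambda>q. W q (\<xi> i)) - W p (\<lambda>q. V q (\<xi> i)))) p f"
      by (simp only: torsion_def nab[OF V W] nab[OF W V] affine_derivative_def vf_bracket_eq[OF V W] field_of_diff)
    also have "\<dots> = field_of (\<lambda>p. 0) p f"
      by (rule arg_cong[where f = "\<lambda>F. F p f"], rule field_of_cong) (simp add: vec_eq_iff)
    finally show "torsion M nab V W p f = 0" by (simp only: field_of_zero)
  qed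
next
  fix V W Z assume V: "V \<in> VF" and W: "W \<in> VF" and Z: "Z \<in> VF"
  note closed = affine_derivative_closed[OF W Z] affine_derivative_closed[OF V Z] vf_bracket_closed[OF V W]
  have 1: "A p (\<lambda>q. affine_derivative B Z q (\<xi> i)) = A p (\<lambda>q. B q (\<lambda>r. Z r (\<xi> i)))"
    if "A \<in> VF" "B \<in> VF" "p \<in> carrier_of M" for A B p i
    using that
    by (intro vector_field_cong[OF that(1) vector_field_smooth[OF affine_derivative_closed[OF that(2) Z] smooth_coordinate]])
       (simp_all add: affine_derivative_coordinate)
  have 2: "vf_bracket M V W p (\<lambda>q. Z q (\<xi> i))
      = V p (\<lambda>q. W q (\<lambda>r. Z r (\<xi> i))) - W p (\<lambda>q. V q (\<lambda>r. Z r (\<xi> i)))" if "p \<in> carrier_of M" for p i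
    using smooth_at_fun[OF vector_field_smooth[OF Z smooth_coordinate] that] by (simp add: vf_bracket_def)
  show "curvature M nab V W Z = (\<lambda>p f. 0)"
  proof (intro ext)
    fix p f
    have "curvature M nab V W Z p f = field_of (\<lambda>p. (\<chi> i. V p (\<lambda>q. affine_derivative W Z q (\<xi> i)))
       - (\<chi> i. W p (\<lambda>q. affine_derivative V Z q (\<xi> i)))
       - (\<chi> i. vf_bracket M V W p (\<lambda>q. Z q (\<xi> i)))) p f"
      by (simp only: curvature_def nab[OF V Z] nab[OF W Z] nab[OF V closed(1)] nab[OF W closed(2)]
          nab[OF closed(3) Z] affine_derivative_def[of V "affine_derivative W Z"]
          affine_derivative_def[of W "affine_derivative V Z"] affine_derivative_def[of "vf_bracket M V W" Z] field_of_diff)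
    also have "\<dots> = field_of (\<lambda>p. 0) p f"
      by (rule arg_cong[where f = "\<lambda>F. F p f"], rule field_of_cong) (simp add: vec_eq_iff 1 2 V W)
    finally show "curvature M nab V W Z p f = 0" by (simp only: field_of_zero)
  qed
qed

text \<open>The product rule splits \<open>V(W \<Phi>)\<close> into the sums of
  \<open>W(\<xi>\<^sub>i) V(\<eta>\<^sub>i)\<close> and of
  \<open>V(W \<xi>\<^sub>i) \<eta>\<^sub>i\<close>. The second is the derivative of
  \<open>\<Phi>\<close> along the affine derivative of \<open>W\<close> by \<open>V\<close>, so the
  Hessian is the first, \<open>g W V\<close>, and symmetry gives \<open>g V W\<close>.\<close>

lemma hessian_structure_dual_coordinates:
  assumes nab: "\<And>Z V. Z \<in> VF \<Longrightarrow> V \<in> VF \<Longrightarrow> nab Z V = affine_derivative Z V"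
    and \<eta>: "\<And>i. smooth (\<eta> i)"
    and g: "\<And>V W p. V \<in> VF \<Longrightarrow> W \<in> VF \<Longrightarrow> p \<in> carrier_of M \<Longrightarrow>
        g V W p = (\<Sum>i\<in>UNIV. V p (\<xi> i) * W p (\<eta> i))"
    and sym: "\<And>V W p. V \<in> VF \<Longrightarrow> W \<in> VF \<Longrightarrow> p \<in> carrier_of M \<Longrightarrow> g V W p = g W V p"
    and pos: "\<And>V p. V \<in> VF \<Longrightarrow> p \<in> carrier_of M \<Longrightarrow> V p \<noteq> (\<lambda>f. 0) \<Longrightarrow> g V V p > 0"
    and \<Phi>: "smooth \<Phi>"
    and d\<Phi>: "\<And>V p. V \<in> VF \<Longrightarrow> p \<in> carrier_of M \<Longrightarrow> V p \<Phi> = (\<Sum>i\<in>UNIV. V p (\<xi> i) * \<eta> i p)"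
  shows "global_potential M g nab \<Phi>" and "hessian_structure M g nab"
proof -
  have "riemannian_metric M g"
    unfolding riemannian_metric_def
  proof (intro conjI ballI allI impI)
    fix V W assume V: "V \<in> VF" and W: "W \<in> VF"
    show "smooth (g V W)"
    proof (rule smooth_fun_cong)
      show "smooth (\<lambda>p. \<Sum>i\<in>UNIV. V p (\<xi> i) * W p (\<eta> i))"
        by (intro smooth_fun_sum openin_carrier smooth_fun_mult vector_field_smooth[OF V smooth_coordinate]
            vector_field_smooth[OF W \<eta>])
    qed (rule g[OF V W])
  next
    fix V W p assume "V \<in> VF" "W \<in> VF" "p \<in> carrier_of M"
    then show "g V W p = g W V p" by (rule sym)
  next
    fix V V' W p assume "V \<in> VF" "V' \<in> VF" "W \<in> VF" "p \<in> carrier_of M"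
    then show "g (vf_add V V') W p = g V W p + g V' W p"
      by (simp add: g vf_add_closed) (simp add: vf_add_def distrib_right sum.distrib)
  next
    fix \<phi> V W p assume "smooth \<phi>" "V \<in> VF" "W \<in> VF" "p \<in> carrier_of M"
    then show "g (vf_mult \<phi> V) W p = \<phi> p * g V W p"
      by (simp add: g vf_mult_closed) (simp add: vf_mult_def sum_distrib_left mult.assoc)
  next
    fix V p assume "V \<in> VF" "p \<in> carrier_of M" "V p \<noteq> (\<lambda>f. 0)"
    then show "g V V p > 0" by (rule pos)
  qed
  moreover have "g V W p = hessian nab \<Phi> V W p" if V: "V \<in> VF" and W: "W \<in> VF" and p: "p \<in> carrier_of M" for V W p
  proof -
    note W\<xi> = vector_field_smooth[OF W smooth_coordinate]
    have "V p (\<lambda>q. W q \<Phi>) = V p (\<lambda>q. \<Sum>i\<in>UNIV. W q (\<xi> i) * \<eta> i q)"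
      by (rule vector_field_cong[OF V vector_field_smooth[OF W \<Phi>] p]) (rule d\<Phi>[OF W])
    also have "\<dots> = (\<Sum>i\<in>UNIV. V p (\<lambda>q. W q (\<xi> i) * \<eta> i q))"
      by (rule vector_field_sum[OF V _ p openin_carrier]) (intro smooth_fun_mult W\<xi> \<eta>)
    also have "\<dots> = (\<Sum>i\<in>UNIV. W p (\<xi> i) * V p (\<eta> i) + V p (\<lambda>q. W q (\<xi> i)) * \<eta> i p)"
      by (intro sum.cong refl vector_field_mult[OF V W\<xi> \<eta> p])
    finally have 1: "V p (\<lambda>q. W q \<Phi>) = g W V p + (\<Sum>i\<in>UNIV. V p (\<lambda>q. W q (\<xi> i)) * \<eta> i p)"
      by (simp add: sum.distrib g[OF W V p])
    have "nab V W p \<Phi> = (\<Sum>i\<in>UNIV. V p (\<lambda>q. W q (\<xi> i)) * \<eta> i p)"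
      unfolding nab[OF V W] d\<Phi>[OF affine_derivative_closed[OF V W] p] affine_derivative_coordinate[OF p] ..
    then show ?thesis using 1 sym[OF V W p] by (simp add: hessian_def)
  qed
  then have "potential_on M g nab (carrier_of M) \<Phi>" using \<Phi> by (simp add: potential_on_def)
  ultimately show "hessian_structure M g nab" "global_potential M g nab \<Phi>"
    using flat_connection_cong[OF nab] by (auto simp: hessian_structure_def global_potential_def)
qed

end

section \<open>Gluing of coordinate systems\<close>

lemma chartI:
  fixes \<phi> :: "'p \<Rightarrow> real^'n::finite"
  assumes U: "openin X U" and inj: "inj_on \<phi> U"
    and op: "\<And>W. W \<subseteq> U \<Longrightarrow> openin X W \<Longrightarrow> open (\<phi> ` W)"
    and cont: "\<And>S. open S \<Longrightarrow> openin X {p \<in> U. \<phi> p \<in> S}"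
  shows "chart X U \<phi>"
  unfolding chart_def
proof (intro conjI)
  have top: "topspace (subtopology X U) = U" using openin_subset[OF U] by auto
  show "openin X U" by (rule U)
  show oU: "open (\<phi> ` U)" using op U by blast
  show "homeomorphic_map (subtopology X U) (top_of_set (\<phi> ` U)) \<phi>"
  proof (rule bijective_open_imp_homeomorphic_map)
    show "continuous_map (subtopology X U) (top_of_set (\<phi> ` U)) \<phi>"
      unfolding continuous_map_def
    proof (intro conjI allI impI)
      show "\<phi> \<in> topspace (subtopology X U) \<rightarrow> topspace (top_of_set (\<phi> ` U))"
        unfolding top by auto
      fix S assume "openin (top_of_set (\<phi> ` U)) S"
      then have "open S" using oU openin_open_eq by blast
      then show "openin (subtopology X U) {x \<in> topspace (subtopology X U). \<phi> x \<in> S}"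
        unfolding top using cont[of S] U by (auto simp: openin_open_subtopology)
    qed
    show "open_map (subtopology X U) (top_of_set (\<phi> ` U)) \<phi>"
      unfolding open_map_def
    proof (intro allI impI)
      fix W assume "openin (subtopology X U) W"
      then have "openin X W" "W \<subseteq> U" using U by (auto simp: openin_open_subtopology)
      then show "openin (top_of_set (\<phi> ` U)) (\<phi> ` W)"
        using op oU by (simp add: openin_open_eq image_mono)
    qed
    show "\<phi> ` topspace (subtopology X U) = topspace (top_of_set (\<phi> ` U))" unfolding top by simp
    show "inj_on \<phi> (topspace (subtopology X U))" unfolding top by (rule inj)
  qed
qed

text \<open>Charts have open images, so a small step in any prescribed direction stays inside; this
  produces the pairs of densities used to compare representations.\<close>

lemma chart_line:
  fixes \<theta> :: "'p \<Rightarrow> real^'m::finite"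
  assumes "chart X U \<theta>" "openin X W" "W \<subseteq> U" "p \<in> W"
  obtains \<epsilon> q where "\<epsilon> > 0" "q \<in> W" "\<theta> q = \<theta> p + \<epsilon> *\<^sub>R v"
proof -
  have "open (\<theta> ` W)" using chart_homeomorphic(4)[OF assms(1,3)] assms(2) by simp
  then obtain r where r: "r > 0" "ball (\<theta> p) r \<subseteq> \<theta> ` W"
    using assms(4) openE by blast
  define n where "n = norm v + 1"
  have nz: "n > 0" unfolding n_def by (smt (verit) norm_ge_zero)
  define \<epsilon> where "\<epsilon> = r / (2 * n)"
  have \<epsilon>: "\<epsilon> > 0" using r nz by (simp add: \<epsilon>_def)
  have "\<epsilon> * norm v \<le> \<epsilon> * n" using \<epsilon> by (simp add: n_def)
  also have "\<dots> = r / 2" using nz by (simp add: \<epsilon>_def)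
  also have "\<dots> < r" using r by simp
  finally have "\<theta> p + \<epsilon> *\<^sub>R v \<in> ball (\<theta> p) r" using \<epsilon> by (simp add: dist_norm)
  then obtain q where "q \<in> W" "\<theta> q = \<theta> p + \<epsilon> *\<^sub>R v" using r(2) by (metis imageE subsetD)
  then show thesis using that \<epsilon> by blast
qed

text \<open>An injective endomorphism of a finite-dimensional space has a linear inverse
  \<open>B\<close>, so both transition maps change only by composition with a smooth affine
  map.\<close>

lemma coordinate_system_affine:
  fixes M :: "('p, 'n::finite) manifold" and A :: "real^'n \<Rightarrow> real^'n"
  assumes M: "is_manifold M" and \<theta>: "coordinate_system M U \<theta>" and A: "linear A" "inj A"
    and \<theta>': "\<And>p. p \<in> U \<Longrightarrow> \<theta>' p = A (\<theta> p) - d"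
  shows "coordinate_system M U \<theta>'"
  unfolding coordinate_system_def
proof (intro conjI ballI)
  have cU: "chart (mtop M) U \<theta>"
    and comp: "\<And>V \<phi>. (V, \<phi>) \<in> atlas M \<Longrightarrow> smoothly_compatible (U, \<theta>) (V, \<phi>)"
    using \<theta> by (auto simp: coordinate_system_def)
  note c = chart_homeomorphic[OF cU]
  obtain B where B: "linear B" "\<And>x. B (A x) = x" "\<And>x. A (B x) = x"
    using linear_injective_isomorphism[OF A] by metis
  have bl: "bounded_linear A" "bounded_linear B" using A(1) B(1) by (simp_all add: linear_conv_bounded_linear)
  have cA: "continuous_on S (\<lambda>x. A x - d)" and cB: "continuous_on S (\<lambda>y. B (y + d))" for S
    by (auto intro!: continuous_intros linear_continuous_on_compose[OF _ A(1)]
        linear_continuous_on_compose[OF _ B(1)])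
  have sA: "smooth_on S (\<lambda>x. A x - d)" if "open S" for S
    using that bl by (intro smooth_on_diff smooth_on_bounded_linear smooth_on_const)
  have sB: "smooth_on S (\<lambda>y. B (y + d))" if "open S" for S
    by (rule smooth_on_compose[where T = UNIV])
       (use that bl in \<open>auto intro: smooth_on_add smooth_on_ident smooth_on_const smooth_on_bounded_linear\<close>)
  have inj': "inj_on \<theta>' U"
    using c(1) \<theta>' B(2) unfolding inj_on_def by (metis diff_add_cancel)
  have img: "\<theta>' ` W = {y. B (y + d) \<in> \<theta> ` W}" if "W \<subseteq> U" for W
  proof (intro equalityI subsetI)
    fix y assume "y \<in> \<theta>' ` W"
    then show "y \<in> {y. B (y + d) \<in> \<theta> ` W}" using that by (auto simp: \<theta>' B(2) subset_iff)
  next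
    fix y assume "y \<in> {y. B (y + d) \<in> \<theta> ` W}"
    then obtain p where p: "p \<in> W" "B (y + d) = \<theta> p" by auto
    then have "y = A (\<theta> p) - d" using B(3)[of "y + d"] by (simp add: algebra_simps)
    then show "y \<in> \<theta>' ` W" using p(1) \<theta>' that by (auto simp: subset_iff)
  qed
  have open': "open (\<theta>' ` W)" if "W \<subseteq> U" "openin (mtop M) W" for W
    unfolding img[OF that(1)]
    using open_vimage[OF _ cB[of UNIV], of "\<theta> ` W"] c(4)[OF that(1)] that(2)
    by (simp add: vimage_def)
  show cU': "chart (mtop M) U \<theta>'"
  proof (rule chartI[OF c(2) inj' open'])
    fix S :: "(real^'n) set" assume "open S"
    then have "open ((\<lambda>x. A x - d) -` S)" using cA open_vimage by blast
    from chart_openin_vimage[OF cU this] show "openin (mtop M) {p \<in> U. \<theta>' p \<in> S}"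
      by (rule back_subst[of "openin (mtop M)"]) (auto simp: \<theta>')
  qed
  fix C assume C: "C \<in> atlas M"
  obtain V \<phi> where V: "C = (V, \<phi>)" by force
  have cV: "chart (mtop M) V \<phi>" using atlas_chart[OF M] C V by blast
  note v = chart_homeomorphic[OF cV]
  have oUV: "openin (mtop M) (U \<inter> V)" using c v by auto
  have o1: "open (\<theta>' ` (U \<inter> V))" "open (\<theta> ` (U \<inter> V))" "open (\<phi> ` (U \<inter> V))"
    using open' c(4) v(4) oUV by auto
  have s: "smooth_on (\<theta> ` (U \<inter> V)) (\<phi> \<circ> inv_into U \<theta>)" "smooth_on (\<phi> ` (U \<inter> V)) (\<theta> \<circ> inv_into V \<phi>)"
    using comp C V by (auto simp: smoothly_compatible_def)
  have "(\<lambda>y. B (y + d)) ` \<theta>' ` (U \<inter> V) \<subseteq> \<theta> ` (U \<inter> V)" by (auto simp: \<theta>' B(2))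
  from smooth_on_compose[OF o1(1,2) this sB[OF o1(1)] s(1)]
  have 1: "smooth_on (\<theta>' ` (U \<inter> V)) (\<phi> \<circ> inv_into U \<theta>')"
    by (rule smooth_on_cong[OF o1(1), rotated]) (use inj' c(1) in \<open>auto simp: \<theta>' B(2) inv_into_f_eq\<close>)
  have "smooth_on (\<phi> ` (U \<inter> V)) (\<lambda>x. A ((\<theta> \<circ> inv_into V \<phi>) x) - d)"
    by (rule smooth_on_compose[OF o1(3) open_UNIV _ s(2) sA[OF open_UNIV]]) simp
  then have 2: "smooth_on (\<phi> ` (U \<inter> V)) (\<theta>' \<circ> inv_into V \<phi>)"
    by (rule smooth_on_cong[OF o1(3), rotated]) (use v(1) in \<open>auto simp: \<theta>'\<close>)
  show "smoothly_compatible (U, \<theta>') C" using 1 2 by (simp add: smoothly_compatible_def V)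
qed

text \<open>Openness, continuity and smoothness are local. Global injectivity is the remaining
  ingredient: it makes the inverse over the whole carrier coincide with the inverse over each local
  domain.\<close>

lemma coordinate_system_glue:
  fixes M :: "('p, 'n::finite) manifold"
  assumes M: "is_manifold M" and inj: "inj_on \<theta> (carrier_of M)"
    and loc: "\<And>p. p \<in> carrier_of M \<Longrightarrow> \<exists>U. p \<in> U \<and> coordinate_system M U \<theta>"
  shows "coordinate_system M (carrier_of M) \<theta>"
  unfolding coordinate_system_def
proof (intro conjI ballI)
  let ?X = "mtop M"
  have loc': "\<exists>U. p \<in> U \<and> chart ?X U \<theta> \<and> (\<forall>C\<in>atlas M. smoothly_compatible (U, \<theta>) C)"
    if "p \<in> carrier_of M" for p
    using loc[OF that] by (simp add: coordinate_system_def)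
  have open': "open (\<theta> ` W)" if "openin ?X W" for W
  proof (subst open_subopen, intro ballI)
    fix y assume "y \<in> \<theta> ` W"
    then obtain p where p: "p \<in> W" "y = \<theta> p" by auto
    then have "p \<in> carrier_of M" using openin_subset[OF that] by (auto simp: carrier_of_def)
    then obtain U where U: "p \<in> U" "chart ?X U \<theta>" using loc' by blast
    have "open (\<theta> ` (U \<inter> W))"
      using chart_homeomorphic[OF U(2)] that by (auto intro: openin_Int)
    then show "\<exists>T. open T \<and> y \<in> T \<and> T \<subseteq> \<theta> ` W" using p U(1) by blast
  qed
  show "chart ?X (carrier_of M) \<theta>"
  proof (rule chartI[OF _ inj open'])
    show "openin ?X (carrier_of M)" by (simp add: carrier_of_def)
    fix S :: "(real^'n) set" assume S: "open S"
    show "openin ?X {p \<in> carrier_of M. \<theta> p \<in> S}"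
    proof (subst openin_subopen, intro ballI)
      fix p assume p: "p \<in> {p \<in> carrier_of M. \<theta> p \<in> S}"
      then obtain U where U: "p \<in> U" "chart ?X U \<theta>" using loc' by blast
      then show "\<exists>T. openin ?X T \<and> p \<in> T \<and> T \<subseteq> {p \<in> carrier_of M. \<theta> p \<in> S}"
        using chart_openin_vimage[OF U(2) S] chart_homeomorphic(3)[OF U(2)] p
        by (intro exI[of _ "{p \<in> U. \<theta> p \<in> S}"]) (auto simp: carrier_of_def)
    qed
  qed
  fix C assume C: "C \<in> atlas M"
  obtain V \<phi> where V: "C = (V, \<phi>)" by force
  have cV: "chart ?X V \<phi>" using atlas_chart[OF M] C V by blast
  note v = chart_homeomorphic[OF cV]
  have VM: "V \<subseteq> carrier_of M" using v(3) by (simp add: carrier_of_def)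
  have "smooth_on (\<theta> ` V) (\<phi> \<circ> inv_into (carrier_of M) \<theta>)"
  proof (rule smooth_on_local)
    fix y assume "y \<in> \<theta> ` V"
    then obtain p where p: "p \<in> V" "y = \<theta> p" by auto
    then obtain U where U: "p \<in> U" "chart ?X U \<theta>" "smoothly_compatible (U, \<theta>) (V, \<phi>)"
      using loc' VM C V by blast
    note u = chart_homeomorphic[OF U(2)]
    have o: "open (\<theta> ` (U \<inter> V))" using u(2) v(2) by (intro open') auto
    have UM: "U \<subseteq> carrier_of M" using u(3) by (simp add: carrier_of_def)
    have "smooth_on (\<theta> ` (U \<inter> V)) (\<phi> \<circ> inv_into U \<theta>)" using U(3) by (simp add: smoothly_compatible_def)
    then have "smooth_on (\<theta> ` (U \<inter> V)) (\<phi> \<circ> inv_into (carrier_of M) \<theta>)"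
      by (rule smooth_on_cong[OF o, rotated])
         (use UM inj u(1) in \<open>auto simp: inv_into_f_eq subset_iff\<close>)
    then show "\<exists>T. open T \<and> y \<in> T \<and> smooth_on T (\<phi> \<circ> inv_into (carrier_of M) \<theta>)"
      using o p U(1) by (intro exI[of _ "\<theta> ` (U \<inter> V)"]) auto
  qed
  moreover have "smooth_on (\<phi> ` V) (\<theta> \<circ> inv_into V \<phi>)"
  proof (rule smooth_on_local)
    fix y assume "y \<in> \<phi> ` V"
    then obtain p where p: "p \<in> V" "y = \<phi> p" by auto
    then obtain U where U: "p \<in> U" "chart ?X U \<theta>" "smoothly_compatible (U, \<theta>) (V, \<phi>)"
      using loc' VM C V by blast
    note u = chart_homeomorphic[OF U(2)]
    have "open (\<phi> ` (U \<inter> V))" using u(2) v(2) v(4)[of "U \<inter> V"] by auto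
    then show "\<exists>T. open T \<and> y \<in> T \<and> smooth_on T (\<theta> \<circ> inv_into V \<phi>)"
      using U(1,3) p by (intro exI[of _ "\<phi> ` (U \<inter> V)"]) (auto simp: smoothly_compatible_def)
  qed
  moreover have "carrier_of M \<inter> V = V" using VM by auto
  ultimately show "smoothly_compatible (carrier_of M, \<theta>) C" by (simp add: smoothly_compatible_def V)
qed

lemma smooth_fun_glue:
  fixes M :: "('p, 'n::finite) manifold"
  assumes M: "is_manifold M" and loc: "\<And>p. p \<in> carrier_of M \<Longrightarrow> \<exists>U. p \<in> U \<and> smooth_fun M U f"
  shows "smooth_fun M (carrier_of M) f"
  unfolding smooth_fun_def
proof (intro conjI ballI, safe)
  show "openin (mtop M) (carrier_of M)" by (simp add: carrier_of_def)
  fix V \<phi> assume V: "(V, \<phi>) \<in> atlas M"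
  note v = chart_homeomorphic[OF atlas_chart(1)[OF M V]]
  show "smooth_on (\<phi> ` (carrier_of M \<inter> V)) (f \<circ> inv_into V \<phi>)"
  proof (rule smooth_on_local)
    fix y assume "y \<in> \<phi> ` (carrier_of M \<inter> V)"
    then obtain p where p: "p \<in> carrier_of M" "p \<in> V" "y = \<phi> p" by auto
    then obtain U where U: "p \<in> U" "smooth_fun M U f" using loc by blast
    then have "smooth_on (\<phi> ` (U \<inter> V)) (f \<circ> inv_into V \<phi>)" "openin (mtop M) (U \<inter> V)"
      using V v(2) by (auto simp: smooth_fun_def)
    then show "\<exists>T. open T \<and> y \<in> T \<and> smooth_on T (f \<circ> inv_into V \<phi>)"
      using p U v(4)[of "U \<inter> V"] by (intro exI[of _ "\<phi> ` (U \<inter> V)"]) auto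
  qed
qed

section \<open>Exponential families have a global representation\<close>

locale admissible_triple =
  fixes h \<tau> :: "real \<Rightarrow> real" and I :: "real set"
  assumes admissible: "(h, \<tau>, I) \<in> admissible_triples"
begin

abbreviation \<l> :: "real \<Rightarrow> real" where "\<l> \<equiv> ell h \<tau>"

abbreviation J :: "real set" where "J \<equiv> \<l> ` I"

abbreviation E :: "real \<Rightarrow> real" where "E \<equiv> inv_into I \<l>"

definition \<kappa> :: "real \<Rightarrow> real" where "\<kappa> z = \<tau> (E z)"

lemma I: "open I" "is_interval I" "I \<subseteq> {0<..}" "smooth_on I \<tau>" "\<And>t. t \<in> I \<Longrightarrow> deriv \<tau> t > 0"
  "smooth_on (\<tau> ` I) h" "\<And>y. y \<in> \<tau> ` I \<Longrightarrow> deriv (deriv h) y > 0"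
  using admissible by (auto simp: admissible_triples_def)

lemma strict_mono_on_interval:
  fixes f :: "real \<Rightarrow> real"
  assumes "\<And>t. t \<in> I \<Longrightarrow> (f has_field_derivative f' t) (at t)" "\<And>t. t \<in> I \<Longrightarrow> f' t > 0"
  shows "strict_mono_on I f"
proof (rule strict_mono_onI)
  fix a b assume ab: "a \<in> I" "b \<in> I" "a < b"
  show "f a < f b"
  proof (rule DERIV_pos_imp_increasing[OF ab(3)])
    fix x assume "a \<le> x" "x \<le> b"
    then have "x \<in> I" using mem_is_interval_1_I[OF I(2) ab(1,2)] by simp
    then show "\<exists>y. (f has_real_derivative y) (at x) \<and> 0 < y" using assms by blast
  qed
qed

lemma \<tau>_derivative: "t \<in> I \<Longrightarrow> (\<tau> has_field_derivative deriv \<tau> t) (at t)"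
  by (rule smooth_on_real_deriv(2)[OF I(1,4)])

lemma open_\<tau>: "open (\<tau> ` I)"
proof (rule smooth_on_real_inverse_function(1)[OF I(1) _ I(4)])
  show "inj_on \<tau> I"
    by (rule strict_mono_on_imp_inj_on[OF strict_mono_on_interval[OF \<tau>_derivative I(5)]])
  show "deriv \<tau> t \<noteq> 0" if "t \<in> I" for t using I(5)[OF that] by simp
qed

lemma h_derivative: "y \<in> \<tau> ` I \<Longrightarrow> (h has_field_derivative deriv h y) (at y)"
  by (rule smooth_on_real_deriv(2)[OF open_\<tau> I(6)])

lemma \<l>_derivative: "t \<in> I \<Longrightarrow> (\<l> has_field_derivative deriv (deriv h) (\<tau> t) * deriv \<tau> t) (at t)"
  unfolding ell_def o_def
  by (rule DERIV_chain2[OF smooth_on_real_deriv(2)[OF open_\<tau> smooth_on_real_deriv(1)[OF open_\<tau> I(6)]] \<tau>_derivative])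
     auto

lemma \<l>_deriv_pos: "t \<in> I \<Longrightarrow> deriv \<l> t > 0"
  using DERIV_imp_deriv[OF \<l>_derivative] I(5,7) by simp

lemma \<l>_strict_mono: "strict_mono_on I \<l>"
  by (rule strict_mono_on_interval[OF \<l>_derivative]) (use I(5,7) in auto)

lemma \<l>_inj: "inj_on \<l> I"
  by (rule strict_mono_on_imp_inj_on[OF \<l>_strict_mono])

lemma \<l>_smooth: "smooth_on I \<l>"
  unfolding ell_def o_def
  by (rule smooth_on_compose[OF I(1) open_\<tau> order_refl I(4) smooth_on_real_deriv(1)[OF open_\<tau> I(6)]])

lemma J: "open J" "smooth_on J E"
  using smooth_on_real_inverse_function[OF I(1) \<l>_inj \<l>_smooth] \<l>_deriv_pos by (auto simp: less_imp_neq[symmetric])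

lemma E: "z \<in> J \<Longrightarrow> E z \<in> I" "z \<in> J \<Longrightarrow> \<l> (E z) = z" "t \<in> I \<Longrightarrow> E (\<l> t) = t"
  using \<l>_inj by (auto simp: inv_into_into f_inv_into_f)

lemma E_deriv_pos: assumes "z \<in> J" shows "deriv E z > 0"
proof -
  have "(E has_field_derivative inverse (deriv (deriv h) (\<tau> (E z)) * deriv \<tau> (E z))) (at z)"
    by (rule real_inverse_function_has_derivative[OF I(1) \<l>_inj \<l>_derivative _ assms])
       (use I(5,7) in \<open>force+\<close>)
  then show ?thesis using DERIV_imp_deriv I(5,7) E(1)[OF assms] by fastforce
qed

lemma \<kappa>_smooth: "smooth_on J \<kappa>"
proof -
  have "E ` J \<subseteq> I" using E(1) by blast
  from smooth_on_compose[OF J(1) I(1) this J(2) I(4)] show ?thesis by (simp add: \<kappa>_def[abs_def])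
qed

lemma \<kappa>_range: "z \<in> J \<Longrightarrow> \<kappa> z \<in> \<tau> ` I"
  using E(1) by (auto simp: \<kappa>_def)

lemma \<kappa>_deriv_pos: assumes "z \<in> J" shows "deriv \<kappa> z > 0"
proof -
  have "(\<kappa> has_field_derivative deriv \<tau> (E z) * deriv E z) (at z)"
    unfolding \<kappa>_def[abs_def]
    by (rule DERIV_chain2[OF \<tau>_derivative[OF E(1)[OF assms]] smooth_on_real_deriv(2)[OF J assms]])
  then show ?thesis using DERIV_imp_deriv I(5)[OF E(1)[OF assms]] E_deriv_pos[OF assms] by fastforce
qed

lemma deriv_h_\<kappa>: "z \<in> J \<Longrightarrow> deriv h (\<kappa> z) = z"
  using E(2) by (simp add: \<kappa>_def ell_def)

lemma \<kappa>_\<l>: "t \<in> I \<Longrightarrow> \<kappa> (\<l> t) = \<tau> t"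
  by (simp add: \<kappa>_def E(3))

lemma h_\<kappa>_smooth: "smooth_on J (\<lambda>z. h (\<kappa> z))"
  using \<kappa>_range by (intro smooth_on_compose[OF J(1) open_\<tau> _ \<kappa>_smooth I(6)]) auto

lemma \<kappa>_derivative: "z \<in> J \<Longrightarrow> (\<kappa> has_field_derivative deriv \<kappa> z) (at z)"
  by (rule smooth_on_real_deriv(2)[OF J(1) \<kappa>_smooth])

text \<open>Because \<open>deriv h (\<kappa> z) = z\<close>, the outer derivative is simply
  \<open>z\<close>; the cancellations in the derivatives of the divergence rest on this.\<close>

lemma h_\<kappa>_derivative:
  assumes "z \<in> J" shows "((\<lambda>z. h (\<kappa> z)) has_field_derivative z * deriv \<kappa> z) (at z)"
  using DERIV_chain2[OF h_derivative[OF \<kappa>_range[OF assms]] \<kappa>_derivative[OF assms]] deriv_h_\<kappa>[OF assms]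
  by simp

text \<open>Legendre duality: up to sign, \<^term>\<open>\<lambda>z. - \<kappa> z * z + h (\<kappa> z)\<close> is the convex conjugate of \<open>h\<close>,
  so its derivative is the inverse of the derivative of \<open>h\<close>.\<close>

lemma conjugate_derivative:
  assumes "z \<in> J"
  shows "((\<lambda>z. - \<kappa> z * z + h (\<kappa> z)) has_field_derivative - \<kappa> z) (at z)"
  by (auto intro!: derivative_eq_intros \<kappa>_derivative h_\<kappa>_derivative assms)

lemma entropy_integrand_\<l>: "t \<in> I \<Longrightarrow> entropy_integrand h \<tau> t = - \<kappa> (\<l> t) * \<l> t + h (\<kappa> (\<l> t))"
  by (simp add: \<kappa>_\<l> entropy_integrand_def) (simp add: ell_def)

text \<open>Elements of \<open>I\<close> are positive and finite, which excludes the default values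
  0 and \<infinity>; what remains is injectivity of \<open>\<l>\<close>.\<close>

lemma gen_exp_iff: "t \<in> I \<Longrightarrow> ereal t = gen_exp h \<tau> I u \<longleftrightarrow> \<l> t = u"
  using I(3) E by (auto simp: gen_exp_def dest: inj_onD[OF \<l>_inj])

end

section \<open>Uniqueness and globalization of exponential representations\<close>

locale compact_exponential_family = admissible_triple h \<tau> I
  for h \<tau> :: "real \<Rightarrow> real" and I :: "real set" +
  fixes \<mu> :: "'x::topological_space measure" and M :: "('x \<Rightarrow> real, 'n::finite) manifold"
  assumes radon: "radon_measure \<mu>" and support: "measure_support \<mu> = UNIV"
    and family: "exponential_family \<mu> h \<tau> I M" and cpt: "compact (UNIV :: 'x set)"
begin

lemma sets_\<mu>: "sets \<mu> = sets borel" and space_\<mu>: "space \<mu> = UNIV"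
proof -
  show "sets \<mu> = sets borel" using radon by (simp add: radon_measure_def)
  then show "space \<mu> = UNIV" using sets_eq_imp_space_eq by fastforce
qed

text \<open>Finitely many of the open sets of finite measure given by local finiteness cover the
  compact space.\<close>

lemma finite_\<mu>: "finite_measure \<mu>"
proof
  have "\<forall>x. \<exists>U. open U \<and> x \<in> U \<and> emeasure \<mu> U < \<infinity>" using radon by (simp add: radon_measure_def)
  then obtain U where U: "\<And>x. open (U x)" "\<And>x. x \<in> U x" "\<And>x. emeasure \<mu> (U x) < \<infinity>" by metis
  obtain D where D: "D \<subseteq> UNIV" "finite D" "UNIV \<subseteq> (\<Union>x\<in>D. U x)"
    by (rule compactE_image[OF cpt, of UNIV U]) (use U in blast)+
  have "emeasure \<mu> (\<Union>x\<in>D. U x) \<le> (\<Sum>x\<in>D. emeasure \<mu> (U x))"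
    using U(1) D(2) sets_\<mu> by (intro emeasure_subadditive_finite) auto
  also have "\<dots> < \<infinity>" using U(3) D(2) by simp
  also have "(\<Union>x\<in>D. U x) = UNIV" using D(3) by auto
  finally have "emeasure \<mu> UNIV < \<infinity>" .
  then show "emeasure \<mu> (space \<mu>) \<noteq> \<infinity>" by (simp add: space_\<mu>)
qed

lemma is_manifold: "is_manifold M"
  using family by (simp add: exponential_family_def manifold_in_densities_def)

abbreviation rep where "rep \<equiv> exp_representation h \<tau> I M"

lemma repD:
  assumes "rep U \<theta> T c \<psi>"
  shows "coordinate_system M U \<theta>" "continuous_on UNIV T" "continuous_on UNIV c" "smooth_fun M U \<psi>"
    and "\<And>p x. p \<in> U \<Longrightarrow> p x \<in> I" "\<And>p x. p \<in> U \<Longrightarrow> \<l> (p x) = \<theta> p \<bullet> T x - c x - \<psi> p"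
    and "chart (mtop M) U \<theta>" "openin (mtop M) U" "U \<subseteq> carrier_of M"
proof -
  show c: "coordinate_system M U \<theta>" "continuous_on UNIV T" "continuous_on UNIV c" "smooth_fun M U \<psi>"
    "\<And>p x. p \<in> U \<Longrightarrow> p x \<in> I"
    using assms by (auto simp: exp_representation_def)
  show "\<l> (p x) = \<theta> p \<bullet> T x - c x - \<psi> p" if "p \<in> U" for p x
    using assms that by (subst gen_exp_iff[symmetric]) (auto simp: exp_representation_def)
  show "chart (mtop M) U \<theta>" using c(1) by (simp add: coordinate_system_def)
  from chart_homeomorphic(2,3)[OF this] show "openin (mtop M) U" "U \<subseteq> carrier_of M"
    by (simp_all add: carrier_of_def)
qed

lemma local_rep:
  assumes "p \<in> carrier_of M" obtains U \<theta> T c \<psi> where "p \<in> U" "rep U \<theta> T c \<psi>"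
  using family assms by (auto simp: exponential_family_def)

lemma in_I: "p \<in> carrier_of M \<Longrightarrow> p x \<in> I"
  by (metis local_rep repD(5))

lemma density: assumes "p \<in> carrier_of M" shows "integrable \<mu> p" "(\<integral>x. p x \<partial>\<mu>) = 1"
proof -
  have "p \<in> prob_densities \<mu> I" using family assms by (auto simp: exponential_family_def manifold_in_densities_def)
  then have p: "integrable \<mu> p" "(\<integral>x. \<bar>p x\<bar> \<partial>\<mu>) = 1" by (simp_all add: prob_densities_def)
  moreover have "\<bar>p x\<bar> = p x" for x using in_I[OF assms, of x] I(3) by auto
  ultimately show "integrable \<mu> p" "(\<integral>x. p x \<partial>\<mu>) = 1" by simp_all
qed

text \<open>Two densities of the family whose \<open>\<l>\<close>-images differ by a constant are pointwise comparable;
  having the same total mass, they coincide.\<close>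

lemma densities_not_shifted:
  assumes "p \<in> carrier_of M" "q \<in> carrier_of M" "\<And>x. \<l> (q x) - \<l> (p x) = k" "k > 0"
  shows False
proof -
  have less: "p x < q x" for x
    using strict_mono_on_less[OF \<l>_strict_mono in_I[OF assms(1)] in_I[OF assms(2)], of x x] assms(3)[of x] assms(4)
    by simp
  have "(\<integral>x. q x - p x \<partial>\<mu>) = 0" using density assms(1,2) by simp
  then have "AE x in \<mu>. q x - p x = 0"
    using integral_nonneg_eq_0_iff_AE[of \<mu> "\<lambda>x. q x - p x"] density assms(1,2) less
    by (simp add: less_imp_le)
  then have "AE x in \<mu>. p x = 0"
  proof (rule eventually_mono)
    fix x assume "q x - p x = 0"
    then show "p x = 0" using less[of x] by simp
  qed
  then have "(\<integral>x. p x \<partial>\<mu>) = 0" by (rule integral_eq_zero_AE)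
  then show False using density(2)[OF assms(1)] by simp
qed

lemma density_eqI:
  assumes "p \<in> carrier_of M" "q \<in> carrier_of M" "\<And>x. \<l> (q x) - \<l> (p x) = k"
  shows "p = q"
proof -
  have "\<l> (p x) - \<l> (q x) = - k" for x using assms(3)[of x] by simp
  then have "\<not> k > 0" "\<not> - k > 0"
    using densities_not_shifted[OF assms] densities_not_shifted[OF assms(2,1), of "- k"] by blast+
  then have "k = 0" by simp
  then have "p x = q x" for x
    using assms(3)[of x] inj_onD[OF \<l>_inj _ in_I[OF assms(1)] in_I[OF assms(2)], of x x] by simp
  then show ?thesis by auto
qed

text \<open>A step in direction \<open>v\<close> within the chart would shift the
  \<open>\<l>\<close>-image by a constant, so by \<open>density_eqI\<close> it does not move the
  density at all; but the chart coordinates of the two points differ by a positive multiple of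
  \<open>v\<close>.\<close>

lemma rep_independent:
  assumes r: "rep U \<theta> T c \<psi>" "U \<noteq> {}" and v: "\<And>x. v \<bullet> T x = k"
  shows "v = 0"
proof -
  obtain p where p: "p \<in> U" using r(2) by auto
  obtain \<epsilon> q where q: "\<epsilon> > 0" "q \<in> U" "\<theta> q = \<theta> p + \<epsilon> *\<^sub>R v"
    by (rule chart_line[OF repD(7,8)[OF r(1)] order_refl p])
  have "\<l> (q x) - \<l> (p x) = \<epsilon> * k - \<psi> q + \<psi> p" for x
    using repD(6)[OF r(1) p, of x] repD(6)[OF r(1) q(2), of x] v[of x] q(3) by (simp add: inner_add_left)
  then have "p = q" using p q(2) repD(9)[OF r(1)] by (intro density_eqI) auto
  then show ?thesis using q(1,3) by simp
qed

text \<open>Says that the \<open>\<l>\<close>-image of \<open>p\<close> lies in the affine space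
  through \<open>- c0\<close> spanned by the constants and the components of \<open>T0\<close>. No
  regularity of \<open>u\<close> and \<open>s\<close> in \<open>p\<close> is asked, so that
  connectedness can be exploited before smoothness.\<close>

definition good :: "('x \<Rightarrow> real^'n) \<Rightarrow> ('x \<Rightarrow> real) \<Rightarrow> ('x \<Rightarrow> real) \<Rightarrow> bool" where
  "good T0 c0 p \<longleftrightarrow> (\<exists>u s. \<forall>x. \<l> (p x) = u \<bullet> T0 x - c0 x - s)"

text \<open>The image under \<open>\<theta>\<close> of a nonempty open set of good densities contains a segment in every
  direction, so differences of good densities determine \<open>T\<close> modulo constants; one density then
  determines \<open>c\<close>.\<close>

lemma good_change:
  assumes r: "rep U \<theta> T c \<psi>" and W: "openin (mtop M) W" "W \<subseteq> U" "p \<in> W"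
    and g: "\<And>q. q \<in> W \<Longrightarrow> good T0 c0 q"
  obtains A \<beta> d e where "linear A" "linear \<beta>" "\<And>v x. v \<bullet> T x = A v \<bullet> T0 x + \<beta> v"
    "\<And>q x. q \<in> U \<Longrightarrow> \<l> (q x) = (A (\<theta> q) - d) \<bullet> T0 x - c0 x - (\<psi> q + e - \<beta> (\<theta> q))"
proof -
  obtain u s where p: "\<And>x. \<l> (p x) = u \<bullet> T0 x - c0 x - s" using g[OF W(3)] by (auto simp: good_def)
  have pU: "p \<in> U" using W by auto
  have "\<exists>w k. \<forall>x. v \<bullet> T x = w \<bullet> T0 x + k" for v
  proof -
    obtain \<epsilon> q where q: "\<epsilon> > 0" "q \<in> W" "\<theta> q = \<theta> p + \<epsilon> *\<^sub>R v"
      by (rule chart_line[OF repD(7)[OF r] W])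
    obtain u' s' where q': "\<And>x. \<l> (q x) = u' \<bullet> T0 x - c0 x - s'" using g[OF q(2)] by (auto simp: good_def)
    have "\<epsilon> * (v \<bullet> T x) = (u' - u) \<bullet> T0 x + (s - s' + \<psi> q - \<psi> p)" for x
      using repD(6)[OF r pU, of x] repD(6)[OF r, of q x] q(2) W(2) q(3) p[of x] q'[of x]
      by (simp add: inner_add_left inner_diff_left subset_iff)
    then have "v \<bullet> T x = ((1 / \<epsilon>) *\<^sub>R (u' - u)) \<bullet> T0 x + (s - s' + \<psi> q - \<psi> p) / \<epsilon>" for x
      using q(1) by (simp only: inner_scaleR_left) (simp add: field_simps)
    then show ?thesis by blast
  qed
  then obtain w k where wk: "\<And>v x. v \<bullet> T x = w v \<bullet> T0 x + k v" by metis
  \<comment> \<open>The choices \<open>w v\<close> and \<open>k v\<close> were made separately for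
    each direction and need not be linear; only their values on the axis vectors are kept and
    extended linearly.\<close>
  define A where "A v = (\<Sum>i\<in>UNIV. v $ i *\<^sub>R w (axis i 1))" for v
  define \<beta> where "\<beta> v = (\<Sum>i\<in>UNIV. v $ i * k (axis i 1))" for v
  have A: "linear A" "linear \<beta>"
    unfolding A_def[abs_def] \<beta>_def[abs_def]
    by (auto intro!: linearI simp: algebra_simps sum.distrib scaleR_sum_right sum_distrib_left)
  have T: "v \<bullet> T x = A v \<bullet> T0 x + \<beta> v" for v x
  proof -
    have "v \<bullet> T x = (\<Sum>i\<in>UNIV. v $ i *\<^sub>R axis i 1) \<bullet> T x"
      using basis_expansion[of v] by (simp add: scalar_mult_eq_scaleR)
    also have "\<dots> = (\<Sum>i\<in>UNIV. v $ i * (axis i 1 \<bullet> T x))"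
      by (simp only: inner_sum_left inner_scaleR_left)
    also have "\<dots> = (\<Sum>i\<in>UNIV. v $ i * (w (axis i 1) \<bullet> T0 x + k (axis i 1)))"
      by (simp only: wk)
    also have "\<dots> = A v \<bullet> T0 x + \<beta> v"
      by (simp add: A_def \<beta>_def inner_sum_left sum.distrib distrib_left)
    finally show ?thesis .
  qed
  have c: "c x = c0 x + (A (\<theta> p) - u) \<bullet> T0 x + (\<beta> (\<theta> p) - \<psi> p + s)" for x
    using repD(6)[OF r pU, of x] p[of x] T[of "\<theta> p" x] by (simp add: inner_diff_left)
  have "\<l> (q x) = (A (\<theta> q) - (A (\<theta> p) - u)) \<bullet> T0 x - c0 x - (\<psi> q + (\<beta> (\<theta> p) - \<psi> p + s) - \<beta> (\<theta> q))"
    if "q \<in> U" for q x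
    using repD(6)[OF r that, of x] T[of "\<theta> q" x] c[of x] by (simp add: inner_diff_left)
  then show thesis using that A T by blast
qed

text \<open>The largest open set of good densities is also closed, since it contains every chart it meets.\<close>

lemma all_good:
  assumes r0: "rep U0 \<theta>0 T0 c0 \<psi>0" "U0 \<noteq> {}" and p: "p \<in> carrier_of M"
  shows "good T0 c0 p"
proof -
  have conn: "connected_space (mtop M)" using is_manifold by (simp add: is_manifold_def)
  define G where "G = \<Union>{W. openin (mtop M) W \<and> (\<forall>q\<in>W. good T0 c0 q)}"
  define B where "B = \<Union>{W. openin (mtop M) W \<and> W \<inter> G = {}}"
  have op: "openin (mtop M) G" "openin (mtop M) B" unfolding G_def B_def by auto
  have "U0 \<subseteq> G" using repD(6,8)[OF r0(1)] unfolding G_def good_def by blast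
  then have "G \<noteq> {}" using r0(2) by auto
  moreover have "G \<inter> B = {}" unfolding B_def by auto
  moreover have "topspace (mtop M) \<subseteq> G \<union> B"
  proof
    fix q assume "q \<in> topspace (mtop M)"
    then obtain U \<theta> T c \<psi> where U: "q \<in> U" "rep U \<theta> T c \<psi>" by (metis local_rep carrier_of_def)
    have oU: "openin (mtop M) U" by (rule repD(8)[OF U(2)])
    show "q \<in> G \<union> B"
    proof (cases "U \<inter> G = {}")
      case True
      then show ?thesis using oU U(1) by (auto simp: B_def)
    next
      case False
      then obtain p where p: "p \<in> U \<inter> G" by auto
      have gd: "good T0 c0 q" if "q \<in> U \<inter> G" for q using that by (auto simp: G_def)
      obtain A \<beta> d e where
        "linear A" "linear \<beta>" "\<And>v x. v \<bullet> T x = A v \<bullet> T0 x + \<beta> v"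
        and A: "\<And>q x. q \<in> U \<Longrightarrow> \<l> (q x) = (A (\<theta> q) - d) \<bullet> T0 x - c0 x - (\<psi> q + e - \<beta> (\<theta> q))"
        by (rule good_change[OF U(2) openin_Int[OF oU op(1)] Int_lower1 p gd], assumption) (rule that; assumption)
      have "\<forall>q\<in>U. good T0 c0 q" unfolding good_def using A by blast
      then show ?thesis using oU U(1) by (auto simp: G_def)
    qed
  qed
  ultimately have "B = {}" using conn op unfolding connected_space_def by blast
  then have "p \<in> G" using \<open>topspace (mtop M) \<subseteq> G \<union> B\<close> p by (auto simp: carrier_of_def)
  then show ?thesis by (auto simp: G_def)
qed

text \<open>The parameters are picked point by point. \<open>rep_independent\<close> makes them
  unique, so on each local domain they must equal the expressions in local coordinates from
  \<open>good_change\<close>; this yields both smoothness and compatibility with the atlas.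
  Injectivity comes from \<open>density_eqI\<close>.\<close>

theorem global_representation:
  "\<exists>\<theta> T c \<psi>. rep (carrier_of M) \<theta> T c \<psi>"
proof (cases "carrier_of M = {}")
  \<comment> \<open>Without a point there is no local representation to start from, but the empty
    chart serves.\<close>
  case True
  have "chart (mtop M) {} (\<lambda>_. 0 :: real^'n)"
    by (rule chartI) auto
  then have "rep {} (\<lambda>_. 0) (\<lambda>_. 0) (\<lambda>_. 0) (\<lambda>_. 0)"
    by (auto simp: exp_representation_def coordinate_system_def smoothly_compatible_def smooth_fun_def
        smooth_on_empty)
  then show ?thesis using True by metis
next
  case False
  then obtain p0 where p0: "p0 \<in> carrier_of M" by auto
  obtain U0 \<theta>0 T0 c0 \<psi>0 where r0: "p0 \<in> U0" "rep U0 \<theta>0 T0 c0 \<psi>0" by (rule local_rep[OF p0])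
  then have ne: "U0 \<noteq> {}" by auto
  have "\<forall>p\<in>carrier_of M. \<exists>u s. \<forall>x. \<l> (p x) = u \<bullet> T0 x - c0 x - s"
    using all_good[OF r0(2) ne] by (simp add: good_def)
  then obtain \<theta> \<psi> where \<theta>: "\<And>p x. p \<in> carrier_of M \<Longrightarrow> \<l> (p x) = \<theta> p \<bullet> T0 x - c0 x - \<psi> p" by metis
  have unique: "u = \<theta> p" "s = \<psi> p"
    if p: "p \<in> carrier_of M" and us: "\<And>x. \<l> (p x) = u \<bullet> T0 x - c0 x - s" for p u s
  proof -
    have "(u - \<theta> p) \<bullet> T0 x = s - \<psi> p" for x
      using \<theta>[OF p, of x] us[of x] by (simp add: inner_diff_left)
    then have "u - \<theta> p = 0" by (rule rep_independent[OF r0(2) ne])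
    then show "u = \<theta> p" by simp
    then show "s = \<psi> p" using \<theta>[OF p] us by simp
  qed
  have inj: "inj_on \<theta> (carrier_of M)"
  proof (rule inj_onI)
    fix p q assume pq: "p \<in> carrier_of M" "q \<in> carrier_of M" "\<theta> p = \<theta> q"
    show "p = q" by (rule density_eqI[OF pq(1,2)]) (simp add: \<theta> pq)
  qed
  have loc: "\<exists>U. p \<in> U \<and> coordinate_system M U \<theta> \<and> smooth_fun M U \<psi>" if p: "p \<in> carrier_of M" for p
  proof -
    obtain U \<theta>' T c \<psi>' where U: "p \<in> U" "rep U \<theta>' T c \<psi>'" by (rule local_rep[OF p])
    note r = repD[OF U(2)]
    have gd: "good T0 c0 q" if "q \<in> U" for q using all_good[OF r0(2) ne] r(9) that by blast
    obtain A \<beta> d e where A: "linear A" "linear \<beta>" "\<And>v x. v \<bullet> T x = A v \<bullet> T0 x + \<beta> v"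
      "\<And>q x. q \<in> U \<Longrightarrow> \<l> (q x) = (A (\<theta>' q) - d) \<bullet> T0 x - c0 x - (\<psi>' q + e - \<beta> (\<theta>' q))"
      by (rule good_change[OF U(2) r(8) order_refl U(1) gd], assumption) (rule that; assumption)
    \<comment> \<open>If \<open>A v = 0\<close>, then \<open>v \<bullet> T x\<close> is the constant
      \<open>\<beta> v\<close>, which independence forbids for nonzero \<open>v\<close>.\<close>
    have "v = 0" if "A v = 0" for v
    proof (rule rep_independent[OF U(2)])
      show "v \<bullet> T x = \<beta> v" for x using A(3)[of v x] that by simp
    qed (use U(1) in auto)
    then have injA: "inj A" using linear_injective_0[OF A(1)] by blast
    have eq: "\<theta> q = A (\<theta>' q) - d" "\<psi> q = \<psi>' q + e - \<beta> (\<theta>' q)" if "q \<in> U" for q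
      using unique[OF _ A(4)[OF that]] r(9) that by auto
    have "smooth_on (\<theta>' ` U) (\<psi> \<circ> inv_into U \<theta>')"
    proof (rule smooth_on_cong)
      have inj': "inj_on \<theta>' U" and oU: "open (\<theta>' ` U)"
        using chart_homeomorphic(1)[OF r(7)] chart_homeomorphic(4)[OF r(7), of U] r(8) by auto
      show "open (\<theta>' ` U)" by (rule oU)
      show "\<psi>' (inv_into U \<theta>' u) + e - \<beta> u = (\<psi> \<circ> inv_into U \<theta>') u" if "u \<in> \<theta>' ` U" for u
        using that inj' eq(2) by auto
      have "smooth_on (\<theta>' ` U) (\<lambda>u. \<psi>' (inv_into U \<theta>' u))"
        using smooth_fun_coordinates_iff[OF is_manifold r(1) order_refl, of \<psi>'] r(4) by (simp add: o_def)
      moreover have "bounded_linear \<beta>" using A(2) by (simp add: linear_conv_bounded_linear)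
      ultimately show "smooth_on (\<theta>' ` U) (\<lambda>u. \<psi>' (inv_into U \<theta>' u) + e - \<beta> u)"
        by (intro smooth_on_diff[OF oU smooth_on_add[OF oU _ smooth_on_const] smooth_on_bounded_linear])
    qed
    then have "smooth_fun M U \<psi>"
      using smooth_fun_coordinates_iff[OF is_manifold r(1) order_refl, of \<psi>] r(8) by simp
    moreover have "coordinate_system M U \<theta>"
      by (rule coordinate_system_affine[OF is_manifold r(1) A(1) injA eq(1)])
    ultimately show ?thesis using U(1) by blast
  qed
  have "coordinate_system M (carrier_of M) \<theta>"
    by (rule coordinate_system_glue[OF is_manifold inj]) (use loc in blast)
  moreover have "smooth_fun M (carrier_of M) \<psi>"
    by (rule smooth_fun_glue[OF is_manifold]) (use loc in blast)
  ultimately have "rep (carrier_of M) \<theta> T0 c0 \<psi>"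
    using repD(2,3)[OF r0(2)] in_I gen_exp_iff \<theta> by (simp add: exp_representation_def)
  then show ?thesis by blast
qed

end

section \<open>The divergence geometry of an exponential family\<close>

locale global_exponential_family =
  compact_exponential_family h \<tau> I \<mu> M + global_chart M \<theta>
  for h \<tau> :: "real \<Rightarrow> real" and I :: "real set" and \<mu> :: "'x::topological_space measure"
    and M :: "('x \<Rightarrow> real, 'n::finite) manifold" and \<theta> :: "('x \<Rightarrow> real) \<Rightarrow> real^'n" +
  fixes T :: "'x \<Rightarrow> real^'n" and c :: "'x \<Rightarrow> real" and \<psi> :: "('x \<Rightarrow> real) \<Rightarrow> real"
  assumes rep: "rep (carrier_of M) \<theta> T c \<psi>"
    and const_integral: "integral_functional \<mu> \<tau> constant_on carrier_of M"
begin

text \<open>The coordinate formula, rather than \<open>\<l> (p x)\<close>, is taken as the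
  definition, so that smoothness in \<open>p\<close> and continuity in \<open>x\<close> can be read
  off.\<close>

definition L :: "'x \<Rightarrow> ('x \<Rightarrow> real) \<Rightarrow> real" where
  "L x p = \<theta> p \<bullet> T x - c x - \<psi> p"

lemma L_\<l>: "p \<in> carrier_of M \<Longrightarrow> \<l> (p x) = L x p"
  using repD(6)[OF rep] by (simp add: L_def)

lemma L_in_J: "p \<in> carrier_of M \<Longrightarrow> L x p \<in> J"
  using in_I L_\<l> by (metis imageI)

lemma \<tau>_eq: "p \<in> carrier_of M \<Longrightarrow> \<tau> (p x) = \<kappa> (L x p)"
  using \<kappa>_\<l>[OF in_I] L_\<l> by metis

lemma ev_eq: "p \<in> carrier_of M \<Longrightarrow> ev x p = E (L x p)"
  using E(3)[OF in_I] L_\<l> by (metis ev_def)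

lemma L_eq_sum: "L x p = (\<Sum>i\<in>UNIV. \<xi> i p * T x $ i) - c x - \<psi> p"
  by (simp add: L_def inner_vec_def)

lemma smooth_\<psi>: "smooth \<psi>"
  by (rule repD(4)[OF rep])

lemma smooth_L: "smooth (L x)"
  unfolding L_eq_sum[abs_def]
  by (intro smooth_fun_diff smooth_fun_sum smooth_fun_mult smooth_fun_const openin_carrier
      smooth_coordinate smooth_\<psi>)

lemma vector_field_L:
  assumes V: "V \<in> VF" and p: "p \<in> carrier_of M"
  shows "V p (L x) = (\<Sum>i\<in>UNIV. V p (\<xi> i) * T x $ i) - V p \<psi>"
proof -
  have s: "smooth (\<lambda>p. \<xi> i p * T x $ i)" for i
    by (intro smooth_fun_mult smooth_fun_const openin_carrier smooth_coordinate)
  note s' = smooth_fun_sum[OF openin_carrier, of UNIV "\<lambda>i p. \<xi> i p * T x $ i", OF s]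
  have "V p (L x) = V p (\<lambda>p. (\<Sum>i\<in>UNIV. \<xi> i p * T x $ i) - c x) - V p \<psi>"
    unfolding L_eq_sum[abs_def]
    by (rule vector_field_diff[OF V smooth_fun_diff[OF s' smooth_fun_const[OF openin_carrier]] smooth_\<psi> p])
  also have "V p (\<lambda>p. (\<Sum>i\<in>UNIV. \<xi> i p * T x $ i) - c x) = V p (\<lambda>p. \<Sum>i\<in>UNIV. \<xi> i p * T x $ i)"
    using vector_field_diff[OF V s' smooth_fun_const[OF openin_carrier] p, of "c x"] vector_field_const[OF V p]
    by simp
  also have "\<dots> = (\<Sum>i\<in>UNIV. V p (\<lambda>p. \<xi> i p * T x $ i))"
    by (rule vector_field_sum[OF V s p openin_carrier])
  also have "\<dots> = (\<Sum>i\<in>UNIV. V p (\<xi> i) * T x $ i)"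
    by (intro sum.cong refl vector_field_mult_const(1)[OF V smooth_coordinate p])
  finally show ?thesis .
qed

text \<open>The affine shape in \<open>T x\<close> survives a second differentiation: the
  coefficients are those of \<open>affine_derivative Z V\<close>, and the only other term is
  independent of \<open>x\<close>. This is the source of flatness.\<close>

lemma vector_field_L_L:
  assumes Z: "Z \<in> VF" and V: "V \<in> VF" and p: "p \<in> carrier_of M"
  shows "Z p (\<lambda>q. V q (L x)) = (\<Sum>i\<in>UNIV. Z p (\<lambda>q. V q (\<xi> i)) * T x $ i) - Z p (\<lambda>q. V q \<psi>)"
proof -
  note V\<xi> = vector_field_smooth[OF V smooth_coordinate]
  have s: "smooth (\<lambda>q. V q (\<xi> i) * T x $ i)" for i
    by (intro smooth_fun_mult smooth_fun_const openin_carrier V\<xi>)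
  note s' = smooth_fun_sum[OF openin_carrier, of UNIV "\<lambda>i q. V q (\<xi> i) * T x $ i", OF s]
  have "Z p (\<lambda>q. V q (L x)) = Z p (\<lambda>q. (\<Sum>i\<in>UNIV. V q (\<xi> i) * T x $ i) - V q \<psi>)"
    by (rule vector_field_cong[OF Z vector_field_smooth[OF V smooth_L] p vector_field_L[OF V]])
  also have "\<dots> = Z p (\<lambda>q. \<Sum>i\<in>UNIV. V q (\<xi> i) * T x $ i) - Z p (\<lambda>q. V q \<psi>)"
    by (rule vector_field_diff[OF Z s' vector_field_smooth[OF V smooth_\<psi>] p])
  also have "Z p (\<lambda>q. \<Sum>i\<in>UNIV. V q (\<xi> i) * T x $ i) = (\<Sum>i\<in>UNIV. Z p (\<lambda>q. V q (\<xi> i) * T x $ i))"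
    by (rule vector_field_sum[OF Z s p openin_carrier])
  also have "\<dots> = (\<Sum>i\<in>UNIV. Z p (\<lambda>q. V q (\<xi> i)) * T x $ i)"
    by (intro sum.cong refl vector_field_mult_const(1)[OF Z V\<xi> p])
  finally show ?thesis .
qed

text \<open>At fixed \<open>x\<close>, densities enter the divergence only through
  \<open>L x\<close>, so each differentiation below becomes a derivative in one real variable. The
  function \<open>f\<close> need match \<open>F\<close> on the carrier only.\<close>

lemma vector_field_function_of_L:
  assumes V: "V \<in> VF" and p: "p \<in> carrier_of M" and F: "smooth_on J F"
    and F': "(F has_field_derivative d) (at (L x p))"
    and f: "\<And>q. q \<in> carrier_of M \<Longrightarrow> f q = F (L x q)"
  shows "smooth f" "V p f = d * V p (L x)"
proof -
  have s: "smooth (\<lambda>q. F (L x q))"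
    by (rule smooth_fun_compose[OF smooth_L J(1) F L_in_J])
  then show "smooth f" by (rule smooth_fun_cong) (rule f)
  have "V p (\<lambda>q. F (L x q)) = V p f"
    by (rule vector_field_cong[OF V s p]) (rule f[symmetric])
  then show "V p f = d * V p (L x)"
    using vector_field_compose[OF V smooth_L p J(1) F L_in_J] DERIV_imp_deriv[OF F'] by simp
qed

lemma divergence_ev_eq:
  assumes "p \<in> carrier_of M" "q \<in> carrier_of M"
  shows "divergence_ev h \<tau> x (p, q) = h (\<kappa> (L x p)) - h (\<kappa> (L x q)) - (\<kappa> (L x p) - \<kappa> (L x q)) * L x q"
  using assms deriv_h_\<kappa>[OF L_in_J[OF assms(2)]]
  by (simp add: divergence_ev_def divergence_def ev_def \<tau>_eq)

text \<open>The contributions of \<open>deriv \<kappa>\<close> cancel, since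
  \<open>h (\<kappa> z)\<close> has derivative \<open>z * deriv \<kappa> z\<close>.\<close>

lemma divergence_right:
  assumes W: "W \<in> VF" and p: "p \<in> carrier_of M" and q: "q \<in> carrier_of M"
  shows "W p (\<lambda>q'. divergence_ev h \<tau> x (q, q')) = (\<kappa> (L x p) - \<kappa> (L x q)) * W p (L x)"
proof (rule vector_field_function_of_L(2)[OF W p])
  let ?F = "\<lambda>z. h (\<kappa> (L x q)) - h (\<kappa> z) - (\<kappa> (L x q) - \<kappa> z) * z"
  show "divergence_ev h \<tau> x (q, q') = ?F (L x q')" if "q' \<in> carrier_of M" for q'
    by (rule divergence_ev_eq[OF q that])
  show "smooth_on J ?F"
    by (intro smooth_on_diff[OF J(1)] smooth_on_mult[OF J(1)] smooth_on_const smooth_on_ident h_\<kappa>_smooth \<kappa>_smooth)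
  show "(?F has_real_derivative \<kappa> (L x p) - \<kappa> (L x q)) (at (L x p))"
    using L_in_J[OF p, of x]
    by (auto intro!: derivative_eq_intros h_\<kappa>_derivative \<kappa>_derivative simp: algebra_simps)
qed

lemma divergence_left:
  assumes W: "W \<in> VF" and p: "p \<in> carrier_of M" and q: "q \<in> carrier_of M"
  shows "W p (\<lambda>q'. divergence_ev h \<tau> x (q', q)) = deriv \<kappa> (L x p) * (L x p - L x q) * W p (L x)"
proof (rule vector_field_function_of_L(2)[OF W p])
  let ?F = "\<lambda>z. h (\<kappa> z) - h (\<kappa> (L x q)) - (\<kappa> z - \<kappa> (L x q)) * L x q"
  show "divergence_ev h \<tau> x (q', q) = ?F (L x q')" if "q' \<in> carrier_of M" for q'
    by (rule divergence_ev_eq[OF that q])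
  show "smooth_on J ?F"
    by (intro smooth_on_diff[OF J(1)] smooth_on_mult[OF J(1)] smooth_on_const h_\<kappa>_smooth \<kappa>_smooth)
  show "(?F has_real_derivative deriv \<kappa> (L x p) * (L x p - L x q)) (at (L x p))"
    using L_in_J[OF p, of x]
    by (auto intro!: derivative_eq_intros h_\<kappa>_derivative \<kappa>_derivative simp: algebra_simps)
qed

lemma ht_metric_eq:
  assumes V: "V \<in> VF" and W: "W \<in> VF" and p: "p \<in> carrier_of M"
  shows "ht_metric \<mu> h \<tau> V W p = (\<integral>x. (deriv \<kappa> (L x p) * V p (L x)) * W p (L x) \<partial>\<mu>)"
proof -
  have "V p (\<lambda>q. W p (\<lambda>q'. divergence_ev h \<tau> x (q, q'))) = - (deriv \<kappa> (L x p) * W p (L x)) * V p (L x)" for x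
  proof (rule vector_field_function_of_L(2)[OF V p])
    let ?F = "\<lambda>z. (\<kappa> (L x p) - \<kappa> z) * W p (L x)"
    show "W p (\<lambda>q'. divergence_ev h \<tau> x (q, q')) = ?F (L x q)" if "q \<in> carrier_of M" for q
      by (rule divergence_right[OF W p that])
    show "smooth_on J ?F"
      by (intro smooth_on_diff[OF J(1)] smooth_on_mult[OF J(1)] smooth_on_const \<kappa>_smooth)
    show "(?F has_real_derivative - (deriv \<kappa> (L x p) * W p (L x))) (at (L x p))"
      using L_in_J[OF p, of x] by (auto intro!: derivative_eq_intros \<kappa>_derivative)
  qed
  then show ?thesis by (simp add: ht_metric_def vf_left_def vf_right_def mult_ac)
qed

text \<open>With the first slot differentiated first, \<open>divergence_left\<close> leaves a
  function of the second slot that is affine in \<open>L x\<close>, with slope \<open>- ?a\<close>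
  fixed by \<open>p\<close>. The two remaining derivatives therefore fall on \<open>L x\<close>
  alone and no second derivative of \<open>\<kappa>\<close> appears.\<close>

lemma connection_integrand:
  assumes Z: "Z \<in> VF" and V: "V \<in> VF" and W: "W \<in> VF" and p: "p \<in> carrier_of M"
  shows "vf_right Z (p, p) (\<lambda>z. vf_right V z (\<lambda>y. vf_left W y (divergence_ev h \<tau> x)))
    = - ((deriv \<kappa> (L x p) * W p (L x)) * Z p (\<lambda>q. V q (L x)))"
proof -
  let ?a = "deriv \<kappa> (L x p) * W p (L x)"
  have 1: "V q (\<lambda>q'. W p (\<lambda>q''. divergence_ev h \<tau> x (q'', q'))) = - ?a * V q (L x)"
    if q: "q \<in> carrier_of M" for q
  proof (rule vector_field_function_of_L(2)[OF V q])
    let ?F = "\<lambda>z. deriv \<kappa> (L x p) * (L x p - z) * W p (L x)"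
    show "W p (\<lambda>q''. divergence_ev h \<tau> x (q'', q')) = ?F (L x q')" if "q' \<in> carrier_of M" for q'
      by (rule divergence_left[OF W p that])
    show "smooth_on J ?F"
      by (intro smooth_on_diff[OF J(1)] smooth_on_mult[OF J(1)] smooth_on_const smooth_on_ident)
    show "(?F has_real_derivative - ?a) (at (L x q))"
      by (auto intro!: derivative_eq_intros)
  qed
  have s: "smooth (\<lambda>q. V q (L x))" by (rule vector_field_smooth[OF V smooth_L])
  have "Z p (\<lambda>q. - ?a * V q (L x)) = Z p (\<lambda>q. V q (\<lambda>q'. W p (\<lambda>q''. divergence_ev h \<tau> x (q'', q'))))"
    by (rule vector_field_cong[OF Z smooth_fun_mult[OF smooth_fun_const[OF openin_carrier] s] p]) (rule 1[symmetric])
  then show ?thesis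
    using vector_field_mult_const(2)[OF Z s p, of "- ?a"] by (simp add: vf_left_def vf_right_def)
qed

section \<open>Integrals over the sample space and their derivatives\<close>

lemma continuous_L: "continuous_on UNIV (\<lambda>x. L x p)"
  unfolding L_def using repD(2,3)[OF rep] by (auto intro!: continuous_intros)

lemma continuous_function_of_L:
  assumes "smooth_on J F" "p \<in> carrier_of M"
  shows "continuous_on UNIV (\<lambda>x. F (L x p))"
  by (rule continuous_on_compose2[OF smooth_on_continuous_on[OF assms(1)] continuous_L])
     (use L_in_J[OF assms(2)] in auto)

lemma continuous_T: "continuous_on UNIV (\<lambda>x. T x $ i)"
  using repD(2)[OF rep] by (auto intro!: continuous_intros)

lemma continuous_vector_field_L:
  assumes "V \<in> VF" "p \<in> carrier_of M" shows "continuous_on UNIV (\<lambda>x. V p (L x))"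
  unfolding vector_field_L[OF assms] by (intro continuous_intros continuous_T)

lemma integrable_continuous: "continuous_on UNIV f \<Longrightarrow> integrable \<mu> f" for f :: "'x \<Rightarrow> real"
  by (rule integrable_continuous_compact[OF finite_\<mu> sets_\<mu> cpt])

lemma integral_affine:
  assumes f: "continuous_on UNIV f"
  shows "(\<integral>x. f x * ((\<Sum>i\<in>UNIV. a i * T x $ i) - b) \<partial>\<mu>)
    = (\<Sum>i\<in>UNIV. a i * (\<integral>x. f x * T x $ i \<partial>\<mu>)) - b * (\<integral>x. f x \<partial>\<mu>)"
proof -
  have i: "integrable \<mu> (\<lambda>x. f x * T x $ i)" for i
    by (intro integrable_continuous continuous_intros f continuous_T)
  have "(\<integral>x. f x * ((\<Sum>i\<in>UNIV. a i * T x $ i) - b) \<partial>\<mu>) = (\<integral>x. (\<Sum>i\<in>UNIV. a i * (f x * T x $ i)) - b * f x \<partial>\<mu>)"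
    by (simp add: right_diff_distrib sum_distrib_left mult_ac)
  then show ?thesis using i integrable_continuous[OF f] by simp
qed

text \<open>The weight \<open>w\<close> is 1 for the integrals of \<tau> and of the entropy
  integrand, and a coordinate projection for \<open>\<eta>\<close>.\<close>

lemma integral_function_of_L:
  assumes F: "smooth_on J F" and w: "smooth_on UNIV w"
  defines "G \<equiv> \<lambda>p. \<integral>x. F (L x p) * w (T x) \<partial>\<mu>"
  shows "smooth G"
    and "\<And>V p. V \<in> VF \<Longrightarrow> p \<in> carrier_of M \<Longrightarrow>
      V p G = (\<integral>x. deriv F (L x p) * V p (L x) * w (T x) \<partial>\<mu>)"
proof -
  define \<Omega> where "\<Omega> = \<theta> ` carrier_of M"
  define Y where "Y = (\<lambda>x. (T x, c x))"
  define \<Lambda> where "\<Lambda> = (\<lambda>z :: (real^'n) \<times> (real^'n) \<times> real. fst z \<bullet> fst (snd z) - snd (snd z) - (\<psi> \<circ> \<sigma>) (fst z))"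
  \<comment> \<open>\<open>\<Lambda>\<close> is \<open>L\<close> with \<open>T x\<close> and
    \<open>c x\<close> turned into free variables. As \<open>F\<close> is smooth only on
    \<open>J\<close>, the integrand is considered only where \<open>\<Lambda>\<close> takes values
    in \<open>J\<close>, an open set by continuity.\<close>
  define Q where "Q = {z \<in> \<Omega> \<times> UNIV. \<Lambda> z \<in> J}"
  define \<Phi> where "\<Phi> = (\<lambda>z. F (\<Lambda> z) * w (fst (snd z)))"
  have \<Omega>: "open \<Omega>" unfolding \<Omega>_def by (rule open_image[OF openin_carrier])
  have o: "open (\<Omega> \<times> (UNIV :: ((real^'n) \<times> real) set))" using \<Omega> by (intro open_Times open_UNIV)
  have bl: "bounded_linear (\<lambda>z :: (real^'n) \<times> (real^'n) \<times> real. fst (snd z))"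
    "bounded_linear (\<lambda>z :: (real^'n) \<times> (real^'n) \<times> real. snd (snd z))"
    by (intro bounded_linear_fst_comp bounded_linear_snd_comp bounded_linear_snd)+
  have f: "smooth_on (\<Omega> \<times> UNIV) (fst :: (real^'n) \<times> (real^'n) \<times> real \<Rightarrow> _)"
    by (rule smooth_on_bounded_linear[OF bounded_linear_fst])
  have "smooth_on \<Omega> (\<psi> \<circ> \<sigma>)" using smooth_\<psi> by (simp add: smooth_fun_iff \<Omega>_def)
  then have "smooth_on (\<Omega> \<times> UNIV) (\<lambda>z :: (real^'n) \<times> (real^'n) \<times> real. (\<psi> \<circ> \<sigma>) (fst z))"
    by (rule smooth_on_compose[OF o \<Omega> _ f, rotated]) auto
  then have \<Lambda>: "smooth_on (\<Omega> \<times> UNIV) \<Lambda>"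
    unfolding \<Lambda>_def
    by (rule smooth_on_diff[OF o smooth_on_diff[OF o smooth_on_inner[OF o f smooth_on_bounded_linear[OF bl(1)]]
            smooth_on_bounded_linear[OF bl(2)]]])
  have "Q = (\<Omega> \<times> UNIV) \<inter> \<Lambda> -` J" by (auto simp: Q_def)
  then have Q: "open Q" using continuous_open_preimage[OF smooth_on_continuous_on[OF \<Lambda>] o J(1)] by simp
  have \<Lambda>Q: "smooth_on Q \<Lambda>" by (rule smooth_on_subset[OF \<Lambda>]) (auto simp: Q_def)
  have wQ: "smooth_on Q (\<lambda>z. w (fst (snd z)))"
    by (rule smooth_on_compose[OF Q open_UNIV _ smooth_on_bounded_linear[OF bl(1)] w]) simp
  have "smooth_on Q (\<lambda>z. F (\<Lambda> z))"
    by (rule smooth_on_compose[OF Q J(1) _ \<Lambda>Q F]) (auto simp: Q_def)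
  then have \<Phi>: "smooth_on Q \<Phi>" unfolding \<Phi>_def by (intro smooth_on_mult[OF Q] wQ)
  have \<Lambda>L: "\<Lambda> (\<theta> p, Y x) = L x p" if "p \<in> carrier_of M" for p x
    using that by (simp add: \<Lambda>_def Y_def L_def)
  have \<Omega>Q: "\<Omega> \<times> range Y \<subseteq> Q" using \<Lambda>L L_in_J by (auto simp: Q_def \<Omega>_def)
  have Y: "continuous_on UNIV Y" unfolding Y_def using repD(2,3)[OF rep] by (intro continuous_on_Pair)
  note par = finite_\<mu> sets_\<mu> cpt Y \<Omega> Q \<Omega>Q \<Phi>
  have G: "G p = (\<integral>x. \<Phi> (\<theta> p, Y x) \<partial>\<mu>)" if "p \<in> carrier_of M" for p
    using that by (simp add: G_def \<Phi>_def \<Lambda>L) (simp add: Y_def)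
  show sG: "smooth G"
    by (rule smooth_funI[OF openin_carrier smooth_on_parametric_integral[OF par, unfolded \<Omega>_def]]) (rule G)
  fix V p assume V: "V \<in> VF" and p: "p \<in> carrier_of M"
  have \<theta>p: "\<theta> p \<in> \<Omega>" using p by (simp add: \<Omega>_def)
  have "(G \<circ> \<sigma> has_derivative (\<lambda>v. \<integral>x. frechet_derivative \<Phi> (at (\<theta> p, Y x)) (v, 0) \<partial>\<mu>)) (at (\<theta> p))"
    by (rule has_derivative_transform_within_open[OF has_derivative_parametric_integral[OF par \<theta>p] \<Omega> \<theta>p])
       (auto simp: \<Omega>_def G)
  from vector_field_apply[OF V smooth_at_fun[OF sG p] this]
  have 1: "V p G = (\<integral>x. frechet_derivative \<Phi> (at (\<theta> p, Y x)) (coef V p, 0) \<partial>\<mu>)" .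
  \<comment> \<open>Instead of computing the derivative of \<open>\<Phi>\<close>, note that freezing
    \<open>Y x\<close> gives \<open>F (L x q) * w (T x)\<close> in coordinates; its derivative along
    \<open>V\<close> is known already.\<close>
  have "frechet_derivative \<Phi> (at (\<theta> p, Y x)) (coef V p, 0) = deriv F (L x p) * V p (L x) * w (T x)" for x
  proof -
    have sF: "smooth (\<lambda>q. F (L x q))" by (rule smooth_fun_compose[OF smooth_L J(1) F L_in_J])
    have s: "smooth (\<lambda>q. F (L x q) * w (T x))"
      by (intro smooth_fun_mult sF smooth_fun_const openin_carrier)
    have "((\<lambda>u. (u, Y x)) has_derivative (\<lambda>v. (v, 0))) (at (\<theta> p))"
      by (auto intro!: derivative_eq_intros)
    moreover have "(\<theta> p, Y x) \<in> Q" using \<Omega>Q \<theta>p by auto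
    ultimately have "((\<lambda>u. \<Phi> (u, Y x)) has_derivative (\<lambda>v. frechet_derivative \<Phi> (at (\<theta> p, Y x)) (v, 0))) (at (\<theta> p))"
      using has_derivative_compose[of "\<lambda>u. (u, Y x)" "\<lambda>v. (v, 0)", OF _ smooth_on_has_derivative[OF \<Phi>]] by blast
    then have "((\<lambda>q. F (L x q) * w (T x)) \<circ> \<sigma> has_derivative
        (\<lambda>v. frechet_derivative \<Phi> (at (\<theta> p, Y x)) (v, 0))) (at (\<theta> p))"
      by (rule has_derivative_transform_within_open[OF _ \<Omega> \<theta>p])
         (auto simp: \<Omega>_def \<Phi>_def \<Lambda>L, simp add: Y_def)
    from vector_field_apply[OF V smooth_at_fun[OF s p] this] show ?thesis
      using vector_field_mult_const(1)[OF V sF p, of "w (T x)"] vector_field_compose[OF V smooth_L p J(1) F L_in_J]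
      by simp
  qed
  then show "V p G = (\<integral>x. deriv F (L x p) * V p (L x) * w (T x) \<partial>\<mu>)" using 1 by simp
qed

definition \<eta> :: "'n \<Rightarrow> ('x \<Rightarrow> real) \<Rightarrow> real" where
  "\<eta> i p = (\<integral>x. \<kappa> (L x p) * T x $ i \<partial>\<mu>)"

lemma smooth_\<eta>: "smooth (\<eta> i)"
  and vector_field_\<eta>: "V \<in> VF \<Longrightarrow> p \<in> carrier_of M \<Longrightarrow>
    V p (\<eta> i) = (\<integral>x. deriv \<kappa> (L x p) * V p (L x) * T x $ i \<partial>\<mu>)"
  using integral_function_of_L[OF \<kappa>_smooth smooth_on_bounded_linear[OF bounded_linear_vec_nth]]
  unfolding \<eta>_def[abs_def] by blast+

lemma integral_\<tau>: "p \<in> carrier_of M \<Longrightarrow> integral_functional \<mu> \<tau> p = (\<integral>x. \<kappa> (L x p) \<partial>\<mu>)"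
  by (simp add: integral_functional_def \<tau>_eq)

text \<open>The left side is the derivative along \<open>V\<close> of the constant integral of
  \<tau>. This cancels the \<psi>-terms in metric and connection.\<close>

lemma integral_deriv_\<kappa>_eq_0:
  assumes V: "V \<in> VF" and p: "p \<in> carrier_of M"
  shows "(\<integral>x. deriv \<kappa> (L x p) * V p (L x) \<partial>\<mu>) = 0"
proof -
  obtain k where k: "\<And>q. q \<in> carrier_of M \<Longrightarrow> integral_functional \<mu> \<tau> q = k"
    using const_integral by (auto simp: constant_on_def)
  note G = integral_function_of_L[OF \<kappa>_smooth smooth_on_const[where c = "1 :: real"]]
  have "V p (\<lambda>p. \<integral>x. \<kappa> (L x p) * 1 \<partial>\<mu>) = V p (\<lambda>_. k)"
    by (rule vector_field_cong[OF V G(1) p]) (simp add: integral_\<tau>[symmetric] k)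
  then show ?thesis using G(2)[OF V p] vector_field_const[OF V p] by simp
qed

lemma deriv_\<kappa>_smooth: "smooth_on J (deriv \<kappa>)"
  by (rule smooth_on_real_deriv(1)[OF J(1) \<kappa>_smooth])

text \<open>Leaving \<open>a\<close> and \<open>b\<close> arbitrary covers both
  \<open>V p (L x)\<close> for the metric and \<open>Z p (\<lambda>q. V q (L x))\<close> for the
  connection.\<close>

lemma integral_deriv_\<kappa>_affine:
  assumes W: "W \<in> VF" and p: "p \<in> carrier_of M"
  shows "(\<integral>x. (deriv \<kappa> (L x p) * W p (L x)) * ((\<Sum>i\<in>UNIV. a i * T x $ i) - b) \<partial>\<mu>)
    = (\<Sum>i\<in>UNIV. a i * W p (\<eta> i))"
proof -
  have "continuous_on UNIV (\<lambda>x. deriv \<kappa> (L x p) * W p (L x))"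
    by (intro continuous_intros continuous_function_of_L[OF deriv_\<kappa>_smooth p] continuous_vector_field_L[OF W p])
  from integral_affine[OF this, of a b] show ?thesis
    by (simp add: vector_field_\<eta>[OF W p] integral_deriv_\<kappa>_eq_0[OF W p])
qed

section \<open>Metric, connection and potential in dual coordinates\<close>

lemma ht_metric_sym:
  "V \<in> VF \<Longrightarrow> W \<in> VF \<Longrightarrow> p \<in> carrier_of M \<Longrightarrow> ht_metric \<mu> h \<tau> V W p = ht_metric \<mu> h \<tau> W V p"
  by (simp add: ht_metric_eq mult_ac)

lemma ht_metric_dual:
  assumes V: "V \<in> VF" and W: "W \<in> VF" and p: "p \<in> carrier_of M"
  shows "ht_metric \<mu> h \<tau> V W p = (\<Sum>i\<in>UNIV. V p (\<xi> i) * W p (\<eta> i))"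
  unfolding ht_metric_sym[OF V W p] ht_metric_eq[OF W V p] vector_field_L[OF V p]
  by (rule integral_deriv_\<kappa>_affine[OF W p])

text \<open>The set where \<open>f\<close> does not vanish is open and contains \<open>x0\<close>,
  so full support gives it positive measure.\<close>

lemma integral_continuous_pos:
  fixes f :: "'x \<Rightarrow> real"
  assumes f: "continuous_on UNIV f" "\<And>x. f x \<ge> 0" "f x0 \<noteq> 0"
  shows "(\<integral>x. f x \<partial>\<mu>) > 0"
proof (rule ccontr)
  assume "\<not> (\<integral>x. f x \<partial>\<mu>) > 0"
  moreover have "(\<integral>x. f x \<partial>\<mu>) \<ge> 0" using f(2) by simp
  ultimately have "(\<integral>x. f x \<partial>\<mu>) = 0" by simp
  then have ae: "AE x in \<mu>. f x = 0"
    using integral_nonneg_eq_0_iff_AE[OF integrable_continuous[OF f(1)]] f(2) by simp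
  have "{x. f x \<noteq> 0} = f -` (- {0})" by auto
  then have o: "open {x. f x \<noteq> 0}" using open_vimage[OF _ f(1), of "- {0}"] by (simp add: open_Compl)
  then have "emeasure \<mu> {x. f x \<noteq> 0} > 0"
    using support f(3) unfolding measure_support_def by blast
  moreover have "{x. f x \<noteq> 0} \<in> sets \<mu>" using o sets_\<mu> by simp
  ultimately show False using ae by (simp add: AE_iff_measurable[OF _ refl] space_\<mu>)
qed

text \<open>Condition (d) of a statistical model provides a point \<open>x0\<close> with
  \<open>V p (ev x0) \<noteq> 0\<close>. Since \<open>ev x0\<close> is \<open>E\<close> composed
  with \<open>L x0\<close>, also \<open>V p (L x0) \<noteq> 0\<close>, and the integrand is a
  positive factor times the square of this.\<close>

lemma ht_metric_pos:
  assumes V: "V \<in> VF" and p: "p \<in> carrier_of M" and nz: "V p \<noteq> (\<lambda>f. 0)"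
  shows "ht_metric \<mu> h \<tau> V V p > 0"
proof -
  have "statistical_model \<mu> M" using family by (simp add: exponential_family_def)
  then obtain N where "\<forall>V\<in>VF. \<forall>p\<in>carrier_of M. (\<forall>x. x \<notin> N \<longrightarrow> V p (ev x) = 0) \<longleftrightarrow> V p = (\<lambda>f. 0)"
    unfolding statistical_model_def by blast
  then obtain x0 where x0: "V p (ev x0) \<noteq> 0" using V p nz by blast
  have "V p (ev x0) = deriv E (L x0 p) * V p (L x0)"
    by (rule vector_field_function_of_L(2)[OF V p J(2) smooth_on_real_deriv(2)[OF J L_in_J[OF p]] ev_eq])
  then have nz: "V p (L x0) \<noteq> 0" using x0 by auto
  show ?thesis
    unfolding ht_metric_eq[OF V V p]
  proof (rule integral_continuous_pos)
    show "continuous_on UNIV (\<lambda>x. deriv \<kappa> (L x p) * V p (L x) * V p (L x))"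
      by (intro continuous_intros continuous_function_of_L[OF deriv_\<kappa>_smooth p] continuous_vector_field_L[OF V p])
    show "0 \<le> deriv \<kappa> (L x p) * V p (L x) * V p (L x)" for x
      using \<kappa>_deriv_pos[OF L_in_J[OF p, of x]] by (simp add: mult.assoc)
    show "deriv \<kappa> (L x0 p) * V p (L x0) * V p (L x0) \<noteq> 0"
      using \<kappa>_deriv_pos[OF L_in_J[OF p, of x0]] nz by simp
  qed
qed

text \<open>Test the difference of the two fields against itself.\<close>

lemma ht_metric_nondegenerate:
  assumes Y: "Y \<in> VF" and Y': "Y' \<in> VF"
    and eq: "\<And>W p. W \<in> VF \<Longrightarrow> p \<in> carrier_of M \<Longrightarrow> ht_metric \<mu> h \<tau> Y W p = ht_metric \<mu> h \<tau> Y' W p"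
  shows "Y = Y'"
proof (rule vector_field_eqI[OF Y Y'])
  fix p i assume p: "p \<in> carrier_of M"
  define D where "D = vf_add Y (vf_mult (\<lambda>_. - 1) Y')"
  have D: "D \<in> VF" unfolding D_def
    by (intro vf_add_closed vf_mult_closed Y Y' smooth_fun_const openin_carrier)
  have D_apply: "D p f = Y p f - Y' p f" for f by (simp add: D_def vf_add_def vf_mult_def)
  have "ht_metric \<mu> h \<tau> D D p = ht_metric \<mu> h \<tau> Y D p - ht_metric \<mu> h \<tau> Y' D p"
    unfolding ht_metric_dual[OF D D p] ht_metric_dual[OF Y D p] ht_metric_dual[OF Y' D p]
    by (simp add: D_apply[of "\<xi> _"] left_diff_distrib sum_subtractf)
  then have "\<not> ht_metric \<mu> h \<tau> D D p > 0" using eq[OF D p] by simp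
  then have "D p = (\<lambda>f. 0)" using ht_metric_pos[OF D p] by blast
  then show "Y p (\<xi> i) = Y' p (\<xi> i)" using D_apply[of "\<xi> i"] by simp
qed

text \<open>The integral prescribed for the connection is the metric paired with
  \<open>affine_derivative Z V\<close>, so this field solves the defining condition; nondegeneracy
  makes it the only solution.\<close>

lemma ht_connection_eq:
  assumes Z: "Z \<in> VF" and V: "V \<in> VF"
  shows "ht_connection \<mu> h \<tau> M Z V = affine_derivative Z V"
proof -
  have rhs: "- (\<integral>x. vf_right Z (p, p) (\<lambda>z. vf_right V z (\<lambda>y. vf_left W y (divergence_ev h \<tau> x))) \<partial>\<mu>)
      = ht_metric \<mu> h \<tau> (affine_derivative Z V) W p" if W: "W \<in> VF" and p: "p \<in> carrier_of M" for W p
    unfolding connection_integrand[OF Z V W p] vector_field_L_L[OF Z V p] 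
      ht_metric_dual[OF affine_derivative_closed[OF Z V] W p] affine_derivative_coordinate[OF p]
    using integral_deriv_\<kappa>_affine[OF W p] by simp
  show ?thesis
    unfolding ht_connection_def
  proof (rule the_equality)
    show "affine_derivative Z V \<in> VF \<and> (\<forall>W\<in>VF. \<forall>p\<in>carrier_of M. ht_metric \<mu> h \<tau> (affine_derivative Z V) W p =
      - (\<integral>x. vf_right Z (p, p) (\<lambda>z. vf_right V z (\<lambda>y. vf_left W y (divergence_ev h \<tau> x))) \<partial>\<mu>))"
      using rhs affine_derivative_closed[OF Z V] by simp
    fix Y assume "Y \<in> VF \<and> (\<forall>W\<in>VF. \<forall>p\<in>carrier_of M. ht_metric \<mu> h \<tau> Y W p =
      - (\<integral>x. vf_right Z (p, p) (\<lambda>z. vf_right V z (\<lambda>y. vf_left W y (divergence_ev h \<tau> x))) \<partial>\<mu>))"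
    then show "Y = affine_derivative Z V"
      using rhs by (intro ht_metric_nondegenerate affine_derivative_closed Z V) auto
  qed
qed

definition potential :: "('x \<Rightarrow> real) \<Rightarrow> real" where
  "potential p = - integral_functional \<mu> (entropy_integrand h \<tau>) p + \<psi> p * integral_functional \<mu> \<tau> p"

text \<open>With the integral of \<tau> equal to \<open>k\<close>, the potential is
  \<open>\<psi> * k - S\<close>. By \<open>conjugate_derivative\<close>, \<open>V S\<close> is minus
  the integral of \<open>\<kappa> (L x p) * V p (L x)\<close>; its \<psi>-part
  \<open>k * V p \<psi>\<close> cancels the derivative of \<open>\<psi> * k\<close>, and the
  \<theta>-part is the asserted sum.\<close>

lemma smooth_potential: "smooth potential"
  and vector_field_potential: "V \<in> VF \<Longrightarrow> p \<in> carrier_of M \<Longrightarrow>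
    V p potential = (\<Sum>i\<in>UNIV. V p (\<xi> i) * \<eta> i p)"
proof -
  let ?F = "\<lambda>z. - \<kappa> z * z + h (\<kappa> z)"
  define S where "S = (\<lambda>p. \<integral>x. ?F (L x p) * 1 \<partial>\<mu>)"
  have F: "smooth_on J ?F"
    by (intro smooth_on_add[OF J(1)] smooth_on_mult[OF J(1)] smooth_on_minus[OF J(1)] smooth_on_ident
        \<kappa>_smooth h_\<kappa>_smooth)
  note S = integral_function_of_L[OF F smooth_on_const[where c = "1 :: real"], folded S_def]
  obtain k where k: "\<And>q. q \<in> carrier_of M \<Longrightarrow> integral_functional \<mu> \<tau> q = k"
    using const_integral by (auto simp: constant_on_def)
  have eq: "potential q = \<psi> q * k - S q" if "q \<in> carrier_of M" for q
    using that entropy_integrand_\<l>[OF in_I[OF that]] L_\<l>[OF that]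
    by (simp add: potential_def k S_def integral_functional_def[of _ "entropy_integrand h \<tau>"])
  have s: "smooth (\<lambda>q. \<psi> q * k)" by (intro smooth_fun_mult smooth_\<psi> smooth_fun_const openin_carrier)
  note s' = smooth_fun_diff[OF s S(1)]
  show "smooth potential" by (rule smooth_fun_cong[OF s' eq])
  assume V: "V \<in> VF" and p: "p \<in> carrier_of M"
  have VS: "V p S = - (\<integral>x. \<kappa> (L x p) * V p (L x) \<partial>\<mu>)"
    using S(2)[OF V p] DERIV_imp_deriv[OF conjugate_derivative[OF L_in_J[OF p]]] by simp
  have "V p potential = V p (\<lambda>q. \<psi> q * k - S q)"
    by (rule vector_field_cong[OF V s' p, symmetric]) (rule eq[symmetric])
  also have "\<dots> = V p \<psi> * k - V p S"
    using vector_field_diff[OF V s S(1) p] vector_field_mult_const(1)[OF V smooth_\<psi> p] by simp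
  also have "\<dots> = (\<Sum>i\<in>UNIV. V p (\<xi> i) * \<eta> i p)"
    unfolding VS vector_field_L[OF V p] integral_affine[OF continuous_function_of_L[OF \<kappa>_smooth p]]
    using k[OF p] integral_\<tau>[OF p] by (simp add: \<eta>_def)
  finally show "V p potential = (\<Sum>i\<in>UNIV. V p (\<xi> i) * \<eta> i p)" .
qed

theorem hessian_structure_and_potential:
  "global_potential M (ht_metric \<mu> h \<tau>) (ht_connection \<mu> h \<tau> M) potential"
  "hessian_structure M (ht_metric \<mu> h \<tau>) (ht_connection \<mu> h \<tau> M)"
proof -
  note * = hessian_structure_dual_coordinates[where nab = "ht_connection \<mu> h \<tau> M" and g = "ht_metric \<mu> h \<tau>"
      and \<eta> = \<eta> and \<Phi> = potential]
  show "global_potential M (ht_metric \<mu> h \<tau>) (ht_connection \<mu> h \<tau> M) potential"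
    by (rule *(1)) (rule ht_connection_eq smooth_\<eta> ht_metric_dual ht_metric_sym ht_metric_pos
        smooth_potential vector_field_potential; assumption)+
  show "hessian_structure M (ht_metric \<mu> h \<tau>) (ht_connection \<mu> h \<tau> M)"
    by (rule *(2)) (rule ht_connection_eq smooth_\<eta> ht_metric_dual ht_metric_sym ht_metric_pos
        smooth_potential vector_field_potential; assumption)+
qed

end

theorem theorem1p3:
  fixes \<mu> :: "'x::topological_space measure"
    and h \<tau> :: "real \<Rightarrow> real" and I :: "real set"
    and M :: "('x \<Rightarrow> real, 'n::finite) manifold"
  assumes "radon_measure \<mu>" and "measure_support \<mu> = UNIV"
    and "(h, \<tau>, I) \<in> admissible_triples"
    and "exponential_family \<mu> h \<tau> I M"
    and "compact (UNIV :: 'x set)"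
    and "integral_functional \<mu> \<tau> constant_on carrier_of M"
  shows "hessian_structure M (ht_metric \<mu> h \<tau>) (ht_connection \<mu> h \<tau> M) \<and>
    (\<exists>\<psi>. global_exp_normalization h \<tau> I M \<psi>) \<and>
    (\<forall>\<psi>. global_exp_normalization h \<tau> I M \<psi> \<longrightarrow>
       global_potential M (ht_metric \<mu> h \<tau>) (ht_connection \<mu> h \<tau> M)
         (\<lambda>p. - integral_functional \<mu> (entropy_integrand h \<tau>) p
               + \<psi> p * integral_functional \<mu> \<tau> p))"
proof -
  interpret compact_exponential_family h \<tau> I \<mu> M
    using assms by unfold_locales
  have *: "hessian_structure M (ht_metric \<mu> h \<tau>) (ht_connection \<mu> h \<tau> M)"
    "global_potential M (ht_metric \<mu> h \<tau>) (ht_connection \<mu> h \<tau> M)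
         (\<lambda>p. - integral_functional \<mu> (entropy_integrand h \<tau>) p + \<psi> p * integral_functional \<mu> \<tau> p)"
    if r: "exp_representation h \<tau> I M (carrier_of M) \<theta> T c \<psi>" for \<theta> T c \<psi>
  proof -
    interpret global_exponential_family h \<tau> I \<mu> M \<theta> T c \<psi>
      using is_manifold repD(1)[OF r] r assms(6) by unfold_locales
    show "hessian_structure M (ht_metric \<mu> h \<tau>) (ht_connection \<mu> h \<tau> M)"
      by (rule hessian_structure_and_potential(2))
    show "global_potential M (ht_metric \<mu> h \<tau>) (ht_connection \<mu> h \<tau> M)
         (\<lambda>p. - integral_functional \<mu> (entropy_integrand h \<tau>) p + \<psi> p * integral_functional \<mu> \<tau> p)"
      using hessian_structure_and_potential(1) unfolding potential_def[abs_def] .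
  qed
  \<comment> \<open>Metric and connection do not refer to a representation, so one of them settles
    the Hessian structure; the potential is obtained separately for every representation.\<close>
  obtain \<theta> T c \<psi> where "exp_representation h \<tau> I M (carrier_of M) \<theta> T c \<psi>"
    using global_representation by blast
  then show ?thesis using *(1) *(2) unfolding global_exp_normalization_def by blast
qed

end
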